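(* On functionals of the fields $(\mathbf{B},\mathbf{D},\psi,\phi)$, with $\mathbf{B}(\mathbf{x}),\mathbf{D}(\mathbf{x})\in\mathbb{R}^3$ and $\psi(\mathbf{x}),\phi(\mathbf{x})\in\mathbb{R}$, consider the bracket $$\{\mathcal{A},\mathcal{B}\}=\int\Big(\big[\mathcal{A}_{D_k}(\epsilon_{kij}\partial_i\mathcal{B}_{B_j}-\partial_k\mathcal{B}_\psi)-(\epsilon_{kij}\partial_i\mathcal{A}_{B_j}-\partial_k\mathcal{A}_\psi)\mathcal{B}_{D_k}\big]+\big[\mathcal{A}_\phi(-\partial_k\mathcal{B}_{B_k})-(-\partial_k\mathcal{A}_{B_k})\mathcal{B}_\phi\big]\Big)\mathrm{d}\mathbf{x}.$$ This is a (non-canonical) Poisson bracket; in particular, the Jacobi identity holds for it. Moreover, the bracket generates the nonlinear Maxwell-GLM system: after integration by parts it takes the form $$\{\mathcal{A},\mathcal{B}\}=\int\Big(\mathcal{A}_{B_k}(-\epsilon_{kij}\partial_i\mathcal{B}_{D_j}-\partial_k\mathcal{B}_\phi)+\mathcal{A}_\phi(-\partial_k\mathcal{B}_{B_k})+\mathcal{A}_{D_k}(\epsilon_{kij}\partial_i\mathcal{B}_{B_j}-\partial_k\mathcal{B}_\psi)+\mathcal{A}_\psi(-\partial_k\mathcal{B}_{D_k})\Big)\mathrm{d}\mathbf{x},$$ and the evolution law $\frac{\partial\mathcal{A}}{\partial t}=\{\mathcal{A},\mathcal{E}\}$ for arbitrary functionals $\mathcal{A}$, where $\mathcal{E}$ is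 the energy of the system, yields $$\partial_tB_k+\epsilon_{kij}\partial_i\mathcal{E}_{D_j}+\partial_k\mathcal{E}_\phi=0,\qquad \partial_t\phi+\partial_k\mathcal{E}_{B_k}=0,$$ $$\partial_tD_k-\epsilon_{kij}\partial_i\mathcal{E}_{B_j}+\partial_k\mathcal{E}_\psi=0,\qquad \partial_t\psi+\partial_k\mathcal{E}_{D_k}=0.$$
   Context: Space is three-dimensional, $\partial_k=\partial/\partial x_k$, repeated indices are summed over $1,2,3$, and $\epsilon_{kij}$ is the Levi-Civita symbol. $\mathcal{A}$ and $\mathcal{B}$ are arbitrary sufficiently smooth functionals of the variables $(B_k,D_k,\psi,\phi)$ and possibly of their first spatial gradients; subscripts denote functional derivatives, e.g. $\mathcal{A}_{B_k}=\delta\mathcal{A}/\delta B_k$. It is then assumed that the functionals do not depend on the gradients of the fields, so that their functional derivatives equal the partial derivatives, e.g. $\mathcal{A}_{B_k}=\partial\mathcal{A}/\partial B_k$. The energy is given by a potential $\mathcal{E}(\mathbf{D},\mathbf{B},\phi,\psi)$, the same symbol being used for the energy functional and its density. The time derivative of a functional is understood as $\frac{\partial\mathcal{A}}{\partial t}=\int\big(\mathcal{A}_{B_k}\partial_tB_k+\mathcal{A}_\phi\partial_t\phi+\mathcal{A}_{D_k}\partial_tD_k+\mathcal{A}_\psi\partial_t\psi\big)\mathrm{d}\mathbf{x}$. *)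

theory Defs
  imports "HOL-Analysis.Analysis"
begin

section \<open>Fields\<close>

type_synonym space = "real^3"

text \<open>A point value of the fields, in the order \<open>(B, D, \<psi>, \<phi>)\<close>. The inner product on this
  product type is the sum of the inner products of the four components.\<close>

type_synonym state = "(real^3) \<times> (real^3) \<times> real \<times> real"

type_synonym field = "space \<Rightarrow> state"

type_synonym functional = "field \<Rightarrow> real"

definition comp_B :: "state \<Rightarrow> real^3" where "comp_B w = fst w"
definition comp_D :: "state \<Rightarrow> real^3" where "comp_D w = fst (snd w)"
definition comp_psi :: "state \<Rightarrow> real" where "comp_psi w = fst (snd (snd w))"
definition comp_phi :: "state \<Rightarrow> real" where "comp_phi w = snd (snd (snd w))"

text \<open>\<open>\<partial>f/\<partial>x\<^sub>k\<close>\<close>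

definition pd :: "3 \<Rightarrow> (space \<Rightarrow> 'b::real_normed_vector) \<Rightarrow> space \<Rightarrow> 'b" where
  "pd k f x = vector_derivative (\<lambda>h. f (x + h *\<^sub>R axis k 1)) (at 0)"

definition levi_civita :: "3 \<Rightarrow> 3 \<Rightarrow> 3 \<Rightarrow> real" where
  "levi_civita k i j =
    (if (k, i, j) \<in> {(1, 2, 3), (2, 3, 1), (3, 1, 2)} then 1
     else if (k, i, j) \<in> {(1, 3, 2), (3, 2, 1), (2, 1, 3)} then -1 else 0)"


section \<open>Smoothness\<close>

text \<open>\<open>C\<^sup>m\<close> in the sense that all iterated partial derivatives up to order \<open>m\<close> exist and are
  continuous. The coordinate directions are given by a set \<open>T\<close> of translations
  \<open>\<tau> p h\<close> (the point \<open>p\<close> moved by \<open>h\<close> along one coordinate), so that the same notion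
  applies to Euclidean spaces and to parametrised families of fields.\<close>

primrec Ck_along ::
    "('p::topological_space \<Rightarrow> real \<Rightarrow> 'p) set \<Rightarrow> nat \<Rightarrow> ('p \<Rightarrow> 'b::real_normed_vector) \<Rightarrow> bool" where
  "Ck_along T 0 f \<longleftrightarrow> continuous_on UNIV f"
| "Ck_along T (Suc m) f \<longleftrightarrow> continuous_on UNIV f \<and>
    (\<forall>\<tau>\<in>T. (\<forall>p. (\<lambda>h. f (\<tau> p h)) differentiable (at 0)) \<and>
      Ck_along T m (\<lambda>p. vector_derivative (\<lambda>h. f (\<tau> p h)) (at 0)))"

definition smooth :: "('a::euclidean_space \<Rightarrow> 'b::real_normed_vector) \<Rightarrow> bool" where
  "smooth f \<longleftrightarrow> (\<forall>m. Ck_along {(\<lambda>p h. p + h *\<^sub>R b) | b. b \<in> Basis} m f)"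

text \<open>The space of field configurations: compactly supported smooth fields, so that all
  boundary terms vanish. It is a vector space, hence also the space of variations.\<close>

definition fields :: "field set" where
  "fields = {u. smooth u \<and> (\<exists>R. \<forall>x. R \<le> norm x \<longrightarrow> u x = 0)}"

text \<open>A smooth family \<open>w\<^sub>s\<close> of functions on space, depending on finitely many real parameters
  \<open>s 0, \<dots>, s (n - 1)\<close>; it is required to be jointly smooth in \<open>(s, x)\<close>. (On functions of
  \<open>s 0, \<dots>, s (n - 1)\<close> only, continuity in the product topology of \<open>nat \<Rightarrow> real\<close> is continuity
  on \<open>n\<close>-dimensional Euclidean space.)\<close>

definition smooth_family :: "((nat \<Rightarrow> real) \<Rightarrow> space \<Rightarrow> 'b::real_normed_vector) \<Rightarrow> bool" where
  "smooth_family w \<longleftrightarrow>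
    (\<exists>n. \<forall>s s'. (\<forall>i<n. s i = s' i) \<longrightarrow> w s = w s') \<and>
    (\<forall>m. Ck_along
      ({(\<lambda>(s, x) h. (s(i := s i + h), x)) | i. True} \<union>
       {(\<lambda>(s, x) h. (s, x + h *\<^sub>R b)) | b. b \<in> Basis}) m (\<lambda>(s, x). w s x))"

text \<open>Smooth families of field configurations: the supports are locally uniformly bounded.\<close>

definition field_family :: "((nat \<Rightarrow> real) \<Rightarrow> field) \<Rightarrow> bool" where
  "field_family u \<longleftrightarrow> smooth_family u \<and>
    (\<forall>s0. \<exists>U R. open U \<and> s0 \<in> U \<and> (\<forall>s\<in>U. \<forall>x. R \<le> norm x \<longrightarrow> u s x = 0))"

text \<open>Smooth families of functions that are constant near infinity. This is the behaviour of
  \<open>x \<mapsto> e' (u x)\<close> for a compactly supported field \<open>u\<close>.\<close>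

definition asymp_const_family :: "((nat \<Rightarrow> real) \<Rightarrow> field) \<Rightarrow> bool" where
  "asymp_const_family w \<longleftrightarrow> smooth_family w \<and>
    (\<forall>s0. \<exists>U R. open U \<and> s0 \<in> U \<and>
      (\<forall>s\<in>U. \<forall>x y. R \<le> norm x \<longrightarrow> R \<le> norm y \<longrightarrow> w s x = w s y))"


section \<open>Functionals and functional derivatives\<close>

definition has_func_deriv :: "functional \<Rightarrow> field \<Rightarrow> field \<Rightarrow> bool" where
  "has_func_deriv F u g \<longleftrightarrow> continuous_on UNIV g \<and>
    (\<forall>v\<in>fields. ((\<lambda>\<epsilon>. F (\<lambda>x. u x + \<epsilon> *\<^sub>R v x)) has_real_derivative
      (\<integral>x. g x \<bullet> v x \<partial>lborel)) (at 0))"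

text \<open>The continuous representative is unique by the fundamental lemma of the calculus of
  variations.\<close>

definition func_deriv :: "functional \<Rightarrow> field \<Rightarrow> field" where
  "func_deriv F u = (THE g. has_func_deriv F u g)"

definition fd_B :: "functional \<Rightarrow> field \<Rightarrow> 3 \<Rightarrow> space \<Rightarrow> real" where
  "fd_B F u k x = comp_B (func_deriv F u x) $ k"
definition fd_D :: "functional \<Rightarrow> field \<Rightarrow> 3 \<Rightarrow> space \<Rightarrow> real" where
  "fd_D F u k x = comp_D (func_deriv F u x) $ k"
definition fd_psi :: "functional \<Rightarrow> field \<Rightarrow> space \<Rightarrow> real" where
  "fd_psi F u x = comp_psi (func_deriv F u x)"
definition fd_phi :: "functional \<Rightarrow> field \<Rightarrow> space \<Rightarrow> real" where
  "fd_phi F u x = comp_phi (func_deriv F u x)"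

text \<open>Sufficiently smooth functionals: the functional derivative exists at every field
  configuration and depends smoothly on it, i.e. it turns smooth finite-parameter families of
  field configurations into smooth families. Gradients of the fields of any order may occur in
  such a functional, as they do in the bracket of two functionals.\<close>

definition smooth_functionals :: "functional set" where
  "smooth_functionals = {F.
    (\<forall>u\<in>fields. \<exists>g. has_func_deriv F u g) \<and>
    (\<forall>u. field_family u \<longrightarrow> asymp_const_family (\<lambda>s. func_deriv F (u s)))}"

text \<open>Local functionals with a density depending on position, on the fields, and on their first
  gradients (\<open>p $ k\<close> is the value of \<open>\<partial>\<^sub>k u\<close>). Explicit dependence on the position is
  confined to a bounded region, and the density of the zero field vanishes outside it, so that
  the integral is finite.\<close>

type_synonym density = "space \<times> state \<times> (state^3) \<Rightarrow> real"

definition admissible_density :: "density \<Rightarrow> bool" where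
  "admissible_density a \<longleftrightarrow> smooth a \<and>
    (\<exists>R. (\<forall>x y w p. R \<le> norm x \<longrightarrow> R \<le> norm y \<longrightarrow> a (x, w, p) = a (y, w, p)) \<and>
         (\<forall>x. R \<le> norm x \<longrightarrow> a (x, 0, 0) = 0))"

definition gradient_free :: "density \<Rightarrow> bool" where
  "gradient_free a \<longleftrightarrow> (\<forall>x w p p'. a (x, w, p) = a (x, w, p'))"

definition local_functional :: "density \<Rightarrow> functional" where
  "local_functional a u = (\<integral>x. a (x, u x, (\<chi> k. pd k u x)) \<partial>lborel)"


section \<open>The bracket\<close>

definition bracket :: "functional \<Rightarrow> functional \<Rightarrow> functional" where
  "bracket F G u = (\<integral>x.
      (\<Sum>k\<in>UNIV.
          fd_D F u k x * ((\<Sum>i\<in>UNIV. \<Sum>j\<in>UNIV. levi_civita k i j * pd i (fd_B G u j) x)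
                            - pd k (fd_psi G u) x)
        - ((\<Sum>i\<in>UNIV. \<Sum>j\<in>UNIV. levi_civita k i j * pd i (fd_B F u j) x)
                            - pd k (fd_psi F u) x) * fd_D G u k x)
    + (fd_phi F u x * (- (\<Sum>k\<in>UNIV. pd k (fd_B G u k) x))
        - (- (\<Sum>k\<in>UNIV. pd k (fd_B F u k) x)) * fd_phi G u x) \<partial>lborel)"

text \<open>\<open>br\<close> is a Poisson bracket on the algebra \<open>S\<close> of functionals on the configuration
  space \<open>X\<close>.\<close>

definition poisson_bracket_on ::
    "'x set \<Rightarrow> ('x \<Rightarrow> real) set \<Rightarrow> (('x \<Rightarrow> real) \<Rightarrow> ('x \<Rightarrow> real) \<Rightarrow> ('x \<Rightarrow> real)) \<Rightarrow> bool" where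
  "poisson_bracket_on X S br \<longleftrightarrow>
    (\<forall>F\<in>S. \<forall>G\<in>S. \<forall>c. (\<lambda>u. c * F u + G u) \<in> S \<and> (\<lambda>u. F u * G u) \<in> S \<and> br F G \<in> S) \<and>
    (\<forall>F\<in>S. \<forall>G\<in>S. \<forall>H\<in>S. \<forall>c. \<forall>u\<in>X.
        br (\<lambda>u. c * F u + G u) H u = c * br F H u + br G H u
      \<and> br H (\<lambda>u. c * F u + G u) u = c * br H F u + br H G u) \<and>
    (\<forall>F\<in>S. \<forall>G\<in>S. \<forall>u\<in>X. br F G u = - br G F u) \<and>
    (\<forall>F\<in>S. \<forall>G\<in>S. \<forall>H\<in>S. \<forall>u\<in>X.
        br (\<lambda>u. F u * G u) H u = F u * br G H u + br F H u * G u) \<and>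
    (\<forall>F\<in>S. \<forall>G\<in>S. \<forall>H\<in>S. \<forall>u\<in>X.
        br (br F G) H u + br (br G H) F u + br (br H F) G u = 0)"


section \<open>Evolution\<close>

text \<open>A curve of field configurations, on an open set of times, with a time derivative.\<close>

definition field_evolution :: "real set \<Rightarrow> (real \<Rightarrow> field) \<Rightarrow> bool" where
  "field_evolution I q \<longleftrightarrow> open I \<and>
    (\<forall>t\<in>I. q t \<in> fields \<and>
      (\<exists>v\<in>fields. \<forall>x. ((\<lambda>\<tau>. q \<tau> x) has_vector_derivative v x) (at t)))"

definition dt_B :: "(real \<Rightarrow> field) \<Rightarrow> real \<Rightarrow> 3 \<Rightarrow> space \<Rightarrow> real" where
  "dt_B q t k x = deriv (\<lambda>\<tau>. comp_B (q \<tau> x) $ k) t"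
definition dt_D :: "(real \<Rightarrow> field) \<Rightarrow> real \<Rightarrow> 3 \<Rightarrow> space \<Rightarrow> real" where
  "dt_D q t k x = deriv (\<lambda>\<tau>. comp_D (q \<tau> x) $ k) t"
definition dt_psi :: "(real \<Rightarrow> field) \<Rightarrow> real \<Rightarrow> space \<Rightarrow> real" where
  "dt_psi q t x = deriv (\<lambda>\<tau>. comp_psi (q \<tau> x)) t"
definition dt_phi :: "(real \<Rightarrow> field) \<Rightarrow> real \<Rightarrow> space \<Rightarrow> real" where
  "dt_phi q t x = deriv (\<lambda>\<tau>. comp_phi (q \<tau> x)) t"

definition dt_functional :: "functional \<Rightarrow> (real \<Rightarrow> field) \<Rightarrow> real \<Rightarrow> real" where
  "dt_functional F q t = (\<integral>x.
      (\<Sum>k\<in>UNIV. fd_B F (q t) k x * dt_B q t k x) + fd_phi F (q t) x * dt_phi q t x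
    + (\<Sum>k\<in>UNIV. fd_D F (q t) k x * dt_D q t k x) + fd_psi F (q t) x * dt_psi q t x \<partial>lborel)"

end

theory Submission
  imports Defs
begin

text \<open>
  Write \<open>F' u\<close> for the functional derivative of \<open>F\<close> at \<open>u\<close>. The proof rests on the observation that
  the bracket is \<open>\<integral> F' u \<bullet> \<J> (G' u)\<close> for a first-order differential operator
  \<open>\<J> = (\<Sum>k. J\<^sub>k \<partial>\<^sub>k)\<close> whose coefficients \<open>J\<^sub>k\<close> are constant symmetric matrices
  (\<open>ham_matrix\<close>, \<open>ham_op\<close>). Functional derivatives are constant near infinity, so integration by
  parts produces no boundary terms and \<open>\<J>\<close> is skew-adjoint. The bracket as it is stated pairs only
  the \<open>(D, \<phi>)\<close> components of \<open>F' u\<close> with \<open>\<J> (G' u)\<close>, minus the same expression with \<open>F\<close>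
  and \<open>G\<close> exchanged. As every \<open>J\<^sub>k\<close> exchanges the \<open>(D, \<phi>)\<close> and the \<open>(B, \<psi>)\<close> components, one
  integration by parts (\<open>graded_parts\<close>) turns this into the full pairing, which is the second form of
  the bracket. Antisymmetry is the skew-adjointness of \<open>\<J>\<close>; bilinearity and the Leibniz rule come
  from the rules for functional derivatives.

  For the Jacobi identity put \<open>X\<^sub>G = \<J> (G' u)\<close>. Since \<open>\<J>\<close> does not depend on the field, the
  derivative of the bracket in a direction \<open>v\<close> only involves the derivatives of \<open>F'\<close> and \<open>G'\<close>, and
  by skew-adjointness it is \<open>D\<^sup>2F(v, X\<^sub>G) - D\<^sup>2G(v, X\<^sub>F)\<close>. The second variation \<open>D\<^sup>2F\<close> is symmetric,
  so the bracket has the functional derivative \<open>D\<^sup>2F(X\<^sub>G) - D\<^sup>2G(X\<^sub>F)\<close> (\<open>bracket_func_deriv\<close>), hence the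
  bracket of \<open>{F, G}\<close> with \<open>H\<close> is \<open>D\<^sup>2F(X\<^sub>G, X\<^sub>H) - D\<^sup>2G(X\<^sub>F, X\<^sub>H)\<close>, and the six terms of
  the cyclic sum cancel in pairs. The functionals enter only through the fact that \<open>F'\<close>
  maps smooth families of fields to smooth families, which covers brackets of functionals as well as integrals
  of densities. Then \<open>D\<^sup>2F(v)\<close> is the parameter derivative of
  \<open>F' (u + h v)\<close> at \<open>h = 0\<close>, and its symmetry is the equality of the mixed derivatives of
  \<open>F (u + h v + k w)\<close>.

  A product of functionals has the derivative \<open>F u G' u + G u F' u\<close>, so that smooth dependence of the
  values \<open>F (u\<^sub>s)\<close> on the parameters is needed. It is read off from
  \<open>F (u\<^sub>s) = F 0 + \<integral>\<^sub>0\<^sup>1 \<integral> F' (r u\<^sub>s) \<bullet> u\<^sub>s dx dr\<close> (\<open>value_family\<close>), which replaces a chain rule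
  along curves of fields. A local functional has the Euler-Lagrange expression of its density as functional
  derivative. The evolution equations follow by testing the evolution law on the linear functional
  \<open>\<integral> d \<bullet> u\<close>, where \<open>d\<close> is the difference of \<open>\<partial>\<^sub>t q\<close> and \<open>X\<^sub>E\<close>: it gives \<open>\<integral> d \<bullet> d = 0\<close>.
\<close>

section \<open>Differentiability along translations\<close>

definition deriv_along :: "('p \<Rightarrow> real \<Rightarrow> 'p) \<Rightarrow> ('p \<Rightarrow> 'b::real_normed_vector) \<Rightarrow> 'p \<Rightarrow> 'b" where
  "deriv_along \<tau> f p = vector_derivative (\<lambda>h. f (\<tau> p h)) (at 0)"

definition smooth_along ::
    "('p::topological_space \<Rightarrow> real \<Rightarrow> 'p) set \<Rightarrow> ('p \<Rightarrow> 'b::real_normed_vector) \<Rightarrow> bool" where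
  "smooth_along T f \<longleftrightarrow> (\<forall>m. Ck_along T m f)"

text \<open>Step \<open>0\<close> must not move the point: the product rule and the chain rule along \<open>\<tau>\<close> evaluate the
  undifferentiated factors at \<open>\<tau> p 0\<close>.\<close>

definition based :: "('p \<Rightarrow> real \<Rightarrow> 'p) set \<Rightarrow> bool" where
  "based T \<longleftrightarrow> (\<forall>\<tau>\<in>T. \<forall>p. \<tau> p 0 = p)"

lemma Ck_along_cont: "Ck_along T m f \<Longrightarrow> continuous_on UNIV f"
  by (cases m) auto

lemma Ck_along_SucI:
  assumes "continuous_on UNIV f"
    and D: "\<And>\<tau> p. \<tau> \<in> T \<Longrightarrow> ((\<lambda>h. f (\<tau> p h)) has_vector_derivative f' \<tau> p) (at 0)"
    and "\<And>\<tau>. \<tau> \<in> T \<Longrightarrow> Ck_along T m (f' \<tau>)"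
  shows "Ck_along T (Suc m) f"
proof -
  have "(\<lambda>p. vector_derivative (\<lambda>h. f (\<tau> p h)) (at 0)) = f' \<tau>" if "\<tau> \<in> T" for \<tau>
    using D[OF that] by (intro ext vector_derivative_at)
  then show ?thesis using assms by (auto intro: differentiableI_vector)
qed

lemma Ck_along_SucI_ex:
  assumes "continuous_on UNIV f"
    and "\<And>\<tau>. \<tau> \<in> T \<Longrightarrow> \<exists>g. (\<forall>p. ((\<lambda>h. f (\<tau> p h)) has_vector_derivative g p) (at 0)) \<and> Ck_along T m g"
  shows "Ck_along T (Suc m) f"
proof -
  obtain g where "\<And>\<tau>. \<tau> \<in> T \<Longrightarrow> (\<forall>p. ((\<lambda>h. f (\<tau> p h)) has_vector_derivative g \<tau> p) (at 0)) \<and> Ck_along T m (g \<tau>)"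
    using assms(2) by metis
  then show ?thesis using assms(1) by (intro Ck_along_SucI[where f' = g]) blast+
qed

declare Ck_along.simps(2) [simp del]

lemma Ck_along_SucD:
  assumes "Ck_along T (Suc m) f" "\<tau> \<in> T"
  shows "((\<lambda>h. f (\<tau> p h)) has_vector_derivative deriv_along \<tau> f p) (at 0)"
    and "Ck_along T m (deriv_along \<tau> f)"
  using assms by (auto simp: Ck_along.simps(2) deriv_along_def[abs_def] vector_derivative_works)

lemma Ck_along_Suc_imp: "Ck_along T (Suc m) f \<Longrightarrow> Ck_along T m f"
proof (induction m arbitrary: f)
  case (Suc m)
  show ?case
    by (rule Ck_along_SucI[where f' = "\<lambda>\<tau>. deriv_along \<tau> f"])
      (use Suc in \<open>auto intro: Ck_along_SucD Ck_along_cont\<close>)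
qed (auto intro: Ck_along_cont)

lemma Ck_along_const: "Ck_along T m (\<lambda>p. c)"
  by (induction m arbitrary: c) (auto simp: Ck_along.simps(2))

lemma Ck_along_linear:
  assumes "bounded_linear L" "Ck_along T m f"
  shows "Ck_along T m (\<lambda>p. L (f p))"
  using assms(2)
proof (induction m arbitrary: f)
  case 0
  then show ?case using bounded_linear.continuous_on[OF assms(1)] by auto
next
  case (Suc m)
  show ?case
    by (rule Ck_along_SucI[where f' = "\<lambda>\<tau> p. L (deriv_along \<tau> f p)"])
      (use Suc in \<open>auto intro!: bounded_linear.continuous_on[OF assms(1)]
          bounded_linear.has_vector_derivative[OF assms(1)] Ck_along_SucD
          intro: Ck_along_cont\<close>)
qed

lemma Ck_along_add:
  assumes "Ck_along T m f" "Ck_along T m g"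
  shows "Ck_along T m (\<lambda>p. f p + g p)"
  using assms
proof (induction m arbitrary: f g)
  case 0
  then show ?case by (auto intro: continuous_intros)
next
  case (Suc m)
  show ?case
    by (rule Ck_along_SucI[where f' = "\<lambda>\<tau> p. deriv_along \<tau> f p + deriv_along \<tau> g p"])
      (use Suc Ck_along_cont in \<open>auto intro!: continuous_intros has_vector_derivative_add Ck_along_SucD\<close>)
qed

lemma Ck_along_sum:
  assumes "\<And>i. i \<in> I \<Longrightarrow> Ck_along T m (f i)"
  shows "Ck_along T m (\<lambda>p. \<Sum>i\<in>I. f i p)"
  using assms by (induction I rule: infinite_finite_induct) (auto intro: Ck_along_const Ck_along_add)

lemma Ck_along_bilinear:
  assumes "based T" "bounded_bilinear B" "Ck_along T m f" "Ck_along T m g"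
  shows "Ck_along T m (\<lambda>p. B (f p) (g p))"
  using assms(3,4)
proof (induction m arbitrary: f g)
  case 0
  then show ?case using bounded_bilinear.continuous_on[OF assms(2)] by auto
next
  case (Suc m)
  have c: "continuous_on UNIV f" "continuous_on UNIV g" using Suc.prems by (auto intro: Ck_along_cont)
  show ?case
  proof (rule Ck_along_SucI[where f' = "\<lambda>\<tau> p. B (f p) (deriv_along \<tau> g p) + B (deriv_along \<tau> f p) (g p)"])
    show "continuous_on UNIV (\<lambda>p. B (f p) (g p))"
      using bounded_bilinear.continuous_on[OF assms(2) c] .
    fix \<tau> assume t: "\<tau> \<in> T"
    have b: "\<tau> p 0 = p" for p using assms(1) t by (auto simp: based_def)
    show "((\<lambda>h. B (f (\<tau> p h)) (g (\<tau> p h))) has_vector_derivative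
        B (f p) (deriv_along \<tau> g p) + B (deriv_along \<tau> f p) (g p)) (at 0)" for p
      using bounded_bilinear.has_vector_derivative[OF assms(2) Ck_along_SucD(1)[OF Suc.prems(1) t]
          Ck_along_SucD(1)[OF Suc.prems(2) t], of p p] by (simp add: b)
    show "Ck_along T m (\<lambda>p. B (f p) (deriv_along \<tau> g p) + B (deriv_along \<tau> f p) (g p))"
      by (intro Ck_along_add Suc.IH Ck_along_SucD Suc.prems t Ck_along_Suc_imp)
  qed
qed

text \<open>A substitution \<open>\<iota>\<close> that carries each coordinate translation to a coordinate translation, or ignores it,
  needs no chain rule. Restriction to a single field, extension by a dummy parameter and freezing a parameter are of
  this kind.\<close>

lemma Ck_along_pullback:
  assumes "Ck_along T m f" and cont: "continuous_on UNIV \<iota>"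
    and i: "\<And>\<tau>. \<tau> \<in> T' \<Longrightarrow> (\<exists>\<tau>0\<in>T. \<forall>p h. \<iota> (\<tau> p h) = \<tau>0 (\<iota> p) h) \<or> (\<forall>p h. \<iota> (\<tau> p h) = \<iota> p)"
  shows "Ck_along T' m (\<lambda>p. f (\<iota> p))"
  using assms(1)
proof (induction m arbitrary: f)
  case 0
  then show ?case using continuous_on_compose2[OF _ cont] by auto
next
  case (Suc m)
  have c: "continuous_on UNIV (\<lambda>p. f (\<iota> p))"
    using continuous_on_compose2[OF Ck_along_cont[OF Suc.prems] cont] by auto
  have "(\<forall>p. (\<lambda>h. f (\<iota> (\<tau> p h))) differentiable (at 0)) \<and>
      Ck_along T' m (\<lambda>p. vector_derivative (\<lambda>h. f (\<iota> (\<tau> p h))) (at 0))" if t: "\<tau> \<in> T'" for \<tau>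
    using i[OF t]
  proof (elim disjE bexE)
    fix \<tau>0 assume t0: "\<tau>0 \<in> T" and e: "\<forall>p h. \<iota> (\<tau> p h) = \<tau>0 (\<iota> p) h"
    show ?thesis
      using Suc.prems t0 Suc.IH[OF Ck_along_SucD(2)[OF Suc.prems t0]]
      by (simp add: Ck_along.simps(2) e deriv_along_def)
  next
    assume e: "\<forall>p h. \<iota> (\<tau> p h) = \<iota> p"
    then show ?thesis by (simp add: Ck_along_const)
  qed
  then show ?case using c by (simp add: Ck_along.simps(2))
qed

subsection \<open>Functions with continuous partial derivatives\<close>

definition space_shift :: "'a::real_vector \<Rightarrow> 'a \<Rightarrow> real \<Rightarrow> 'a" where
  "space_shift b p h = p + h *\<^sub>R b"

lemma smooth_iff: "smooth f \<longleftrightarrow> smooth_along (space_shift ` Basis) f"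
proof -
  have "{(\<lambda>p h. p + h *\<^sub>R b) | b. b \<in> Basis} = (space_shift ` Basis :: ('a \<Rightarrow> _) set)"
    by (auto simp: space_shift_def[abs_def])
  then show ?thesis by (simp add: smooth_def smooth_along_def)
qed

lemma based_space_shift: "based (space_shift ` B)"
  by (auto simp: based_def space_shift_def)

lemma shift_has_vector_derivative:
  fixes f :: "'a::real_vector \<Rightarrow> 'b::real_normed_vector"
  assumes "\<And>p. ((\<lambda>h. f (p + h *\<^sub>R b)) has_vector_derivative f' p) (at 0)"
  shows "((\<lambda>h. f (p + h *\<^sub>R b)) has_vector_derivative f' (p + t *\<^sub>R b)) (at t within S)"
proof -
  have "((\<lambda>h. f ((p + t *\<^sub>R b) + h *\<^sub>R b)) has_vector_derivative f' (p + t *\<^sub>R b)) (at (t - t))"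
    using assms by simp
  moreover have "((\<lambda>h. h - t) has_vector_derivative 1) (at t)"
    by (auto intro!: derivative_eq_intros)
  ultimately have "((\<lambda>h. f ((p + t *\<^sub>R b) + h *\<^sub>R b)) \<circ> (\<lambda>h. h - t) has_vector_derivative 1 *\<^sub>R f' (p + t *\<^sub>R b)) (at t)"
    by (intro vector_diff_chain_at) auto
  moreover have "(p + t *\<^sub>R b) + (h - t) *\<^sub>R b = p + h *\<^sub>R b" for h
    by (simp add: scaleR_left_diff_distrib)
  ultimately have "((\<lambda>h. f (p + h *\<^sub>R b)) has_vector_derivative f' (p + t *\<^sub>R b)) (at t)"
    by (simp only: o_def scaleR_one)
  then show ?thesis
    by (rule has_vector_derivative_at_within)
qed

text \<open>The coordinates of the increment are changed one at a time, and each change is estimated by the mean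
  value inequality along one basis vector.\<close>

lemma has_derivative_continuous_partials:
  fixes f :: "'a::euclidean_space \<Rightarrow> 'b::real_normed_vector"
  assumes D: "\<And>p b. b \<in> Basis \<Longrightarrow> ((\<lambda>h. f (p + h *\<^sub>R b)) has_vector_derivative f' b p) (at 0)"
    and c: "\<And>b. b \<in> Basis \<Longrightarrow> continuous_on UNIV (f' b)"
  shows "(f has_derivative (\<lambda>h. \<Sum>b\<in>Basis. (h \<bullet> b) *\<^sub>R f' b x)) (at x)"
proof -
  \<comment> \<open>Uniform in the base point \<open>y\<close>, as the increments along the other coordinates displace it.\<close>
  have *: "\<exists>d>0. \<forall>y h. norm (y - x) < d \<and> norm h < d \<longrightarrow>
      norm (f (y + (\<Sum>b\<in>S. (h \<bullet> b) *\<^sub>R b)) - f y - (\<Sum>b\<in>S. (h \<bullet> b) *\<^sub>R f' b x)) \<le> e * (\<Sum>b\<in>S. \<bar>h \<bullet> b\<bar>)"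
    if "finite S" "S \<subseteq> Basis" "e > 0" for S and e :: real
    using that
  proof (induction S rule: finite_induct)
    case empty
    then show ?case by (auto intro: exI[of _ 1])
  next
    case (insert b S)
    then obtain d1 where d1: "d1 > 0" "\<And>y h. norm (y - x) < d1 \<Longrightarrow> norm h < d1 \<Longrightarrow>
      norm (f (y + (\<Sum>b\<in>S. (h \<bullet> b) *\<^sub>R b)) - f y - (\<Sum>b\<in>S. (h \<bullet> b) *\<^sub>R f' b x)) \<le> e * (\<Sum>b\<in>S. \<bar>h \<bullet> b\<bar>)"
      by auto
    have b: "b \<in> Basis" using insert by auto
    obtain d2 where d2: "d2 > 0" "\<And>y. dist y x < d2 \<Longrightarrow> dist (f' b y) (f' b x) < e / 3"
      using c[OF b] insert.prems(2) unfolding continuous_on_iff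
      by (metis UNIV_I zero_less_divide_iff zero_less_numeral)
    \<comment> \<open>Half of the radius for the base point, half for the step along \<open>b\<close>.\<close>
    define d where "d = min d1 d2 / 2"
    show ?case
    proof (intro exI[of _ d] conjI allI impI)
      show "d > 0" using d1 d2 by (simp add: d_def)
      fix y h :: 'a assume yh: "norm (y - x) < d \<and> norm h < d"
      define z where "z = y + (h \<bullet> b) *\<^sub>R b"
      have nb: "\<bar>h \<bullet> b\<bar> \<le> norm h" using b by (rule Basis_le_norm)
      have z: "norm (z - x) < min d1 d2"
      proof -
        have "norm (z - x) \<le> norm (y - x) + norm ((h \<bullet> b) *\<^sub>R b)"
          unfolding z_def by (metis add_diff_eq add.commute norm_triangle_ineq)
        also have "\<dots> < d + d" using yh nb b by simp
        finally show ?thesis by (simp add: d_def)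
      qed
      have 1: "norm (f (z + (\<Sum>b\<in>S. (h \<bullet> b) *\<^sub>R b)) - f z - (\<Sum>b\<in>S. (h \<bullet> b) *\<^sub>R f' b x)) \<le> e * (\<Sum>b\<in>S. \<bar>h \<bullet> b\<bar>)"
        using z yh d1(1) d2(1) by (intro d1(2)) (auto simp: d_def)
      have near: "norm (f' b (y + t *\<^sub>R b) - f' b x) \<le> e / 3" if "t \<in> closed_segment 0 (h \<bullet> b)" for t
      proof -
        have "\<bar>t\<bar> \<le> norm h"
          using that nb by (auto simp: closed_segment_eq_real_ivl split: if_splits)
        moreover have "norm ((y + t *\<^sub>R b) - x) \<le> norm (y - x) + norm (t *\<^sub>R b)"
          by (metis add_diff_eq add.commute norm_triangle_ineq)
        ultimately have "norm ((y + t *\<^sub>R b) - x) < d + d" using yh b by simp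
        then show ?thesis using d2(2)[of "y + t *\<^sub>R b"] by (simp add: d_def dist_norm)
      qed
      have 2: "norm (f z - f y - (h \<bullet> b) *\<^sub>R f' b y) \<le> \<bar>h \<bullet> b\<bar> * (2 * e / 3)"
      proof -
        have "norm (f (y + (h \<bullet> b) *\<^sub>R b) - f (y + 0 *\<^sub>R b) - (h \<bullet> b - 0) *\<^sub>R f' b (y + 0 *\<^sub>R b))
          \<le> norm (h \<bullet> b - 0) * (2 * e / 3)"
        proof (rule vector_differentiable_bound_linearization[where S = "closed_segment 0 (h \<bullet> b)"
              and f' = "\<lambda>t. f' b (y + t *\<^sub>R b)" and f = "\<lambda>t. f (y + t *\<^sub>R b)" and ?x0.0 = 0])
          show "((\<lambda>t. f (y + t *\<^sub>R b)) has_vector_derivative f' b (y + t *\<^sub>R b))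
              (at t within closed_segment 0 (h \<bullet> b))" for t
            by (rule shift_has_vector_derivative[OF D[OF b]])
          fix t assume t: "t \<in> closed_segment 0 (h \<bullet> b)"
          show "norm (f' b (y + t *\<^sub>R b) - f' b (y + 0 *\<^sub>R b)) \<le> 2 * e / 3"
            using norm_triangle_ineq4[of "f' b (y + t *\<^sub>R b) - f' b x" "f' b (y + 0 *\<^sub>R b) - f' b x"]
              near[OF t] near[of 0] by simp
        qed auto
        then show ?thesis by (simp add: z_def)
      qed
      have 3: "norm ((h \<bullet> b) *\<^sub>R (f' b y - f' b x)) \<le> \<bar>h \<bullet> b\<bar> * (e / 3)"
        using mult_left_mono[OF near[of 0], of "\<bar>h \<bullet> b\<bar>"] by simp
      have "f (y + (\<Sum>b\<in>insert b S. (h \<bullet> b) *\<^sub>R b)) - f y - (\<Sum>b\<in>insert b S. (h \<bullet> b) *\<^sub>R f' b x)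
        = (f (z + (\<Sum>b\<in>S. (h \<bullet> b) *\<^sub>R b)) - f z - (\<Sum>b\<in>S. (h \<bullet> b) *\<^sub>R f' b x))
          + (f z - f y - (h \<bullet> b) *\<^sub>R f' b y) + (h \<bullet> b) *\<^sub>R (f' b y - f' b x)"
        using insert.hyps by (simp add: z_def algebra_simps)
      also have "norm \<dots> \<le> e * (\<Sum>b\<in>S. \<bar>h \<bullet> b\<bar>) + \<bar>h \<bullet> b\<bar> * (2 * e / 3) + \<bar>h \<bullet> b\<bar> * (e / 3)"
        by (intro norm_triangle_le add_mono 1 2 3)
      also have "\<dots> = e * (\<Sum>b\<in>insert b S. \<bar>h \<bullet> b\<bar>)"
        using insert.hyps by (simp add: algebra_simps)
      finally show "norm (f (y + (\<Sum>b\<in>insert b S. (h \<bullet> b) *\<^sub>R b)) - f y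
          - (\<Sum>b\<in>insert b S. (h \<bullet> b) *\<^sub>R f' b x)) \<le> e * (\<Sum>b\<in>insert b S. \<bar>h \<bullet> b\<bar>)" .
    qed
  qed
  have lin: "bounded_linear (\<lambda>h. \<Sum>b\<in>Basis. (h \<bullet> b) *\<^sub>R f' b x)"
    by (intro bounded_linear_sum bounded_linear_scaleR_const bounded_linear_inner_left)
  show ?thesis
    unfolding has_derivative_at_alt
  proof (intro conjI lin allI impI)
    fix e :: real assume e: "e > 0"
    define n where "n = real DIM('a)"
    have n: "n > 0" by (simp add: n_def)
    obtain d where d: "d > 0" "\<And>y h. norm (y - x) < d \<Longrightarrow> norm h < d \<Longrightarrow>
      norm (f (y + (\<Sum>b\<in>Basis. (h \<bullet> b) *\<^sub>R b)) - f y - (\<Sum>b\<in>Basis. (h \<bullet> b) *\<^sub>R f' b x))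
        \<le> (e / n) * (\<Sum>b\<in>Basis. \<bar>h \<bullet> b\<bar>)"
      using *[of Basis "e / n"] e n by auto
    show "\<exists>d>0. \<forall>y. norm (y - x) < d \<longrightarrow>
        norm (f y - f x - (\<Sum>b\<in>Basis. ((y - x) \<bullet> b) *\<^sub>R f' b x)) \<le> e * norm (y - x)"
    proof (intro exI[of _ d] conjI allI impI d(1))
      fix y assume y: "norm (y - x) < d"
      have "norm (f y - f x - (\<Sum>b\<in>Basis. ((y - x) \<bullet> b) *\<^sub>R f' b x))
          \<le> (e / n) * (\<Sum>b\<in>Basis. \<bar>(y - x) \<bullet> b\<bar>)"
        using d(2)[of x "y - x"] y d(1) by (simp add: euclidean_representation)
      also have "\<dots> \<le> (e / n) * (n * norm (y - x))"
        using sum_bounded_above[of Basis "\<lambda>b. \<bar>(y - x) \<bullet> b\<bar>" "norm (y - x)"] e n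
        by (intro mult_left_mono) (auto simp: n_def Basis_le_norm)
      finally show "norm (f y - f x - (\<Sum>b\<in>Basis. ((y - x) \<bullet> b) *\<^sub>R f' b x)) \<le> e * norm (y - x)"
        using n by simp
    qed
  qed
qed

text \<open>The derivative along \<open>\<tau>\<close> is a sum of products of \<open>C\<^sup>m\<close> functions: components of the derivative
  of \<open>z\<close>, and partial derivatives of \<open>a\<close> composed with \<open>z\<close>. The induction therefore runs over all \<open>a\<close>.\<close>

lemma Ck_along_compose:
  fixes a :: "'e::euclidean_space \<Rightarrow> 'b::real_normed_vector"
  assumes "based T" "Ck_along (space_shift ` Basis) m a" "Ck_along T m z"
  shows "Ck_along T m (\<lambda>p. a (z p))"
  using assms(2,3)
proof (induction m arbitrary: a)
  case 0
  then show ?case by (auto intro: continuous_on_compose2)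
next
  case (Suc m)
  let ?d = "\<lambda>b. deriv_along (space_shift b) a"
  have D: "(a has_derivative (\<lambda>h. \<Sum>b\<in>Basis. (h \<bullet> b) *\<^sub>R ?d b x)) (at x)" for x
    using Ck_along_SucD[OF Suc.prems(1)]
    by (intro has_derivative_continuous_partials)
      (auto intro!: Ck_along_cont[where T = "space_shift ` Basis" and m = m] simp flip: space_shift_def)
  show ?case
  proof (rule Ck_along_SucI[where f' = "\<lambda>\<tau> p. \<Sum>b\<in>Basis. (deriv_along \<tau> z p \<bullet> b) *\<^sub>R ?d b (z p)"])
    show "continuous_on UNIV (\<lambda>p. a (z p))"
      using Suc.prems by (auto intro: continuous_on_compose2 Ck_along_cont)
    fix \<tau> assume t: "\<tau> \<in> T"
    have b: "\<tau> p 0 = p" for p using assms(1) t by (auto simp: based_def)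
    show "((\<lambda>h. a (z (\<tau> p h))) has_vector_derivative
        (\<Sum>b\<in>Basis. (deriv_along \<tau> z p \<bullet> b) *\<^sub>R ?d b (z p))) (at 0)" for p
      using vector_derivative_diff_chain_within[OF Ck_along_SucD(1)[OF Suc.prems(2) t, of p]
        has_derivative_at_withinI[OF D[of "z (\<tau> p 0)"]]]
      by (simp add: b o_def)
    show "Ck_along T m (\<lambda>p. \<Sum>b\<in>Basis. (deriv_along \<tau> z p \<bullet> b) *\<^sub>R ?d b (z p))"
      by (intro Ck_along_sum Ck_along_bilinear[OF assms(1) bounded_bilinear_scaleR]
          Ck_along_linear[OF bounded_linear_inner_left] Ck_along_SucD(2)[OF Suc.prems(2) t] Suc.IH
          Ck_along_SucD(2)[OF Suc.prems(1)] Ck_along_Suc_imp[OF Suc.prems(2)]) auto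
  qed
qed

text \<open>Only one of the mixed derivatives is assumed to exist; the other one is obtained. Integrating \<open>f1\<close> over
  the first variable recovers \<open>f\<close> up to its value at a base point, the second derivative passes under that integral,
  and the fundamental theorem of calculus differentiates the result.\<close>

lemma mixed_derivatives_commute:
  fixes f :: "real \<Rightarrow> real \<Rightarrow> 'b::euclidean_space"
  assumes f1: "\<And>h k. ((\<lambda>h. f h k) has_vector_derivative f1 h k) (at h)"
    and f2: "\<And>h k. ((\<lambda>k. f h k) has_vector_derivative f2 h k) (at k)"
    and f12: "\<And>h k. ((\<lambda>k. f1 h k) has_vector_derivative f12 h k) (at k)"
    and c: "continuous_on UNIV (\<lambda>(h, k). f12 h k)"
  shows "((\<lambda>h. f2 h k) has_vector_derivative f12 h k) (at h)"
proof -
  \<comment> \<open>To the left of \<open>h\<close>, so that two-sided derivatives at \<open>h\<close> come from one-sided intervals.\<close>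
  define a where "a = h - 1"
  have I: "((\<lambda>t. f1 t k) has_integral f y k - f a k) (cbox a y)" if "y \<ge> a" for y k
    using fundamental_theorem_of_calculus[OF that, of "\<lambda>h. f h k" "\<lambda>h. f1 h k"] f1
    by (auto intro: has_vector_derivative_at_within)
  have f2_eq: "f2 y k = f2 a k + integral {a..y} (\<lambda>t. f12 t k)" if "y \<ge> a" for y
  proof -
    have "((\<lambda>k. integral (cbox a y) (\<lambda>t. f1 t k)) has_vector_derivative
        integral (cbox a y) (\<lambda>t. f12 t k)) (at k within UNIV)"
    proof (rule leibniz_rule_vector_derivative)
      show "continuous_on (UNIV \<times> cbox a y) (\<lambda>(k, t). f12 t k)"
        using continuous_on_compose2[OF c continuous_on_swap, of "UNIV \<times> cbox a y"]
        by (simp add: case_prod_unfold)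
    qed (use f12 I[OF that] in \<open>auto intro: has_integral_integrable\<close>)
    moreover have "(\<lambda>k. integral (cbox a y) (\<lambda>t. f1 t k)) = (\<lambda>k. f y k - f a k)"
      using I[OF that] by (intro ext integral_unique)
    ultimately have "((\<lambda>k. f y k - f a k) has_vector_derivative integral {a..y} (\<lambda>t. f12 t k)) (at k)"
      by simp
    moreover have "((\<lambda>k. f y k - f a k) has_vector_derivative f2 y k - f2 a k) (at k)"
      by (intro has_vector_derivative_diff f2)
    ultimately have "integral {a..y} (\<lambda>t. f12 t k) = f2 y k - f2 a k"
      by (rule vector_derivative_unique_at)
    then show ?thesis by (simp add: algebra_simps)
  qed
  have ck: "continuous_on {a..h + 1} (\<lambda>t. f12 t k)"
    using continuous_on_compose2[OF c continuous_on_Pair[OF continuous_on_id continuous_on_const]]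
    by (simp add: split_def)
  have "((\<lambda>y. integral {a..y} (\<lambda>t. f12 t k)) has_vector_derivative f12 h k) (at h within {a..h + 1})"
    by (rule integral_has_vector_derivative[OF ck]) (simp add: a_def)
  moreover have "at h within {a..h + 1} = at h"
    by (rule at_within_interior) (simp add: a_def)
  ultimately have "((\<lambda>y. integral {a..y} (\<lambda>t. f12 t k)) has_vector_derivative f12 h k) (at h)"
    by simp
  from has_vector_derivative_add[OF has_vector_derivative_const this, of "f2 a k"]
  have "((\<lambda>y. f2 a k + integral {a..y} (\<lambda>t. f12 t k)) has_vector_derivative f12 h k) (at h)"
    by simp
  then show ?thesis
  proof (rule has_vector_derivative_transform_within_open)
    show "open {a<..}" "h \<in> {a<..}" by (auto simp: a_def)
    show "f2 a k + integral {a..y} (\<lambda>t. f12 t k) = f2 y k" if "y \<in> {a<..}" for y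
      using f2_eq[of y] that by simp
  qed
qed

subsection \<open>Infinite differentiability\<close>

lemma smooth_along_const: "smooth_along T (\<lambda>p. c)"
  by (simp add: smooth_along_def Ck_along_const)

lemma smooth_along_linear: "bounded_linear L \<Longrightarrow> smooth_along T f \<Longrightarrow> smooth_along T (\<lambda>p. L (f p))"
  by (simp add: smooth_along_def Ck_along_linear)

lemma smooth_along_add: "smooth_along T f \<Longrightarrow> smooth_along T g \<Longrightarrow> smooth_along T (\<lambda>p. f p + g p)"
  by (simp add: smooth_along_def Ck_along_add)

lemma smooth_along_sum: "(\<And>i. i \<in> I \<Longrightarrow> smooth_along T (f i)) \<Longrightarrow> smooth_along T (\<lambda>p. \<Sum>i\<in>I. f i p)"
  by (simp add: smooth_along_def Ck_along_sum)

lemma smooth_along_bilinear: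
  "based T \<Longrightarrow> bounded_bilinear B \<Longrightarrow> smooth_along T f \<Longrightarrow> smooth_along T g \<Longrightarrow>
    smooth_along T (\<lambda>p. B (f p) (g p))"
  by (simp add: smooth_along_def Ck_along_bilinear)

lemma smooth_along_compose:
  "based T \<Longrightarrow> smooth a \<Longrightarrow> smooth_along T z \<Longrightarrow> smooth_along T (\<lambda>p. a (z p))"
  by (simp add: smooth_along_def smooth_iff Ck_along_compose)

lemma smooth_along_pullback:
  assumes "smooth_along T f" "continuous_on UNIV \<iota>"
    and "\<And>\<tau>. \<tau> \<in> T' \<Longrightarrow> (\<exists>\<tau>0\<in>T. \<forall>p h. \<iota> (\<tau> p h) = \<tau>0 (\<iota> p) h) \<or> (\<forall>p h. \<iota> (\<tau> p h) = \<iota> p)"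
  shows "smooth_along T' (\<lambda>p. f (\<iota> p))"
  unfolding smooth_along_def
proof
  fix m show "Ck_along T' m (\<lambda>p. f (\<iota> p))"
    by (rule Ck_along_pullback[where T = T, OF _ assms(2) assms(3)])
      (use assms(1) in \<open>simp_all add: smooth_along_def\<close>)
qed

lemma smooth_along_cont: "smooth_along T f \<Longrightarrow> continuous_on UNIV f"
  by (auto simp: smooth_along_def intro: Ck_along_cont)

lemma smooth_along_D:
  assumes "smooth_along T f" "\<tau> \<in> T"
  shows "((\<lambda>h. f (\<tau> p h)) has_vector_derivative deriv_along \<tau> f p) (at 0)"
    and "smooth_along T (deriv_along \<tau> f)"
  using Ck_along_SucD[OF _ assms(2), where f = f] assms(1) unfolding smooth_along_def by blast+

text \<open>Affine functions of the coordinates, from which the other smooth functions are built.\<close>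

lemma smooth_along_base:
  assumes "\<And>\<tau>. \<tau> \<in> T \<Longrightarrow> \<exists>c. \<forall>p h. f (\<tau> p h) = f p + h *\<^sub>R c" "continuous_on UNIV f"
  shows "smooth_along T f"
  unfolding smooth_along_def
proof
  obtain c where c: "\<And>\<tau> p h. \<tau> \<in> T \<Longrightarrow> f (\<tau> p h) = f p + h *\<^sub>R c \<tau>"
    using assms(1) by metis
  fix m show "Ck_along T m f"
    by (rule Ck_along_Suc_imp, rule Ck_along_SucI[where f' = "\<lambda>\<tau> p. c \<tau>"])
      (use assms in \<open>auto simp: c intro!: Ck_along_const derivative_eq_intros\<close>)
qed

lemma smooth_const: "smooth (\<lambda>x. c)"
  by (simp add: smooth_iff smooth_along_const)

lemma smooth_id: "smooth (\<lambda>x. x)"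
  unfolding smooth_iff by (rule smooth_along_base) (auto simp: space_shift_def)

lemma smooth_add: "smooth f \<Longrightarrow> smooth g \<Longrightarrow> smooth (\<lambda>x. f x + g x)"
  by (simp add: smooth_iff smooth_along_add)

lemma smooth_linear: "bounded_linear L \<Longrightarrow> smooth f \<Longrightarrow> smooth (\<lambda>x. L (f x))"
  by (simp add: smooth_iff smooth_along_linear)

lemma smooth_bilinear: "bounded_bilinear B \<Longrightarrow> smooth f \<Longrightarrow> smooth g \<Longrightarrow> smooth (\<lambda>x. B (f x) (g x))"
  by (simp add: smooth_iff smooth_along_bilinear based_space_shift)

lemma smooth_compose: "smooth a \<Longrightarrow> smooth z \<Longrightarrow> smooth (\<lambda>x. a (z x))"
  unfolding smooth_iff[of z] smooth_iff[of "\<lambda>x. a (z x)"]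
  by (rule smooth_along_compose[OF based_space_shift])

lemma smooth_cont: "smooth f \<Longrightarrow> continuous_on UNIV f"
  unfolding smooth_iff by (rule smooth_along_cont)

section \<open>Smooth bump functions\<close>

text \<open>The standard smooth functions that are flat at the origin. A polynomial factor in \<open>1 / t\<close> makes the class closed
  under differentiation.\<close>

definition flat :: "real poly \<Rightarrow> real \<Rightarrow> real" where
  "flat P t = (if t > 0 then poly P (1 / t) * exp (- (1 / t)) else 0)"

lemma poly_exp_decay: "((\<lambda>y. poly P y * exp (- y)) \<longlongrightarrow> 0) (at_top :: real filter)"
proof -
  have "((\<lambda>y. \<Sum>i\<le>degree P. coeff P i * (y ^ i / exp y)) \<longlongrightarrow> (\<Sum>i\<le>degree P. coeff P i * 0)) at_top"
    by (intro tendsto_sum tendsto_mult tendsto_const tendsto_power_div_exp_0)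
  then show ?thesis
    by (simp add: poly_altdef exp_minus divide_inverse sum_distrib_right mult.assoc)
qed

lemma flat_has_derivative:
  "(flat P has_vector_derivative flat (pCons 0 (pCons 0 (P - pderiv P))) t) (at t)"
proof -
  consider "t > 0" | "t < 0" | "t = 0" by linarith
  then show ?thesis
  proof cases
    case 1
    have "((\<lambda>t. poly P (1 / t) * exp (- (1 / t))) has_vector_derivative
        flat (pCons 0 (pCons 0 (P - pderiv P))) t) (at t)"
      unfolding has_real_derivative_iff_has_vector_derivative[symmetric]
      using 1
      by (auto intro!: derivative_eq_intros DERIV_chain2[OF poly_DERIV] simp: flat_def field_simps power2_eq_square)
    then show ?thesis
      by (rule has_vector_derivative_transform_within_open[of _ _ _ "{0<..}"]) (use 1 in \<open>auto simp: flat_def\<close>)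
  next
    case 2
    have "((\<lambda>t. 0) has_vector_derivative flat (pCons 0 (pCons 0 (P - pderiv P))) t) (at t)"
      using 2 by (simp add: flat_def)
    then show ?thesis
      by (rule has_vector_derivative_transform_within_open[of _ _ _ "{..<0}"]) (use 2 in \<open>auto simp: flat_def\<close>)
  next
    case 3
    have "((\<lambda>h. flat P h / h) \<longlongrightarrow> 0) (at 0)"
    proof (rule filterlim_split_at)
      have "((\<lambda>h. (0::real)) \<longlongrightarrow> 0) (at_left 0)" by simp
      then show "((\<lambda>h. flat P h / h) \<longlongrightarrow> 0) (at_left 0)"
        by (rule Lim_transform_eventually) (auto simp: eventually_at_filter flat_def)
      have "((\<lambda>h. poly (pCons 0 P) (inverse h) * exp (- inverse h)) \<longlongrightarrow> 0) (at_right (0::real))"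
        by (rule filterlim_compose[OF poly_exp_decay filterlim_inverse_at_top_right])
      then show "((\<lambda>h. flat P h / h) \<longlongrightarrow> 0) (at_right 0)"
        by (rule Lim_transform_eventually) (auto simp: eventually_at_filter flat_def field_simps)
    qed
    then show ?thesis
      unfolding has_real_derivative_iff_has_vector_derivative[symmetric] DERIV_def
      by (simp add: 3 flat_def)
  qed
qed

lemma smooth_flat: "smooth (flat P)"
  unfolding smooth_iff smooth_along_def
proof
  fix m show "Ck_along (space_shift ` Basis) m (flat P)"
  proof (induction m arbitrary: P)
    case 0
    show ?case
      using flat_has_derivative by (auto intro!: continuous_at_imp_continuous_on has_vector_derivative_continuous)
  next
    case (Suc m)
    show ?case
    proof (rule Ck_along_SucI[where f' = "\<lambda>_. flat (pCons 0 (pCons 0 (P - pderiv P)))"])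
      show "continuous_on UNIV (flat P)"
        using flat_has_derivative by (auto intro!: continuous_at_imp_continuous_on has_vector_derivative_continuous)
      fix \<tau> :: "real \<Rightarrow> real \<Rightarrow> real" and p assume "\<tau> \<in> space_shift ` Basis"
      then have "\<tau> p = (\<lambda>h. p + h)" by (auto simp: space_shift_def)
      moreover have "((flat P \<circ> (\<lambda>h. p + h)) has_vector_derivative 1 *\<^sub>R flat (pCons 0 (pCons 0 (P - pderiv P))) p) (at 0)"
        by (rule vector_diff_chain_at) (use flat_has_derivative[of P "p"] in \<open>auto intro!: derivative_eq_intros\<close>)
      ultimately show "((\<lambda>h. flat P (\<tau> p h)) has_vector_derivative flat (pCons 0 (pCons 0 (P - pderiv P))) p) (at 0)"
        by (simp add: o_def)
    qed (rule Suc)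
  qed
qed

lemma smooth_bump:
  fixes x0 :: "'a::euclidean_space"
  assumes "r > 0"
  shows "\<exists>\<beta>. smooth \<beta> \<and> (\<forall>x. (\<beta> x :: real) \<ge> 0) \<and> \<beta> x0 > 0 \<and> (\<forall>x. r \<le> dist x0 x \<longrightarrow> \<beta> x = 0)"
proof (intro exI conjI allI impI)
  let ?\<beta> = "\<lambda>x. flat 1 (r\<^sup>2 + - ((x + - x0) \<bullet> (x + - x0)))"
  show "smooth ?\<beta>"
    by (intro smooth_compose[OF smooth_flat] smooth_add smooth_const smooth_id
        smooth_linear[OF bounded_linear_minus[OF bounded_linear_ident]]
        smooth_bilinear[OF bounded_bilinear_inner])
  show "?\<beta> x \<ge> 0" for x by (simp add: flat_def)
  show "?\<beta> x0 > 0" using assms by (simp add: flat_def)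
  show "?\<beta> x = 0" if "r \<le> dist x0 x" for x
  proof -
    have "r\<^sup>2 \<le> (norm (x - x0))\<^sup>2"
      using that assms by (intro power_mono) (auto simp: dist_norm norm_minus_commute)
    then show ?thesis by (simp add: flat_def power2_norm_eq_inner)
  qed
qed

section \<open>The fundamental lemma of the calculus of variations\<close>

definition vanishes_beyond :: "real \<Rightarrow> ('a::real_normed_vector \<Rightarrow> 'b::zero) \<Rightarrow> bool" where
  "vanishes_beyond R f \<longleftrightarrow> (\<forall>x. R \<le> norm x \<longrightarrow> f x = 0)"

definition cube :: "real \<Rightarrow> 'a::euclidean_space set" where
  "cube R = cbox (- R *\<^sub>R One) (R *\<^sub>R One)"

lemma vanishes_beyond_mono: "vanishes_beyond R f \<Longrightarrow> R \<le> R' \<Longrightarrow> vanishes_beyond R' f"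
  by (auto simp: vanishes_beyond_def)

lemma not_in_cube: "x \<notin> cube R \<Longrightarrow> R \<le> norm x"
proof -
  assume "x \<notin> cube R"
  then obtain b where "b \<in> Basis" "\<not> (- R \<le> x \<bullet> b \<and> x \<bullet> b \<le> R)"
    by (auto simp: cube_def mem_box)
  then show ?thesis using Basis_le_norm[of b x] by linarith
qed

lemma compact_support_integral:
  fixes f :: "'a::euclidean_space \<Rightarrow> 'b::euclidean_space"
  assumes "continuous_on UNIV f" "vanishes_beyond R f"
  shows "integrable lborel f" and "integral (cube R) f = (\<integral>x. f x \<partial>lborel)"
proof -
  have e: "(\<lambda>x. indicator (cube R) x *\<^sub>R f x) = f"
    using assms(2) not_in_cube[of _ R] by (force simp: vanishes_beyond_def indicator_def)
  have i: "set_integrable lborel (cube R) f"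
    unfolding set_integrable_def cube_def
    by (rule borel_integrable_compact) (auto intro: continuous_on_subset[OF assms(1)])
  then show "integrable lborel f" by (simp add: set_integrable_def e)
  show "integral (cube R) f = (\<integral>x. f x \<partial>lborel)"
    using set_borel_integral_eq_integral(2)[OF i] by (simp add: set_lebesgue_integral_def e)
qed

lemma nonneg_integral_zero:
  fixes f :: "'a::euclidean_space \<Rightarrow> real"
  assumes c: "continuous_on UNIV f" and v: "vanishes_beyond R f" and nn: "\<And>x. f x \<ge> 0"
    and z: "(\<integral>x. f x \<partial>lborel) = 0"
  shows "f x = 0"
proof -
  define R' where "R' = max R (norm x + 1)"
  have v': "vanishes_beyond R' f" using v by (rule vanishes_beyond_mono) (simp add: R'_def)
  have b: "\<bar>x \<bullet> b\<bar> < R'" if "b \<in> Basis" for b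
    using Basis_le_norm[OF that, of x] by (simp add: R'_def)
  have "f integrable_on cube R'"
    unfolding cube_def by (rule integrable_continuous) (rule continuous_on_subset[OF c], simp)
  then have "(f has_integral 0) (cube R')"
    using compact_support_integral(2)[OF c v'] z by (simp add: has_integral_integrable_integral)
  moreover have "x \<in> box (- R' *\<^sub>R One) (R' *\<^sub>R One)"
    using b by (simp add: mem_box abs_less_iff minus_less_iff)
  ultimately show ?thesis
    using continuous_on_subset[OF c] nn
    by (intro has_integral_0_cbox_imp_0[of "- R' *\<^sub>R One" "R' *\<^sub>R One" f x]) (auto simp: cube_def
        dest: subsetD[OF box_subset_cbox])
qed

lemma fields_iff: "u \<in> fields \<longleftrightarrow> smooth u \<and> (\<exists>R. vanishes_beyond R u)"
  by (auto simp: fields_def vanishes_beyond_def)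

text \<open>Tested against a bump function times the value \<open>g x0\<close>, supported where \<open>g \<bullet> g x0\<close> is
  positive, the integrand is nonnegative.\<close>

lemma fundamental_lemma:
  fixes g :: field
  assumes c: "continuous_on UNIV g" and z: "\<And>v. v \<in> fields \<Longrightarrow> (\<integral>x. g x \<bullet> v x \<partial>lborel) = 0"
  shows "g x0 = 0"
proof (rule ccontr)
  assume n: "g x0 \<noteq> 0"
  have "continuous_on UNIV (\<lambda>x. g x \<bullet> g x0)" using c by (intro continuous_intros)
  moreover have "g x0 \<bullet> g x0 > 0" using n by simp
  ultimately obtain r where r: "r > 0" "\<And>x. dist x x0 < r \<Longrightarrow> dist (g x \<bullet> g x0) (g x0 \<bullet> g x0) < g x0 \<bullet> g x0"
    unfolding continuous_on_iff by (metis UNIV_I)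
  obtain \<beta> where \<beta>: "smooth \<beta>" "\<And>x. (\<beta> x :: real) \<ge> 0" "\<beta> x0 > 0" "\<And>x. r \<le> dist x0 x \<Longrightarrow> \<beta> x = 0"
    using smooth_bump[OF r(1), of x0] by metis
  define v where "v = (\<lambda>x. \<beta> x *\<^sub>R g x0)"
  have "vanishes_beyond (r + norm x0) \<beta>"
    unfolding vanishes_beyond_def
  proof (intro allI impI \<beta>(4))
    fix x :: space assume "r + norm x0 \<le> norm x"
    then show "r \<le> dist x0 x" using norm_triangle_sub[of x x0] by (simp add: dist_norm norm_minus_commute)
  qed
  then have vv: "vanishes_beyond (r + norm x0) v" by (auto simp: v_def vanishes_beyond_def)
  have sv: "smooth v"
    unfolding v_def by (intro smooth_bilinear[OF bounded_bilinear_scaleR] \<beta>(1) smooth_const)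
  have "g x0 \<bullet> v x0 = 0"
  proof (rule nonneg_integral_zero[where f = "\<lambda>x. g x \<bullet> v x"])
    show "continuous_on UNIV (\<lambda>x. g x \<bullet> v x)" using c smooth_cont[OF sv] by (intro continuous_intros)
    show "vanishes_beyond (r + norm x0) (\<lambda>x. g x \<bullet> v x)" using vv by (auto simp: vanishes_beyond_def)
    show "(\<integral>x. g x \<bullet> v x \<partial>lborel) = 0" using z vv sv by (auto simp: fields_iff)
    show "g x \<bullet> v x \<ge> 0" for x
    proof (cases "r \<le> dist x0 x")
      case False
      then have "g x \<bullet> g x0 > 0" using r(2)[of x] by (auto simp: dist_real_def dist_commute)
      then show ?thesis using \<beta>(2)[of x] by (simp add: v_def)
    qed (simp add: v_def \<beta>(4))
  qed
  then show False using \<beta>(3) n by (simp add: v_def)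
qed

lemma func_deriv_eqI:
  assumes "has_func_deriv F u g"
  shows "func_deriv F u = g"
  unfolding func_deriv_def
proof (rule the_equality[of "has_func_deriv F u", OF assms])
  fix g' assume g': "has_func_deriv F u g'"
  have c: "continuous_on UNIV g" "continuous_on UNIV g'" using assms g' by (auto simp: has_func_deriv_def)
  have "g' x - g x = 0" for x
  proof (rule fundamental_lemma)
    show "continuous_on UNIV (\<lambda>x. g' x - g x)" using c by (intro continuous_intros)
    fix v assume v: "v \<in> fields"
    then obtain R where R: "vanishes_beyond R v" and cv: "continuous_on UNIV v"
      by (auto simp: fields_iff dest: smooth_cont)
    have "(\<integral>x. g' x \<bullet> v x \<partial>lborel) = (\<integral>x. g x \<bullet> v x \<partial>lborel)"
      using assms g' v unfolding has_func_deriv_def by (meson DERIV_unique)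
    moreover have "integrable lborel (\<lambda>x. g x \<bullet> v x)" "integrable lborel (\<lambda>x. g' x \<bullet> v x)"
      by (rule compact_support_integral(1)[where R = R];
          use c cv R in \<open>auto simp: vanishes_beyond_def intro!: continuous_intros\<close>)+
    ultimately show "(\<integral>x. (g' x - g x) \<bullet> v x \<partial>lborel) = 0"
      by (simp add: inner_diff_left)
  qed
  then show "g' = g" by (intro ext) simp
qed

section \<open>Smooth finite-parameter families\<close>

type_synonym 'b family = "(nat \<Rightarrow> real) \<Rightarrow> space \<Rightarrow> 'b"

definition par_shift :: "nat \<Rightarrow> (nat \<Rightarrow> real) \<times> space \<Rightarrow> real \<Rightarrow> (nat \<Rightarrow> real) \<times> space" where
  "par_shift i = (\<lambda>(s, x) h. (s(i := s i + h), x))"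

definition pos_shift :: "space \<Rightarrow> (nat \<Rightarrow> real) \<times> space \<Rightarrow> real \<Rightarrow> (nat \<Rightarrow> real) \<times> space" where
  "pos_shift b = (\<lambda>(s, x) h. (s, x + h *\<^sub>R b))"

definition family_shifts :: "((nat \<Rightarrow> real) \<times> space \<Rightarrow> real \<Rightarrow> (nat \<Rightarrow> real) \<times> space) set" where
  "family_shifts = range par_shift \<union> pos_shift ` Basis"

definition jointly_smooth :: "'b::real_normed_vector family \<Rightarrow> bool" where
  "jointly_smooth w \<longleftrightarrow> smooth_along family_shifts (\<lambda>(s, x). w s x)"

definition finite_dependence :: "((nat \<Rightarrow> real) \<Rightarrow> 'c) \<Rightarrow> bool" where
  "finite_dependence w \<longleftrightarrow> (\<exists>n. \<forall>s s'. (\<forall>i<n. s i = s' i) \<longrightarrow> w s = w s')"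

definition param_deriv :: "nat \<Rightarrow> 'b::real_normed_vector family \<Rightarrow> 'b family" where
  "param_deriv i w s x = vector_derivative (\<lambda>h. w (s(i := s i + h)) x) (at 0)"

lemma smooth_family_iff: "smooth_family w \<longleftrightarrow> finite_dependence w \<and> jointly_smooth w"
proof -
  have "{(\<lambda>(s, x) h. (s(i := s i + h), x)) | i. True} \<union> {(\<lambda>(s, x) h. (s, x + h *\<^sub>R b)) | b. b \<in> Basis}
      = family_shifts"
    unfolding family_shifts_def par_shift_def pos_shift_def by auto
  then show ?thesis
    unfolding smooth_family_def jointly_smooth_def smooth_along_def finite_dependence_def by simp
qed

lemma based_family: "based family_shifts"
  by (auto simp: based_def family_shifts_def par_shift_def pos_shift_def)

lemma family_shifts_cases:
  assumes "\<tau> \<in> family_shifts"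
  obtains i where "\<tau> = par_shift i" | b where "b \<in> Basis" "\<tau> = pos_shift b"
  using assms by (auto simp: family_shifts_def)

lemma par_shift_in: "par_shift i \<in> family_shifts" and pos_shift_in: "b \<in> Basis \<Longrightarrow> pos_shift b \<in> family_shifts"
  by (auto simp: family_shifts_def)

lemma family_shifts_add: "\<tau> \<in> family_shifts \<Longrightarrow> \<tau> (\<tau> p h) k = \<tau> p (h + k)"
  by (auto simp: family_shifts_def par_shift_def pos_shift_def split_def algebra_simps)

lemma axis_Basis: "axis k (1::real) \<in> (Basis :: (real^3) set)"
  by (simp add: axis_in_Basis_iff)

subsection \<open>Derivatives\<close>

lemma deriv_along_par:
  "deriv_along (par_shift i) (\<lambda>(s, x). w s x) = (\<lambda>(s, x). param_deriv i w s x)"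
  by (auto simp: deriv_along_def par_shift_def param_deriv_def)

lemma deriv_along_pos:
  "deriv_along (pos_shift (axis k 1)) (\<lambda>(s, x). w s x) = (\<lambda>(s, x). pd k (w s) x)"
  by (auto simp: deriv_along_def pos_shift_def pd_def)

lemma jointly_smooth_param_deriv: "jointly_smooth w \<Longrightarrow> jointly_smooth (param_deriv i w)"
  using smooth_along_D(2)[OF _ par_shift_in, of "\<lambda>(s, x). w s x" i]
  by (simp add: jointly_smooth_def deriv_along_par)

lemma jointly_smooth_pd: "jointly_smooth w \<Longrightarrow> jointly_smooth (\<lambda>s. pd k (w s))"
  using smooth_along_D(2)[OF _ pos_shift_in[OF axis_Basis], of "\<lambda>(s, x). w s x" k]
  by (simp add: jointly_smooth_def deriv_along_pos)

lemma real_shift_derivative: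
  fixes F :: "real \<Rightarrow> 'b::real_normed_vector"
  assumes "\<And>t. ((\<lambda>h. F (t + h)) has_vector_derivative F' t) (at 0)"
  shows "(F has_vector_derivative F' t) (at t within S)"
  using shift_has_vector_derivative[of F 1 F' 0 t S] assms by simp

lemma has_param_deriv:
  assumes "jointly_smooth w"
  shows "((\<lambda>t. w (s(i := t)) x) has_vector_derivative param_deriv i w (s(i := t)) x) (at t within S)"
proof (rule real_shift_derivative)
  fix t
  show "((\<lambda>h. w (s(i := t + h)) x) has_vector_derivative param_deriv i w (s(i := t)) x) (at 0)"
    using smooth_along_D(1)[OF _ par_shift_in, of "\<lambda>(s, x). w s x" i "(s(i := t), x)"] assms
    by (simp add: jointly_smooth_def deriv_along_par) (simp add: par_shift_def)
qed

lemma has_param_deriv_0: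
  assumes "jointly_smooth w"
  shows "((\<lambda>h. w (s(i := s i + h)) x) has_vector_derivative param_deriv i w s x) (at 0)"
  using smooth_along_D(1)[OF _ par_shift_in, of "\<lambda>(s, x). w s x" i "(s, x)"] assms
  by (simp add: jointly_smooth_def deriv_along_par) (simp add: par_shift_def)

lemma has_pd:
  assumes "smooth f"
  shows "((\<lambda>h. f (x + h *\<^sub>R axis k 1)) has_vector_derivative pd k f (x + t *\<^sub>R axis k 1)) (at t within S)"
proof (rule shift_has_vector_derivative)
  fix p show "((\<lambda>h. f (p + h *\<^sub>R axis k 1)) has_vector_derivative pd k f p) (at 0)"
    using smooth_along_D(1)[OF assms[unfolded smooth_iff], of "space_shift (axis k 1)" p]
    by (simp add: axis_Basis deriv_along_def pd_def space_shift_def)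
qed

lemma has_pd_0: "smooth f \<Longrightarrow> ((\<lambda>h. f (x + h *\<^sub>R axis k 1)) has_vector_derivative pd k f x) (at 0)"
  using has_pd[of f x k 0 UNIV] by simp

lemma pd_eqI: "((\<lambda>h. f (x + h *\<^sub>R axis k 1)) has_vector_derivative d) (at 0) \<Longrightarrow> pd k f x = d"
  by (simp add: pd_def vector_derivative_at)

lemma smooth_pd: "smooth f \<Longrightarrow> smooth (pd k f)"
  using smooth_along_D(2)[of "space_shift ` Basis" f "space_shift (axis k 1)"]
  by (simp add: smooth_iff axis_Basis deriv_along_def[abs_def] pd_def[abs_def] space_shift_def)

lemma pd_linear: "bounded_linear L \<Longrightarrow> smooth f \<Longrightarrow> pd k (\<lambda>x. L (f x)) x = L (pd k f x)"
  by (rule pd_eqI[OF bounded_linear.has_vector_derivative[OF _ has_pd_0]])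

lemma pd_add: "smooth f \<Longrightarrow> smooth g \<Longrightarrow> pd k (\<lambda>x. f x + g x) x = pd k f x + pd k g x"
  by (rule pd_eqI[OF has_vector_derivative_add[OF has_pd_0 has_pd_0]])

lemma pd_bilinear:
  assumes "bounded_bilinear B" "smooth f" "smooth g"
  shows "pd k (\<lambda>x. B (f x) (g x)) x = B (f x) (pd k g x) + B (pd k f x) (g x)"
  using bounded_bilinear.has_vector_derivative[OF assms(1) has_pd_0[OF assms(2)] has_pd_0[OF assms(3)], of x k x k]
  by (auto dest: pd_eqI)

subsection \<open>Closure properties of joint smoothness\<close>

lemma jointly_smooth_const: "jointly_smooth (\<lambda>s x. c)"
  by (simp add: jointly_smooth_def smooth_along_const split_def)

lemma jointly_smooth_linear: "bounded_linear L \<Longrightarrow> jointly_smooth w \<Longrightarrow> jointly_smooth (\<lambda>s x. L (w s x))"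
  using smooth_along_linear[of L family_shifts "\<lambda>(s, x). w s x"] by (simp add: jointly_smooth_def split_def)

lemma jointly_smooth_add: "jointly_smooth v \<Longrightarrow> jointly_smooth w \<Longrightarrow> jointly_smooth (\<lambda>s x. v s x + w s x)"
  using smooth_along_add[of family_shifts "\<lambda>(s, x). v s x" "\<lambda>(s, x). w s x"]
  by (simp add: jointly_smooth_def split_def)

lemma jointly_smooth_sum: "(\<And>i. i \<in> I \<Longrightarrow> jointly_smooth (w i)) \<Longrightarrow> jointly_smooth (\<lambda>s x. \<Sum>i\<in>I. w i s x)"
  using smooth_along_sum[of I family_shifts "\<lambda>i (s, x). w i s x"]
  by (simp add: jointly_smooth_def split_def)

lemma jointly_smooth_bilinear:
  "bounded_bilinear B \<Longrightarrow> jointly_smooth v \<Longrightarrow> jointly_smooth w \<Longrightarrow> jointly_smooth (\<lambda>s x. B (v s x) (w s x))"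
  using smooth_along_bilinear[OF based_family, of B "\<lambda>(s, x). v s x" "\<lambda>(s, x). w s x"]
  by (simp add: jointly_smooth_def split_def)

lemma jointly_smooth_compose: "smooth a \<Longrightarrow> jointly_smooth z \<Longrightarrow> jointly_smooth (\<lambda>s x. a (z s x))"
  using smooth_along_compose[OF based_family, of a "\<lambda>(s, x). z s x"]
  by (simp add: jointly_smooth_def split_def)

lemma jointly_smooth_of_smooth: "smooth u \<Longrightarrow> jointly_smooth (\<lambda>s. u)"
  unfolding jointly_smooth_def split_def
proof (rule smooth_along_pullback[where T = "space_shift ` Basis" and f = u and \<iota> = snd])
  fix \<tau> assume "\<tau> \<in> family_shifts"
  then show "(\<exists>\<tau>0\<in>space_shift ` Basis. \<forall>p h. snd (\<tau> p h) = \<tau>0 (snd p) h) \<or> (\<forall>p h. snd (\<tau> p h) = snd p)"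
    by (cases rule: family_shifts_cases) (auto simp: par_shift_def pos_shift_def space_shift_def split_def)
qed (auto simp: smooth_iff intro: continuous_intros)

lemma jointly_smooth_slice: "jointly_smooth w \<Longrightarrow> smooth (w s)"
proof -
  assume w: "jointly_smooth w"
  have "smooth_along (space_shift ` Basis) (\<lambda>x. (\<lambda>(s, x). w s x) (s, x))"
  proof (rule smooth_along_pullback[where T = family_shifts and f = "\<lambda>(s, x). w s x" and \<iota> = "\<lambda>x. (s, x)"])
    fix \<tau> :: "space \<Rightarrow> real \<Rightarrow> space" assume "\<tau> \<in> space_shift ` Basis"
    then obtain b where b: "b \<in> Basis" "\<tau> = space_shift b" by auto
    show "(\<exists>\<tau>0\<in>family_shifts. \<forall>p h. (s, \<tau> p h) = \<tau>0 (s, p) h) \<or> (\<forall>p h. (s, \<tau> p h) = (s, p))"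
      by (rule disjI1, rule bexI[OF _ pos_shift_in[OF b(1)]]) (simp add: b(2) pos_shift_def space_shift_def)
  qed (use w in \<open>auto simp: jointly_smooth_def intro: continuous_intros\<close>)
  then show ?thesis by (simp add: smooth_iff)
qed

lemma jointly_smooth_coord: "jointly_smooth (\<lambda>s x. s i)"
  unfolding jointly_smooth_def
proof (rule smooth_along_base)
  fix \<tau> assume "\<tau> \<in> family_shifts"
  then show "\<exists>c. \<forall>p h. (case \<tau> p h of (s, x) \<Rightarrow> s i) = (case p of (s, x) \<Rightarrow> s i) + h *\<^sub>R c"
  proof (cases rule: family_shifts_cases)
    case (1 j)
    then show ?thesis by (intro exI[of _ "if i = j then 1 else 0"]) (auto simp: par_shift_def)
  qed (auto simp: pos_shift_def intro!: exI[of _ 0])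
next
  show "continuous_on UNIV (\<lambda>(s, x :: space). s i :: real)"
    unfolding split_def
    by (rule continuous_on_product_then_coordinatewise[OF continuous_on_fst[OF continuous_on_id]])
qed

lemma jointly_smooth_position: "jointly_smooth (\<lambda>s x. x)"
  by (rule jointly_smooth_of_smooth[OF smooth_id])

definition reset :: "nat \<Rightarrow> real \<Rightarrow> (nat \<Rightarrow> real) \<times> space \<Rightarrow> (nat \<Rightarrow> real) \<times> space" where
  "reset N c = (\<lambda>(s, x). (s(N := c), x))"

lemma cont_update:
  assumes "continuous_on S f" "continuous_on S g"
  shows "continuous_on S (\<lambda>p. (f p)(N := (g p :: real)) :: nat \<Rightarrow> real)"
proof (rule continuous_on_coordinatewise_then_product)
  fix i show "continuous_on S (\<lambda>p. ((f p)(N := g p)) i)"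
    using assms continuous_on_product_then_coordinatewise[OF assms(1), of i] by (cases "i = N") auto
qed

text \<open>Freezing a parameter commutes with every coordinate translation except the one along that parameter, which it
  absorbs.\<close>

lemma reset_shift:
  assumes "\<tau> \<in> family_shifts"
  shows "(\<forall>c p h. reset N c (\<tau> p h) = \<tau> (reset N c p) h) \<or> (\<forall>c p h. reset N c (\<tau> p h) = reset N c p)"
  using assms
  by (cases rule: family_shifts_cases)
    (auto simp: reset_def par_shift_def pos_shift_def split_def fun_upd_twist)

lemma jointly_smooth_reset: "jointly_smooth w \<Longrightarrow> jointly_smooth (\<lambda>s. w (s(N := c)))"
proof -
  assume w: "jointly_smooth w"
  have "smooth_along family_shifts (\<lambda>p. (\<lambda>(s, x). w s x) (reset N c p))"
  proof (rule smooth_along_pullback[where T = family_shifts and f = "\<lambda>(s, x). w s x" and \<iota> = "reset N c"])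
    show "continuous_on UNIV (reset N c)"
      unfolding reset_def split_def by (intro continuous_intros cont_update)
    fix \<tau> assume "\<tau> \<in> family_shifts"
    then show "(\<exists>\<tau>0\<in>family_shifts. \<forall>p h. reset N c (\<tau> p h) = \<tau>0 (reset N c p) h)
        \<or> (\<forall>p h. reset N c (\<tau> p h) = reset N c p)"
      using reset_shift by blast
  qed (use w in \<open>simp add: jointly_smooth_def\<close>)
  then show ?thesis by (simp add: jointly_smooth_def reset_def split_def)
qed

lemma jointly_smooth_cont: "jointly_smooth w \<Longrightarrow> continuous_on UNIV (\<lambda>(s, x). w s x)"
  unfolding jointly_smooth_def by (rule smooth_along_cont)

lemma jointly_smooth_cont_comp:
  assumes "jointly_smooth w" "continuous_on S f" "continuous_on S g"
  shows "continuous_on S (\<lambda>p. w (f p) (g p))"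
  using continuous_on_compose2[OF jointly_smooth_cont[OF assms(1)] continuous_on_Pair[OF assms(2,3)]] by simp

lemma param_deriv_linear:
  "bounded_linear L \<Longrightarrow> jointly_smooth w \<Longrightarrow> param_deriv i (\<lambda>s x. L (w s x)) s x = L (param_deriv i w s x)"
  unfolding param_deriv_def[of i "\<lambda>s x. L (w s x)"]
  by (rule vector_derivative_at[OF bounded_linear.has_vector_derivative[OF _ has_param_deriv_0]])

lemma param_deriv_bilinear:
  assumes "bounded_bilinear B" "jointly_smooth v" "jointly_smooth w"
  shows "param_deriv i (\<lambda>s x. B (v s x) (w s x)) s x = B (v s x) (param_deriv i w s x) + B (param_deriv i v s x) (w s x)"
  unfolding param_deriv_def[of i "\<lambda>s x. B (v s x) (w s x)"]
  using bounded_bilinear.has_vector_derivative[OF assms(1) has_param_deriv_0[OF assms(2)] has_param_deriv_0[OF assms(3)], of s i x s i x]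
  by (auto dest: vector_derivative_at)

text \<open>Along the two coordinates \<open>s i\<close> and \<open>x\<^sub>k\<close> this is the symmetry of mixed derivatives.\<close>

lemma param_deriv_pd:
  fixes w :: "'b::euclidean_space family"
  assumes w: "jointly_smooth w"
  shows "param_deriv i (\<lambda>s. pd k (w s)) s x = pd k (param_deriv i w s) x"
proof -
  let ?e = "axis k 1 :: space"
  have "((\<lambda>h. pd k (w (s(i := h))) (x + 0 *\<^sub>R ?e)) has_vector_derivative
      pd k (param_deriv i w (s(i := s i))) (x + 0 *\<^sub>R ?e)) (at (s i))"
  proof (rule mixed_derivatives_commute[where f = "\<lambda>h k. w (s(i := h)) (x + k *\<^sub>R ?e)"
        and ?f1.0 = "\<lambda>h k. param_deriv i w (s(i := h)) (x + k *\<^sub>R ?e)"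
        and ?f2.0 = "\<lambda>h t. pd k (w (s(i := h))) (x + t *\<^sub>R ?e)"
        and ?f12.0 = "\<lambda>h t. pd k (param_deriv i w (s(i := h))) (x + t *\<^sub>R ?e)"])
    show "continuous_on UNIV (\<lambda>(h, t). pd k (param_deriv i w (s(i := h))) (x + t *\<^sub>R ?e))"
      unfolding split_def
      by (intro jointly_smooth_cont_comp[OF jointly_smooth_pd[OF jointly_smooth_param_deriv[OF w]]] cont_update continuous_intros)
  qed (rule has_param_deriv[OF w] has_pd[OF jointly_smooth_slice[OF w]] has_pd[OF jointly_smooth_slice[OF jointly_smooth_param_deriv[OF w]]])+
  then have "((\<lambda>h. pd k (w (s(i := h))) x) has_vector_derivative pd k (param_deriv i w s) x) (at (s i))"
    by simp
  moreover have "((\<lambda>h. pd k (w (s(i := h))) x) has_vector_derivative param_deriv i (\<lambda>s. pd k (w s)) s x) (at (s i))"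
    using has_param_deriv[OF jointly_smooth_pd[OF w], of k s i x "s i" UNIV] by simp
  ultimately show ?thesis by (rule vector_derivative_unique_at[symmetric])
qed

section \<open>Families with localised support\<close>

definition constant_beyond :: "real \<Rightarrow> ('a::real_normed_vector \<Rightarrow> 'b) \<Rightarrow> bool" where
  "constant_beyond R f \<longleftrightarrow> (\<forall>x y. R \<le> norm x \<longrightarrow> R \<le> norm y \<longrightarrow> f x = f y)"

text \<open>The support conditions of field families hold with a radius that is uniform near each parameter value.
  The predicate \<open>P R\<close> is \<open>vanishes_beyond R\<close> or \<open>constant_beyond R\<close>.\<close>

definition locally_beyond :: "(real \<Rightarrow> 'c \<Rightarrow> bool) \<Rightarrow> ((nat \<Rightarrow> real) \<Rightarrow> 'c) \<Rightarrow> bool" where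
  "locally_beyond P w \<longleftrightarrow> (\<forall>s0. \<exists>R. \<forall>\<^sub>F s in nhds s0. P R (w s))"

text \<open>The notions of \<open>field_family\<close> and \<open>asymp_const_family\<close> for arbitrary value types: the integrands
  are real-valued families.\<close>

definition compact_family :: "'b::real_normed_vector family \<Rightarrow> bool" where
  "compact_family w \<longleftrightarrow> finite_dependence w \<and> jointly_smooth w \<and> locally_beyond vanishes_beyond w"

definition asymp_family :: "'b::real_normed_vector family \<Rightarrow> bool" where
  "asymp_family w \<longleftrightarrow> finite_dependence w \<and> jointly_smooth w \<and> locally_beyond constant_beyond w"

lemma field_family_iff: "field_family u \<longleftrightarrow> compact_family u"
  unfolding field_family_def compact_family_def smooth_family_iff locally_beyond_def vanishes_beyond_def
    eventually_nhds by blast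

lemma asymp_const_family_iff: "asymp_const_family w \<longleftrightarrow> asymp_family w"
  unfolding asymp_const_family_def asymp_family_def smooth_family_iff locally_beyond_def constant_beyond_def
    eventually_nhds by blast

lemma constant_beyond_mono: "constant_beyond R f \<Longrightarrow> R \<le> R' \<Longrightarrow> constant_beyond R' f"
  unfolding constant_beyond_def by (meson order_trans)

lemma vanishes_constant: "vanishes_beyond R f \<Longrightarrow> constant_beyond R f"
  by (simp add: vanishes_beyond_def constant_beyond_def)

text \<open>The unit margin puts a neighbourhood of \<open>x\<close> into the region where \<open>f\<close> is constant.\<close>

lemma pd_vanishes: "constant_beyond R f \<Longrightarrow> vanishes_beyond (R + 1) (pd k f)"
  unfolding vanishes_beyond_def
proof (intro allI impI)
  fix x :: space assume c: "constant_beyond R f" and x: "R + 1 \<le> norm x"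
  have "R \<le> norm (x + h *\<^sub>R axis k 1)" if "h \<in> ball 0 1" for h
    using norm_triangle_ineq4[of "x + h *\<^sub>R axis k 1" "h *\<^sub>R axis k 1"] that x by (simp add: norm_axis_1)
  then have e: "f x = f (x + h *\<^sub>R axis k 1)" if "h \<in> ball 0 1" for h
    using c x that unfolding constant_beyond_def by (smt (verit))
  have "((\<lambda>h. f (x + h *\<^sub>R axis k 1)) has_vector_derivative 0) (at 0)"
    by (rule has_vector_derivative_transform_within_open[where S = "ball 0 1" and f = "\<lambda>h. f x"])
      (use e in auto)
  then show "pd k f x = 0" by (rule pd_eqI)
qed

subsection \<open>Closure properties of finite dependence\<close>

lemma finite_dependence_const: "finite_dependence (\<lambda>s. c)"
  by (simp add: finite_dependence_def)

lemma finite_dependence_map: "finite_dependence w \<Longrightarrow> finite_dependence (\<lambda>s. \<Phi> (w s))"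
  unfolding finite_dependence_def by metis

lemma finite_dependence_comb:
  assumes "finite_dependence v" "finite_dependence w"
  shows "finite_dependence (\<lambda>s. \<Phi> (v s) (w s))"
proof -
  obtain m where m: "\<And>s s'. (\<forall>i<m. s i = s' i) \<Longrightarrow> v s = v s'"
    using assms(1) unfolding finite_dependence_def by blast
  obtain n where n: "\<And>s s'. (\<forall>i<n. s i = s' i) \<Longrightarrow> w s = w s'"
    using assms(2) unfolding finite_dependence_def by blast
  show ?thesis
    unfolding finite_dependence_def
  proof (intro exI[of _ "max m n"] allI impI)
    fix s s' :: "nat \<Rightarrow> real" assume "\<forall>i<max m n. s i = s' i"
    then have "v s = v s'" "w s = w s'" by (auto intro!: m n)
    then show "\<Phi> (v s) (w s) = \<Phi> (v s') (w s')" by simp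
  qed
qed

lemma finite_dependence_coord: "finite_dependence (\<lambda>s. \<Phi> (s i))"
  unfolding finite_dependence_def by (intro exI[of _ "Suc i"]) auto

lemma finite_dependence_reset: "finite_dependence w \<Longrightarrow> finite_dependence (\<lambda>s. w (s(N := c)))"
proof -
  assume "finite_dependence w"
  then obtain n where n: "\<And>s s'. (\<forall>i<n. s i = s' i) \<Longrightarrow> w s = w s'"
    unfolding finite_dependence_def by blast
  show ?thesis
    unfolding finite_dependence_def by (intro exI[of _ n] allI impI n) simp
qed

lemma finite_dependence_param_deriv: "finite_dependence w \<Longrightarrow> finite_dependence (param_deriv i w)"
proof -
  assume "finite_dependence w"
  then obtain n where n: "\<And>s s'. (\<forall>i<n. s i = s' i) \<Longrightarrow> w s = w s'"
    unfolding finite_dependence_def by blast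
  show ?thesis
    unfolding finite_dependence_def
  proof (intro exI[of _ n] allI impI ext)
    fix s s' :: "nat \<Rightarrow> real" and x assume e: "\<forall>j<n. s j = s' j"
    have "w (s(i := s i + h)) = w (s'(i := s' i + h))" if "i < n" for h
      using e that by (intro n) auto
    moreover have "w (s(i := t)) = w (s'(i := t'))" if "\<not> i < n" for t t'
      using e that by (intro n) auto
    ultimately show "param_deriv i w s x = param_deriv i w s' x"
      unfolding param_deriv_def by (cases "i < n") metis+
  qed
qed

text \<open>Supplies parameters that the family does not use; such a parameter is then free to run along a line of
  fields.\<close>

lemma finite_dependence_bound:
  assumes "finite_dependence w"
  obtains n where "\<And>N s t. n \<le> N \<Longrightarrow> w (s(N := t)) = w s"
proof -
  obtain n where n: "\<And>s s'. (\<forall>i<n. s i = s' i) \<Longrightarrow> w s = w s'"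
    using assms unfolding finite_dependence_def by blast
  show thesis by (rule that[of n]) (auto intro!: n)
qed

subsection \<open>Closure properties of local support conditions\<close>

lemma locally_beyond_const: "P R f \<Longrightarrow> locally_beyond P (\<lambda>s. f)"
  unfolding locally_beyond_def by (auto intro: exI[of _ R])

text \<open>The radius grows by one, which leaves room for differentiation in space.\<close>

lemma locally_beyond_map:
  assumes "locally_beyond P w" "\<And>R f. P R f \<Longrightarrow> Q (R + 1) (\<Phi> f)"
  shows "locally_beyond Q (\<lambda>s. \<Phi> (w s))"
  unfolding locally_beyond_def
proof
  fix s0
  obtain R where "\<forall>\<^sub>F s in nhds s0. P R (w s)" using assms(1) unfolding locally_beyond_def by blast
  then have "\<forall>\<^sub>F s in nhds s0. Q (R + 1) (\<Phi> (w s))" by (rule eventually_mono) (rule assms(2))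
  then show "\<exists>R. \<forall>\<^sub>F s in nhds s0. Q R (\<Phi> (w s))" by blast
qed

lemma locally_beyond_comb:
  assumes "locally_beyond P v" "locally_beyond Q w"
    and "\<And>R R' f g. P R f \<Longrightarrow> Q R' g \<Longrightarrow> S (max R R') (\<Phi> f g)"
  shows "locally_beyond S (\<lambda>s. \<Phi> (v s) (w s))"
  unfolding locally_beyond_def
proof
  fix s0
  obtain R where R: "\<forall>\<^sub>F s in nhds s0. P R (v s)" using assms(1) unfolding locally_beyond_def by blast
  obtain R' where R': "\<forall>\<^sub>F s in nhds s0. Q R' (w s)" using assms(2) unfolding locally_beyond_def by blast
  have "\<forall>\<^sub>F s in nhds s0. S (max R R') (\<Phi> (v s) (w s))"
    using R R' by eventually_elim (rule assms(3))
  then show "\<exists>R. \<forall>\<^sub>F s in nhds s0. S R (\<Phi> (v s) (w s))" by blast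
qed

lemma locally_beyond_open:
  assumes "locally_beyond P w"
  obtains R U where "open U" "s0 \<in> U" "\<And>s. s \<in> U \<Longrightarrow> P R (w s)"
  using assms unfolding locally_beyond_def eventually_nhds by meson

lemma locally_beyond_openI:
  assumes "\<And>s0. \<exists>R U. open U \<and> s0 \<in> U \<and> (\<forall>s\<in>U. P R (w s))"
  shows "locally_beyond P w"
  using assms unfolding locally_beyond_def eventually_nhds by meson

lemma locally_beyond_reset: 
  assumes "locally_beyond P w"
  shows "locally_beyond P (\<lambda>s. w (s(N := c)))"
proof (rule locally_beyond_openI)
  fix s0 :: "nat \<Rightarrow> real"
  obtain R U where U: "open U" "s0(N := c) \<in> U" "\<And>s. s \<in> U \<Longrightarrow> P R (w s)"
    using locally_beyond_open[OF assms] by metis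
  have "open ((\<lambda>s. s(N := c)) -` U)"
    using U(1) by (intro open_vimage cont_update continuous_intros)
  then show "\<exists>R U. open U \<and> s0 \<in> U \<and> (\<forall>s\<in>U. P R (w (s(N := c))))"
    using U by (intro exI[of _ R] exI[of _ "(\<lambda>s. s(N := c)) -` U"]) auto
qed

lemma param_shift_eventually:
  fixes s :: "nat \<Rightarrow> real"
  assumes "open U" "s \<in> U"
  shows "\<forall>\<^sub>F h in nhds 0. s(i := s i + h) \<in> U"
proof -
  have "open ((\<lambda>h. s(i := s i + h)) -` U)"
    using assms(1) by (intro open_vimage cont_update continuous_intros)
  then show ?thesis using assms(2) unfolding eventually_nhds by (intro exI[of _ "(\<lambda>h. s(i := s i + h)) -` U"]) auto
qed

text \<open>A parameter derivative only sees parameters near \<open>s\<close>. Local support conditions are therefore inherited with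
  the same radius.\<close>

lemma param_deriv_cong:
  assumes "open U" "s \<in> U" "\<And>s. s \<in> U \<Longrightarrow> w s x = w' s y"
  shows "param_deriv i w s x = param_deriv i w' s y"
  unfolding param_deriv_def
  by (rule vector_derivative_cong_eq) (auto intro: eventually_mono[OF param_shift_eventually[OF assms(1,2)]] assms(3))

lemma locally_beyond_param_deriv_constant:
  assumes "locally_beyond constant_beyond w"
  shows "locally_beyond constant_beyond (param_deriv i w)"
proof (rule locally_beyond_openI)
  fix s0 :: "nat \<Rightarrow> real"
  obtain R U where U: "open U" "s0 \<in> U" "\<And>s. s \<in> U \<Longrightarrow> constant_beyond R (w s)"
    using locally_beyond_open[OF assms] by metis
  have "constant_beyond R (param_deriv i w s)" if "s \<in> U" for s
    unfolding constant_beyond_def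
  proof (intro allI impI)
    fix x y :: space assume "R \<le> norm x" "R \<le> norm y"
    then have "w s x = w s y" if "s \<in> U" for s
      using U(3)[OF that] unfolding constant_beyond_def by blast
    then show "param_deriv i w s x = param_deriv i w s y"
      by (rule param_deriv_cong[OF U(1) that])
  qed
  then show "\<exists>R U. open U \<and> s0 \<in> U \<and> (\<forall>s\<in>U. constant_beyond R (param_deriv i w s))"
    using U(1,2) by (intro exI[of _ R] exI[of _ U]) simp
qed

lemma param_deriv_vanishes:
  assumes "open U" "\<And>s. s \<in> U \<Longrightarrow> vanishes_beyond R (w s)" "s \<in> U"
  shows "vanishes_beyond R (param_deriv i w s)"
  unfolding vanishes_beyond_def
proof (intro allI impI)
  fix x :: space assume x: "R \<le> norm x"
  have "param_deriv i w s x = param_deriv i (\<lambda>s x. 0) s x"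
    using assms(2) x by (intro param_deriv_cong[OF assms(1,3)]) (auto simp: vanishes_beyond_def)
  then show "param_deriv i w s x = 0" by (simp add: param_deriv_def)
qed

lemma locally_beyond_param_deriv_vanishes:
  assumes "locally_beyond vanishes_beyond w"
  shows "locally_beyond vanishes_beyond (param_deriv i w)"
proof (rule locally_beyond_openI)
  fix s0 :: "nat \<Rightarrow> real"
  obtain R U where U: "open U" "s0 \<in> U" "\<And>s. s \<in> U \<Longrightarrow> vanishes_beyond R (w s)"
    using locally_beyond_open[OF assms] by metis
  then show "\<exists>R U. open U \<and> s0 \<in> U \<and> (\<forall>s\<in>U. vanishes_beyond R (param_deriv i w s))"
    using param_deriv_vanishes[OF U(1) U(3)] by (intro exI[of _ R] exI[of _ U]) simp
qed

subsection \<open>Closure properties of families\<close>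

lemma compact_family_jointly_smooth: "compact_family w \<Longrightarrow> jointly_smooth w" and asymp_family_jointly_smooth: "asymp_family w \<Longrightarrow> jointly_smooth w"
  by (simp_all add: compact_family_def asymp_family_def)

lemma compact_imp_asymp_family:
  assumes "compact_family w"
  shows "asymp_family w"
  unfolding asymp_family_def
proof (intro conjI)
  have "constant_beyond (R + 1) f" if "vanishes_beyond R f" for R and f :: "space \<Rightarrow> 'a"
    by (rule constant_beyond_mono[OF vanishes_constant[OF that]]) simp
  then show "locally_beyond constant_beyond w"
    using assms locally_beyond_map[of vanishes_beyond w constant_beyond "\<lambda>f. f"] by (simp add: compact_family_def)
qed (use assms in \<open>auto simp: compact_family_def\<close>)

lemma asymp_family_linear:
  assumes "bounded_linear L" "asymp_family w"
  shows "asymp_family (\<lambda>s x. L (w s x))"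
  unfolding asymp_family_def
proof (intro conjI)
  have w: "finite_dependence w" "jointly_smooth w" "locally_beyond constant_beyond w"
    using assms(2) by (simp_all add: asymp_family_def)
  show "finite_dependence (\<lambda>s x. L (w s x))"
    by (rule finite_dependence_map[OF w(1), of "\<lambda>f x. L (f x)"])
  show "jointly_smooth (\<lambda>s x. L (w s x))"
    by (rule jointly_smooth_linear[OF assms(1) w(2)])
  show "locally_beyond constant_beyond (\<lambda>s x. L (w s x))"
  proof (rule locally_beyond_map[OF w(3), of _ "\<lambda>f x. L (f x)"])
    fix R and f :: "space \<Rightarrow> 'a" assume "constant_beyond R f"
    then have "constant_beyond R (\<lambda>x. L (f x))" unfolding constant_beyond_def by metis
    then show "constant_beyond (R + 1) (\<lambda>x. L (f x))" by (rule constant_beyond_mono) simp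
  qed
qed

lemma compact_family_linear:
  assumes "bounded_linear L" "compact_family w"
  shows "compact_family (\<lambda>s x. L (w s x))"
  unfolding compact_family_def
proof (intro conjI)
  have w: "finite_dependence w" "jointly_smooth w" "locally_beyond vanishes_beyond w"
    using assms(2) by (simp_all add: compact_family_def)
  show "finite_dependence (\<lambda>s x. L (w s x))"
    by (rule finite_dependence_map[OF w(1), of "\<lambda>f x. L (f x)"])
  show "jointly_smooth (\<lambda>s x. L (w s x))"
    by (rule jointly_smooth_linear[OF assms(1) w(2)])
  show "locally_beyond vanishes_beyond (\<lambda>s x. L (w s x))"
    by (rule locally_beyond_map[OF w(3), of _ "\<lambda>f x. L (f x)"])
      (simp add: vanishes_beyond_def linear_simps(3)[OF assms(1)])
qed

lemma asymp_family_add: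
  assumes "asymp_family v" and "asymp_family w"
  shows "asymp_family (\<lambda>s x. v s x + w s x)"
  unfolding asymp_family_def
proof (intro conjI)
  have v: "finite_dependence v" "jointly_smooth v" "locally_beyond constant_beyond v"
    using assms by (simp_all add: asymp_family_def)
  have w: "finite_dependence w" "jointly_smooth w" "locally_beyond constant_beyond w"
    using assms by (simp_all add: asymp_family_def)
  show "finite_dependence (\<lambda>s x. v s x + w s x)"
    by (rule finite_dependence_comb[OF v(1) w(1), of "\<lambda>f g x. f x + g x"])
  show "jointly_smooth (\<lambda>s x. v s x + w s x)"
    by (rule jointly_smooth_add[OF v(2) w(2)])
  show "locally_beyond constant_beyond (\<lambda>s x. v s x + w s x)"
    by (rule locally_beyond_comb[OF v(3) w(3), of _ "\<lambda>f g x. f x + g x"]) (simp add: constant_beyond_def, metis)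
qed

lemma compact_family_add:
  assumes "compact_family v" and "compact_family w"
  shows "compact_family (\<lambda>s x. v s x + w s x)"
  unfolding compact_family_def
proof (intro conjI)
  have v: "finite_dependence v" "jointly_smooth v" "locally_beyond vanishes_beyond v"
    using assms by (simp_all add: compact_family_def)
  have w: "finite_dependence w" "jointly_smooth w" "locally_beyond vanishes_beyond w"
    using assms by (simp_all add: compact_family_def)
  show "finite_dependence (\<lambda>s x. v s x + w s x)"
    by (rule finite_dependence_comb[OF v(1) w(1), of "\<lambda>f g x. f x + g x"])
  show "jointly_smooth (\<lambda>s x. v s x + w s x)"
    by (rule jointly_smooth_add[OF v(2) w(2)])
  show "locally_beyond vanishes_beyond (\<lambda>s x. v s x + w s x)"
    by (rule locally_beyond_comb[OF v(3) w(3), of _ "\<lambda>f g x. f x + g x"]) (simp add: vanishes_beyond_def)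
qed

lemma asymp_family_bilinear:
  assumes B: "bounded_bilinear B" and "asymp_family v" and "asymp_family w"
  shows "asymp_family (\<lambda>s x. B (v s x) (w s x))"
  unfolding asymp_family_def
proof (intro conjI)
  have v: "finite_dependence v" "jointly_smooth v" "locally_beyond constant_beyond v"
    using assms by (simp_all add: asymp_family_def)
  have w: "finite_dependence w" "jointly_smooth w" "locally_beyond constant_beyond w"
    using assms by (simp_all add: asymp_family_def)
  show "finite_dependence (\<lambda>s x. B (v s x) (w s x))"
    by (rule finite_dependence_comb[OF v(1) w(1), of "\<lambda>f g x. B (f x) (g x)"])
  show "jointly_smooth (\<lambda>s x. B (v s x) (w s x))"
    by (rule jointly_smooth_bilinear[OF assms(1) v(2) w(2)])
  show "locally_beyond constant_beyond (\<lambda>s x. B (v s x) (w s x))"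
    by (rule locally_beyond_comb[OF v(3) w(3), of _ "\<lambda>f g x. B (f x) (g x)"]) (simp add: constant_beyond_def, metis)
qed

lemma compact_family_bilinear:
  assumes B: "bounded_bilinear B" and "asymp_family v" and "compact_family w"
  shows "compact_family (\<lambda>s x. B (v s x) (w s x))"
  unfolding compact_family_def
proof (intro conjI)
  have v: "finite_dependence v" "jointly_smooth v" "locally_beyond constant_beyond v"
    using assms by (simp_all add: asymp_family_def)
  have w: "finite_dependence w" "jointly_smooth w" "locally_beyond vanishes_beyond w"
    using assms by (simp_all add: compact_family_def)
  show "finite_dependence (\<lambda>s x. B (v s x) (w s x))"
    by (rule finite_dependence_comb[OF v(1) w(1), of "\<lambda>f g x. B (f x) (g x)"])
  show "jointly_smooth (\<lambda>s x. B (v s x) (w s x))"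
    by (rule jointly_smooth_bilinear[OF assms(1) v(2) w(2)])
  show "locally_beyond vanishes_beyond (\<lambda>s x. B (v s x) (w s x))"
    by (rule locally_beyond_comb[OF v(3) w(3), of _ "\<lambda>f g x. B (f x) (g x)"]) (simp add: vanishes_beyond_def bounded_bilinear.zero_right[OF B])
qed

lemma compact_family_pd: "asymp_family w \<Longrightarrow> compact_family (\<lambda>s. pd k (w s))"
  unfolding asymp_family_def compact_family_def
  using finite_dependence_map[of w "pd k"] locally_beyond_map[of constant_beyond w vanishes_beyond "pd k", OF _ pd_vanishes]
  by (auto intro: jointly_smooth_pd)

lemma asymp_family_param_deriv: "asymp_family w \<Longrightarrow> asymp_family (param_deriv i w)"
  unfolding asymp_family_def using finite_dependence_param_deriv jointly_smooth_param_deriv locally_beyond_param_deriv_constant by blast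

lemma compact_family_param_deriv: "compact_family w \<Longrightarrow> compact_family (param_deriv i w)"
  unfolding compact_family_def using finite_dependence_param_deriv jointly_smooth_param_deriv locally_beyond_param_deriv_vanishes by blast

lemma asymp_family_reset: "asymp_family w \<Longrightarrow> asymp_family (\<lambda>s. w (s(N := c)))"
  unfolding asymp_family_def by (intro conjI finite_dependence_reset jointly_smooth_reset locally_beyond_reset) auto

lemma asymp_family_coord: "asymp_family (\<lambda>s x. s i)"
  unfolding asymp_family_def
  by (intro conjI finite_dependence_coord[of "\<lambda>t x. t"] jointly_smooth_coord locally_beyond_openI) (auto simp: constant_beyond_def)

lemma compact_family_constant_family: "smooth u \<Longrightarrow> vanishes_beyond R u \<Longrightarrow> compact_family (\<lambda>s. u)"
  unfolding compact_family_def by (intro conjI finite_dependence_const jointly_smooth_of_smooth locally_beyond_const[of _ R])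

lemma compact_family_field: "u \<in> fields \<Longrightarrow> compact_family (\<lambda>s. u)"
  by (auto simp: fields_iff intro: compact_family_constant_family)

lemma compact_family_slice:
  assumes "compact_family w"
  shows "smooth (w s)" and "\<exists>R. vanishes_beyond R (w s)"
  subgoal using jointly_smooth_slice[of w s] assms by (simp add: compact_family_def)
  subgoal using locally_beyond_open[of vanishes_beyond w s] assms unfolding compact_family_def by metis
  done

lemma asymp_family_slice:
  assumes "asymp_family w"
  shows "smooth (w s)" and "\<exists>R. constant_beyond R (w s)"
  subgoal using jointly_smooth_slice[of w s] assms by (simp add: asymp_family_def)
  subgoal using locally_beyond_open[of constant_beyond w s] assms unfolding asymp_family_def by metis
  done

lemma compact_family_slice_field: "compact_family w \<Longrightarrow> w s \<in> fields"
  using compact_family_slice by (auto simp: fields_iff)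

subsection \<open>Integrals of families\<close>

text \<open>Near a given parameter all supports lie in one cube. There the rules for integrals with parameters over a
  box become available, for the family and for its derivatives.\<close>

lemma integral_family_local:
  fixes w :: "real family"
  assumes "compact_family w"
  obtains R U where "open U" "s0 \<in> U"
    "\<And>s. s \<in> U \<Longrightarrow> (\<integral>x. w s x \<partial>lborel) = integral (cube R) (w s)"
    "\<And>s i. s \<in> U \<Longrightarrow> (\<integral>x. param_deriv i w s x \<partial>lborel) = integral (cube R) (param_deriv i w s)"
proof -
  obtain R U where U: "open U" "s0 \<in> U" "\<And>s. s \<in> U \<Longrightarrow> vanishes_beyond R (w s)"
    using locally_beyond_open[of vanishes_beyond w s0] assms unfolding compact_family_def by metis
  show thesis
  proof (rule that[OF U(1,2)])
    fix s i assume s: "s \<in> U"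
    show "(\<integral>x. w s x \<partial>lborel) = integral (cube R) (w s)"
      by (rule compact_support_integral(2)[symmetric, OF smooth_cont[OF jointly_smooth_slice[OF compact_family_jointly_smooth[OF assms]]] U(3)[OF s]])
    show "(\<integral>x. param_deriv i w s x \<partial>lborel) = integral (cube R) (param_deriv i w s)"
      by (rule compact_support_integral(2)[symmetric, OF smooth_cont[OF jointly_smooth_slice[OF jointly_smooth_param_deriv[OF compact_family_jointly_smooth[OF assms]]]]
            param_deriv_vanishes[OF U(1) U(3) s]])
  qed
qed

lemma integral_family_has_derivative:
  fixes w :: "real family"
  assumes w: "compact_family w"
  shows "((\<lambda>h. \<integral>x. w (s(i := s i + h)) x \<partial>lborel) has_vector_derivative (\<integral>x. param_deriv i w s x \<partial>lborel)) (at 0)"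
proof -
  note js = compact_family_jointly_smooth[OF w]
  obtain R U where U: "open U" "s \<in> U"
    "\<And>s. s \<in> U \<Longrightarrow> (\<integral>x. w s x \<partial>lborel) = integral (cube R) (w s)"
    "\<And>s i. s \<in> U \<Longrightarrow> (\<integral>x. param_deriv i w s x \<partial>lborel) = integral (cube R) (param_deriv i w s)"
    by (rule integral_family_local[OF w, where ?s0.0 = s]) (rule that, assumption+)
  obtain V where V: "open V" "0 \<in> V" "\<And>h. h \<in> V \<Longrightarrow> s(i := s i + h) \<in> U"
    using param_shift_eventually[OF U(1,2), of i] unfolding eventually_nhds by blast
  have "((\<lambda>h. integral (cube R) (w (s(i := s i + h)))) has_vector_derivative
      integral (cube R) (param_deriv i w (s(i := s i + 0)))) (at 0 within UNIV)"
    unfolding cube_def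
  proof (rule leibniz_rule_vector_derivative)
    fix h x
    show "((\<lambda>h. w (s(i := s i + h)) x) has_vector_derivative param_deriv i w (s(i := s i + h)) x) (at h within UNIV)"
    proof (rule real_shift_derivative)
      show "((\<lambda>h. w (s(i := s i + (t + h))) x) has_vector_derivative param_deriv i w (s(i := s i + t)) x) (at 0)" for t
        using has_param_deriv_0[OF js, of "s(i := s i + t)" i x] by (simp add: add.assoc)
    qed
  next
    fix h show "w (s(i := s i + h)) integrable_on cbox (- R *\<^sub>R One) (R *\<^sub>R One)"
      by (intro integrable_continuous continuous_on_subset[OF smooth_cont[OF jointly_smooth_slice[OF js]]]) simp
  next
    show "continuous_on (UNIV \<times> cbox (- R *\<^sub>R One) (R *\<^sub>R One)) (\<lambda>(h, x). param_deriv i w (s(i := s i + h)) x)"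
      unfolding split_def by (intro jointly_smooth_cont_comp[OF jointly_smooth_param_deriv[OF js]] cont_update continuous_intros)
  qed auto
  then have "((\<lambda>h. integral (cube R) (w (s(i := s i + h)))) has_vector_derivative
      (\<integral>x. param_deriv i w s x \<partial>lborel)) (at 0)"
    using U(4)[OF U(2)] by simp
  then show ?thesis
    by (rule has_vector_derivative_transform_within_open[OF _ V(1,2)]) (simp add: U(3) V(3))
qed

lemma integral_family_continuous:
  fixes w :: "real family"
  assumes w: "compact_family w"
  shows "continuous_on UNIV (\<lambda>s. \<integral>x. w s x \<partial>lborel)"
proof -
  have "\<exists>U. s \<in> U \<and> open U \<and> continuous_on U (\<lambda>s. \<integral>x. w s x \<partial>lborel)" for s
  proof -
    obtain R U where U: "open U" "s \<in> U" "\<And>s. s \<in> U \<Longrightarrow> (\<integral>x. w s x \<partial>lborel) = integral (cube R) (w s)"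
      using integral_family_local[OF w, where ?s0.0 = s] by metis
    have "continuous_on U (\<lambda>s. integral (cube R) (w s))"
      unfolding cube_def
      by (rule integral_continuous_on_param) (rule continuous_on_subset[OF jointly_smooth_cont[OF compact_family_jointly_smooth[OF w]]], simp)
    then have "continuous_on U (\<lambda>s. \<integral>x. w s x \<partial>lborel)"
      by (rule continuous_on_eq) (simp add: U(3))
    then show ?thesis using U by blast
  qed
  then obtain U where U: "\<And>s. s \<in> U s" "\<And>s. open (U s)" "\<And>s. continuous_on (U s) (\<lambda>s. \<integral>x. w s x \<partial>lborel)"
    by metis
  have "continuous_on (\<Union>s. U s) (\<lambda>s. \<integral>x. w s x \<partial>lborel)"
    using U(2,3) by (intro continuous_on_open_UN) auto
  moreover have "(\<Union>s. U s) = UNIV" using U(1) by auto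
  ultimately show ?thesis by simp
qed

text \<open>Each parameter derivative is the integral of a family of the same kind, so the order of
  differentiability can be raised by induction.\<close>

lemma integral_family_smooth:
  fixes w :: "real family"
  assumes "compact_family w"
  shows "jointly_smooth (\<lambda>s y. \<integral>x. w s x \<partial>lborel)"
proof -
  have "Ck_along family_shifts m (\<lambda>p. \<integral>x. w (fst p) x \<partial>lborel)" for m
    using assms
  proof (induction m arbitrary: w)
    case 0
    then show ?case
      using continuous_on_compose2[OF integral_family_continuous[OF 0] continuous_on_fst[OF continuous_on_id]] by simp
  next
    case (Suc m)
    show ?case
    proof (rule Ck_along_SucI_ex)
      show "continuous_on UNIV (\<lambda>p. \<integral>x. w (fst p) x \<partial>lborel)"
        using continuous_on_compose2[OF integral_family_continuous[OF Suc.prems] continuous_on_fst[OF continuous_on_id]] by simp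
      fix \<tau> assume "\<tau> \<in> family_shifts"
      then show "\<exists>g. (\<forall>p. ((\<lambda>h. \<integral>x. w (fst (\<tau> p h)) x \<partial>lborel) has_vector_derivative g p) (at 0))
          \<and> Ck_along family_shifts m g"
      proof (cases rule: family_shifts_cases)
        case (1 i)
        have e: "fst (\<tau> p h) = (fst p)(i := fst p i + h)" for p h
          by (simp add: 1 par_shift_def split_def)
        show ?thesis
          unfolding e
          by (intro exI[of _ "\<lambda>p. \<integral>x. param_deriv i w (fst p) x \<partial>lborel"] conjI allI
              Suc.IH compact_family_param_deriv Suc.prems integral_family_has_derivative[OF Suc.prems])
      next
        case (2 b)
        show ?thesis
          by (intro exI[of _ "\<lambda>p. 0"] conjI allI Ck_along_const) (auto simp: 2 pos_shift_def split_def)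
      qed
    qed
  qed
  then show ?thesis by (simp add: jointly_smooth_def smooth_along_def split_def)
qed

text \<open>Translations either commute with the freezing of parameter \<open>N\<close>, and are then differentiated under the
  integral, or do not change the frozen family at all.\<close>

lemma averaged_family_smooth:
  fixes w :: "real family"
  assumes "jointly_smooth w"
  shows "jointly_smooth (\<lambda>s x. integral {0..1} (\<lambda>r. w (s(N := r)) x))"
proof -
  have cres: "continuous_on UNIV (\<lambda>q :: ((nat \<Rightarrow> real) \<times> space) \<times> real. reset N (snd q) (fst q))"
    unfolding reset_def split_def
    by (intro continuous_on_Pair cont_update continuous_on_fst continuous_on_snd continuous_on_id)
  have cf: "continuous_on (UNIV \<times> cbox 0 1) (\<lambda>(p, r). f (reset N r p))"
    if "continuous_on UNIV f" for f :: "(nat \<Rightarrow> real) \<times> space \<Rightarrow> real"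
    unfolding split_def
    by (rule continuous_on_compose2[OF that continuous_on_subset[OF cres]]) auto
  have "Ck_along family_shifts m (\<lambda>p. integral (cbox 0 1) (\<lambda>r. f (reset N r p)))"
    if "\<And>m. Ck_along family_shifts m f" for m and f :: "(nat \<Rightarrow> real) \<times> space \<Rightarrow> real"
    using that
  proof (induction m arbitrary: f)
    case (0 f)
    show ?case using integral_continuous_on_param[OF cf[OF Ck_along_cont[OF 0]]] by simp
  next
    case (Suc m f)
    have cont: "continuous_on UNIV f" using Suc.prems by (rule Ck_along_cont)
    show ?case
    proof (rule Ck_along_SucI_ex)
      show "continuous_on UNIV (\<lambda>p. integral (cbox 0 1) (\<lambda>r. f (reset N r p)))"
        by (rule integral_continuous_on_param[OF cf[OF cont]])
      fix \<tau> assume t: "\<tau> \<in> family_shifts"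
      have D: "((\<lambda>h. f (\<tau> p h)) has_vector_derivative deriv_along \<tau> f p) (at 0)" for p
        by (rule Ck_along_SucD(1)[OF Suc.prems t])
      have C: "Ck_along family_shifts m (deriv_along \<tau> f)" for m
        by (rule Ck_along_SucD(2)[OF Suc.prems t])
      consider "\<And>c p h. reset N c (\<tau> p h) = \<tau> (reset N c p) h" | "\<And>c p h. reset N c (\<tau> p h) = reset N c p"
        using reset_shift[OF t, of N] by blast
      then show "\<exists>g. (\<forall>p. ((\<lambda>h. integral (cbox 0 1) (\<lambda>r. f (reset N r (\<tau> p h)))) has_vector_derivative g p) (at 0))
          \<and> Ck_along family_shifts m g"
      proof cases
        case 1
        have "((\<lambda>h. integral (cbox 0 1) (\<lambda>r. f (\<tau> (reset N r p) h))) has_vector_derivative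
            integral (cbox 0 1) (\<lambda>r. deriv_along \<tau> f (\<tau> (reset N r p) 0))) (at 0 within UNIV)" for p
        proof (rule leibniz_rule_vector_derivative)
          fix h r
          show "((\<lambda>h. f (\<tau> (reset N r p) h)) has_vector_derivative deriv_along \<tau> f (\<tau> (reset N r p) h)) (at h within UNIV)"
          proof (rule real_shift_derivative)
            show "((\<lambda>h. f (\<tau> (reset N r p) (u + h))) has_vector_derivative
                deriv_along \<tau> f (\<tau> (reset N r p) u)) (at 0)" for u
              using D[of "\<tau> (reset N r p) u"] by (simp add: family_shifts_add[OF t])
          qed
        next
          have cr: "continuous_on UNIV (\<lambda>q. \<tau> (reset N (snd q) p) (fst q))"
            using t
          proof (cases rule: family_shifts_cases)
            case (1 i)
            show ?thesis
              unfolding 1 reset_def par_shift_def split_def fst_conv snd_conv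
              by (intro continuous_on_Pair cont_update continuous_on_add continuous_on_fst continuous_on_snd
                  continuous_on_id continuous_on_const
                  continuous_on_product_then_coordinatewise[of UNIV "\<lambda>x. (fst p)(N := snd x)"])
          next
            case (2 b)
            show ?thesis
              unfolding 2 reset_def pos_shift_def split_def fst_conv snd_conv
              by (intro continuous_on_Pair cont_update continuous_on_add continuous_on_fst continuous_on_snd
                  continuous_on_id continuous_on_const continuous_on_scaleR)
          qed
          show "continuous_on (UNIV \<times> cbox 0 1) (\<lambda>(h, r). deriv_along \<tau> f (\<tau> (reset N r p) h))"
            unfolding split_def
            by (rule continuous_on_compose2[OF Ck_along_cont[OF C] continuous_on_subset[OF cr]]) auto
          fix h
          have "continuous_on UNIV (\<lambda>r. f (\<tau> (reset N r p) h))"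
            using continuous_on_compose2[OF continuous_on_compose2[OF cont cr], of UNIV "\<lambda>r. (h, r)"]
            by (simp add: continuous_on_Pair)
          then show "(\<lambda>r. f (\<tau> (reset N r p) h)) integrable_on cbox 0 1"
            by (intro integrable_continuous) (auto intro: continuous_on_subset)
        qed auto
        moreover have "\<tau> q 0 = q" for q using t based_family unfolding based_def by blast
        ultimately show ?thesis
          using Suc.IH[OF C] by (intro exI[of _ "\<lambda>p. integral (cbox 0 1) (\<lambda>r. deriv_along \<tau> f (reset N r p))"]) (simp add: 1)
      next
        case 2
        then show ?thesis by (intro exI[of _ "\<lambda>p. 0"]) (simp add: Ck_along_const)
      qed
    qed
  qed
  from this[of "\<lambda>(s, x). w s x"] show ?thesis
    using assms by (simp add: jointly_smooth_def smooth_along_def reset_def split_def)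
qed

section \<open>Integration by parts\<close>

lemma integral_family_has_derivative_at:
  fixes w :: "real family"
  assumes w: "compact_family w"
  shows "((\<lambda>t. \<integral>x. w (s(i := t)) x \<partial>lborel) has_vector_derivative
    (\<integral>x. param_deriv i w (s(i := t)) x \<partial>lborel)) (at t within S)"
proof (rule real_shift_derivative)
  fix t
  show "((\<lambda>h. \<integral>x. w (s(i := t + h)) x \<partial>lborel) has_vector_derivative
    (\<integral>x. param_deriv i w (s(i := t)) x \<partial>lborel)) (at 0)"
    using integral_family_has_derivative[OF w, of "s(i := t)" i] by simp
qed

lemma integral_translate:
  fixes f :: "'a::euclidean_space \<Rightarrow> real"
  assumes "continuous_on UNIV f"
  shows "(\<integral>x. f (x + c) \<partial>lborel) = (\<integral>x. f x \<partial>lborel)"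
proof -
  have "(\<integral>x. f x \<partial>distr lborel borel ((+) c)) = (\<integral>x. f (c + x) \<partial>lborel)"
    using borel_measurable_continuous_onI[OF assms] by (intro integral_distr) auto
  then show ?thesis by (simp add: lborel_distr_plus add.commute)
qed

text \<open>The integral of \<open>f (x + h e\<^sub>k)\<close> does not depend on \<open>h\<close>; differentiation under the integral at \<open>h = 0\<close>
  gives the claim.\<close>

lemma integral_pd_zero:
  fixes f :: "space \<Rightarrow> real"
  assumes f: "smooth f" and R: "vanishes_beyond R f"
  shows "(\<integral>x. pd k f x \<partial>lborel) = 0"
proof -
  let ?e = "axis k 1 :: space"
  \<comment> \<open>Parameter \<open>0\<close> is the length of the translation.\<close>
  define w :: "real family" where "w = (\<lambda>s x. f (x + s 0 *\<^sub>R ?e))"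
  have js: "jointly_smooth w"
    unfolding w_def
    by (rule jointly_smooth_compose[OF f jointly_smooth_add[OF jointly_smooth_position jointly_smooth_bilinear[OF bounded_bilinear_scaleR jointly_smooth_coord jointly_smooth_const]]])
  have "locally_beyond vanishes_beyond w"
  proof (rule locally_beyond_openI)
    fix s0 :: "nat \<Rightarrow> real"
    define U where "U = (\<lambda>s :: nat \<Rightarrow> real. s 0) -` ball (s0 0) 1"
    have "open U" unfolding U_def by (intro open_vimage) auto
    moreover have "s0 \<in> U" by (simp add: U_def)
    moreover have "vanishes_beyond (R + \<bar>s0 0\<bar> + 1) (w s)" if "s \<in> U" for s
      unfolding vanishes_beyond_def
    proof (intro allI impI)
      fix x :: space assume x: "R + \<bar>s0 0\<bar> + 1 \<le> norm x"
      have "\<bar>s 0\<bar> \<le> \<bar>s0 0\<bar> + 1" using that by (auto simp: U_def dist_real_def)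
      then have "R \<le> norm (x + s 0 *\<^sub>R ?e)"
        using norm_triangle_ineq4[of "x + s 0 *\<^sub>R ?e" "s 0 *\<^sub>R ?e"] x by (simp add: norm_axis_1)
      then show "w s x = 0" using R by (simp add: w_def vanishes_beyond_def)
    qed
    ultimately show "\<exists>R U. open U \<and> s0 \<in> U \<and> (\<forall>s\<in>U. vanishes_beyond R (w s))" by blast
  qed
  moreover have "finite_dependence w"
    unfolding w_def by (rule finite_dependence_coord[of "\<lambda>t x. f (x + t *\<^sub>R ?e)" 0])
  ultimately have cs: "compact_family w" using js by (simp add: compact_family_def)
  have "(\<integral>x. w s x \<partial>lborel) = (\<integral>x. f x \<partial>lborel)" for s
    unfolding w_def by (rule integral_translate[OF smooth_cont[OF f]])
  then have "((\<lambda>h. \<integral>x. f x \<partial>lborel) has_vector_derivative (\<integral>x. param_deriv 0 w (\<lambda>_. 0) x \<partial>lborel)) (at (0::real))"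
    using integral_family_has_derivative[OF cs, of "\<lambda>_. 0" 0] by simp
  then have "(\<integral>x. param_deriv 0 w (\<lambda>_. 0) x \<partial>lborel) = 0"
    using vector_derivative_unique_at[OF _ has_vector_derivative_const] by blast
  then show ?thesis by (simp add: w_def param_deriv_def pd_def)
qed

text \<open>Subtracting the value at infinity does not change the derivative and leaves a compactly supported function.\<close>

lemma integral_pd_zero_constant:
  fixes f :: "space \<Rightarrow> real"
  assumes f: "smooth f" and R: "constant_beyond R f"
  shows "(\<integral>x. pd k f x \<partial>lborel) = 0"
proof -
  define c where "c = f (R *\<^sub>R axis 1 1)"
  have "smooth (\<lambda>x. f x + - c)" by (rule smooth_add[OF f smooth_const])
  moreover have "vanishes_beyond R (\<lambda>x. f x + - c)"
    unfolding vanishes_beyond_def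
  proof (intro allI impI)
    fix x :: space assume "R \<le> norm x"
    moreover have "R \<le> norm (R *\<^sub>R axis 1 1 :: space)" by (simp add: norm_axis_1)
    ultimately have "f x = c" using R unfolding constant_beyond_def c_def by blast
    then show "f x + - c = 0" by simp
  qed
  ultimately have "(\<integral>x. pd k (\<lambda>x. f x + - c) x \<partial>lborel) = 0" by (rule integral_pd_zero)
  moreover have "pd k (\<lambda>x. - c) x = 0" for x :: space by (simp add: pd_def)
  ultimately show ?thesis by (simp only: pd_add[OF f smooth_const]) simp
qed

lemma compact_support_integrable:
  fixes f :: "space \<Rightarrow> real"
  assumes "smooth f" "vanishes_beyond R f"
  shows "integrable lborel f"
  by (rule compact_support_integral(1)[OF smooth_cont[OF assms(1)] assms(2)])

text \<open>There is no boundary term although neither function has compact support, because their product is constant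
  near infinity.\<close>

lemma integral_by_parts:
  fixes f g :: "space \<Rightarrow> 'b::euclidean_space"
  assumes f: "smooth f" "constant_beyond R f" and g: "smooth g" "constant_beyond R g"
  shows "(\<integral>x. pd k f x \<bullet> g x \<partial>lborel) = - (\<integral>x. f x \<bullet> pd k g x \<partial>lborel)"
proof -
  have "constant_beyond R (\<lambda>x. f x \<bullet> g x)"
    using f(2) g(2) unfolding constant_beyond_def by metis
  then have "(\<integral>x. pd k (\<lambda>x. f x \<bullet> g x) x \<partial>lborel) = 0"
    by (rule integral_pd_zero_constant[OF smooth_bilinear[OF bounded_bilinear_inner f(1) g(1)]])
  then have "(\<integral>x. f x \<bullet> pd k g x + pd k f x \<bullet> g x \<partial>lborel) = 0"
    by (simp only: pd_bilinear[OF bounded_bilinear_inner f(1) g(1)])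
  moreover have "integrable lborel (\<lambda>x. f x \<bullet> pd k g x)"
    by (rule compact_support_integrable[OF smooth_bilinear[OF bounded_bilinear_inner f(1) smooth_pd[OF g(1)]], of "R + 1"])
      (use pd_vanishes[OF g(2), of k] in \<open>simp add: vanishes_beyond_def\<close>)
  moreover have "integrable lborel (\<lambda>x. pd k f x \<bullet> g x)"
    by (rule compact_support_integrable[OF smooth_bilinear[OF bounded_bilinear_inner smooth_pd[OF f(1)] g(1)], of "R + 1"])
      (use pd_vanishes[OF f(2), of k] in \<open>simp add: vanishes_beyond_def\<close>)
  ultimately show ?thesis by simp
qed

section \<open>The Hamiltonian operator of the bracket\<close>

text \<open>Row by row, the coefficients of \<open>\<partial>\<^sub>k\<close> in \<open>- curl D - grad \<phi>\<close>, \<open>curl B - grad \<psi>\<close>, \<open>- div D\<close> and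
  \<open>- div B\<close>, in the order \<open>(B, D, \<psi>, \<phi>)\<close>.\<close>

definition ham_matrix :: "3 \<Rightarrow> state \<Rightarrow> state" where
  "ham_matrix k w =
    ((\<chi> m. - (\<Sum>j\<in>UNIV. levi_civita m k j * comp_D w $ j) - (if m = k then comp_phi w else 0)),
     (\<chi> m. (\<Sum>j\<in>UNIV. levi_civita m k j * comp_B w $ j) - (if m = k then comp_psi w else 0)),
     - comp_D w $ k,
     - comp_B w $ k)"

definition proj_D_phi :: "state \<Rightarrow> state" where
  "proj_D_phi w = (0, comp_D w, 0, comp_phi w)"

definition ham_op :: "field \<Rightarrow> field" where
  "ham_op g x = (\<Sum>k\<in>UNIV. ham_matrix k (pd k g x))"

lemmas comp_defs = comp_B_def comp_D_def comp_psi_def comp_phi_def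

lemma inner_state: "v \<bullet> w = (\<Sum>k\<in>UNIV. comp_B v $ k * comp_B w $ k) + (\<Sum>k\<in>UNIV. comp_D v $ k * comp_D w $ k)
    + comp_psi v * comp_psi w + comp_phi v * comp_phi w" for v w :: state
  by (simp add: comp_defs inner_prod_def inner_vec_def)

lemma bounded_linear_comp_B: "bounded_linear (\<lambda>w. comp_B w $ k)"
  unfolding comp_defs
  by (intro bounded_linear_compose[OF bounded_linear_vec_nth] bounded_linear_fst)

lemma bounded_linear_comp_D: "bounded_linear (\<lambda>w. comp_D w $ k)"
  unfolding comp_defs
  by (intro bounded_linear_compose[OF bounded_linear_vec_nth] bounded_linear_compose[OF bounded_linear_fst bounded_linear_snd])

lemma bounded_linear_comp_psi: "bounded_linear comp_psi"
  unfolding comp_defs[abs_def]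
  by (intro bounded_linear_compose[OF bounded_linear_fst] bounded_linear_compose[OF bounded_linear_snd bounded_linear_snd])

lemma bounded_linear_comp_phi: "bounded_linear comp_phi"
  unfolding comp_defs[abs_def]
  by (intro bounded_linear_compose[OF bounded_linear_snd] bounded_linear_compose[OF bounded_linear_snd bounded_linear_snd])

lemma comp_add [simp]:
  "comp_B (v + w) = comp_B v + comp_B w" "comp_D (v + w) = comp_D v + comp_D w"
  "comp_psi (v + w) = comp_psi v + comp_psi w" "comp_phi (v + w) = comp_phi v + comp_phi w"
  by (simp_all add: comp_defs)

lemma comp_scaleR [simp]:
  "comp_B (c *\<^sub>R w) = c *\<^sub>R comp_B w" "comp_D (c *\<^sub>R w) = c *\<^sub>R comp_D w"
  "comp_psi (c *\<^sub>R w) = c * comp_psi w" "comp_phi (c *\<^sub>R w) = c * comp_phi w"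
  by (simp_all add: comp_defs)

lemma comp_tuple [simp]:
  "comp_B (b, d, p, q) = b" "comp_D (b, d, p, q) = d" "comp_psi (b, d, p, q) = p" "comp_phi (b, d, p, q) = q"
  by (simp_all add: comp_defs)

lemma state_eqI:
  assumes "\<And>k. comp_B v $ k = comp_B w $ k" "\<And>k. comp_D v $ k = comp_D w $ k"
    "comp_psi v = comp_psi w" "comp_phi v = comp_phi w"
  shows "v = w"
  using assms by (auto simp: comp_defs prod_eq_iff vec_eq_iff)

lemma bounded_linear_ham_matrix: "bounded_linear (ham_matrix k)"
  unfolding linear_conv_bounded_linear[symmetric]
  by (rule linearI; rule state_eqI)
    (simp_all add: ham_matrix_def sum.distrib sum_distrib_left algebra_simps if_distrib[of "\<lambda>x. c * x" for c])

lemma bounded_linear_proj: "bounded_linear proj_D_phi"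
  unfolding linear_conv_bounded_linear[symmetric]
  by (rule linearI; rule state_eqI) (simp_all add: proj_D_phi_def)

text \<open>The two curl blocks have opposite signs and \<open>levi_civita\<close> is antisymmetric, so they are transposes of
  each other; likewise the gradients and divergences match.\<close>

lemma ham_matrix_symmetric: "ham_matrix k v \<bullet> w = v \<bullet> ham_matrix k w"
  using exhaust_3[of k]
  by (elim disjE; simp add: inner_state ham_matrix_def sum_3 levi_civita_def algebra_simps)

text \<open>The matrix exchanges the \<open>(D, \<phi>)\<close> and the \<open>(B, \<psi>)\<close> components.\<close>

lemma ham_matrix_proj: "proj_D_phi (ham_matrix k w) + ham_matrix k (proj_D_phi w) = ham_matrix k w"
  by (rule state_eqI) (simp_all add: proj_D_phi_def ham_matrix_def)

lemma ham_op_components: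
  assumes g: "smooth g"
  shows "comp_B (ham_op g x) $ m = - (\<Sum>i\<in>UNIV. \<Sum>j\<in>UNIV. levi_civita m i j * pd i (\<lambda>x. comp_D (g x) $ j) x) - pd m (\<lambda>x. comp_phi (g x)) x"
    and "comp_D (ham_op g x) $ m = (\<Sum>i\<in>UNIV. \<Sum>j\<in>UNIV. levi_civita m i j * pd i (\<lambda>x. comp_B (g x) $ j) x) - pd m (\<lambda>x. comp_psi (g x)) x"
    and "comp_psi (ham_op g x) = - (\<Sum>k\<in>UNIV. pd k (\<lambda>x. comp_D (g x) $ k) x)"
    and "comp_phi (ham_op g x) = - (\<Sum>k\<in>UNIV. pd k (\<lambda>x. comp_B (g x) $ k) x)"
proof -
  have lin: "L (ham_op g x) = (\<Sum>k\<in>UNIV. L (ham_matrix k (pd k g x)))" if "bounded_linear L" for L :: "state \<Rightarrow> real"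
    unfolding ham_op_def by (rule linear_sum[OF bounded_linear.linear[OF that]])
  note c = pd_linear[OF bounded_linear_comp_B g] pd_linear[OF bounded_linear_comp_D g]
    pd_linear[OF bounded_linear_comp_psi g] pd_linear[OF bounded_linear_comp_phi g]
  show "comp_B (ham_op g x) $ m = - (\<Sum>i\<in>UNIV. \<Sum>j\<in>UNIV. levi_civita m i j * pd i (\<lambda>x. comp_D (g x) $ j) x) - pd m (\<lambda>x. comp_phi (g x)) x"
    unfolding lin[OF bounded_linear_comp_B] c
    by (simp add: ham_matrix_def sum_subtractf sum_negf sum.delta)
  show "comp_D (ham_op g x) $ m = (\<Sum>i\<in>UNIV. \<Sum>j\<in>UNIV. levi_civita m i j * pd i (\<lambda>x. comp_B (g x) $ j) x) - pd m (\<lambda>x. comp_psi (g x)) x"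
    unfolding lin[OF bounded_linear_comp_D] c
    by (simp add: ham_matrix_def sum_subtractf sum_negf sum.delta)
  show "comp_psi (ham_op g x) = - (\<Sum>k\<in>UNIV. pd k (\<lambda>x. comp_D (g x) $ k) x)"
    unfolding lin[OF bounded_linear_comp_psi] c by (simp add: ham_matrix_def sum_negf)
  show "comp_phi (ham_op g x) = - (\<Sum>k\<in>UNIV. pd k (\<lambda>x. comp_B (g x) $ k) x)"
    unfolding lin[OF bounded_linear_comp_phi] c by (simp add: ham_matrix_def sum_negf)
qed

lemma asymp_family_constant_family: "smooth f \<Longrightarrow> constant_beyond R f \<Longrightarrow> asymp_family (\<lambda>s. f)"
  unfolding asymp_family_def by (intro conjI finite_dependence_const jointly_smooth_of_smooth locally_beyond_const[of _ R])

lemma compact_family_sum: "finite I \<Longrightarrow> (\<And>i. i \<in> I \<Longrightarrow> compact_family (w i)) \<Longrightarrow> compact_family (\<lambda>s x. \<Sum>i\<in>I. w i s x)"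
proof (induction I rule: finite_induct)
  case empty
  then show ?case
    using compact_family_constant_family[OF smooth_const[of 0], of 0] by (simp add: vanishes_beyond_def)
next
  case (insert i I)
  have "compact_family (\<lambda>s x. w i s x + (\<Sum>i\<in>I. w i s x))"
    by (rule compact_family_add) (use insert in auto)
  then show ?case using insert by simp
qed

lemma compact_family_ham_op: "asymp_family w \<Longrightarrow> compact_family (\<lambda>s. ham_op (w s))"
  using compact_family_sum[of UNIV "\<lambda>k s x. ham_matrix k (pd k (w s) x)"] compact_family_linear[OF bounded_linear_ham_matrix compact_family_pd[of w]]
  by (simp add: ham_op_def[abs_def])

lemma param_deriv_sum:
  assumes "\<And>k. k \<in> I \<Longrightarrow> jointly_smooth (w k)"
  shows "param_deriv i (\<lambda>s x. \<Sum>k\<in>I. w k s x) s x = (\<Sum>k\<in>I. param_deriv i (w k) s x)"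
  unfolding param_deriv_def[of i "\<lambda>s x. \<Sum>k\<in>I. w k s x"]
  by (rule vector_derivative_at[OF has_vector_derivative_sum[OF has_param_deriv_0[OF assms]]])

lemma param_deriv_ham_op:
  assumes w: "jointly_smooth w"
  shows "param_deriv i (\<lambda>s. ham_op (w s)) s x = ham_op (param_deriv i w s) x"
proof -
  have "param_deriv i (\<lambda>s x. \<Sum>k\<in>UNIV. ham_matrix k (pd k (w s) x)) s x
      = (\<Sum>k\<in>UNIV. param_deriv i (\<lambda>s x. ham_matrix k (pd k (w s) x)) s x)"
    by (rule param_deriv_sum[OF jointly_smooth_linear[OF bounded_linear_ham_matrix jointly_smooth_pd[OF w]]])
  also have "\<dots> = (\<Sum>k\<in>UNIV. ham_matrix k (pd k (param_deriv i w s) x))"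
    by (simp only: param_deriv_linear[OF bounded_linear_ham_matrix jointly_smooth_pd[OF w]] param_deriv_pd[OF w])
  finally show ?thesis by (simp add: ham_op_def[abs_def])
qed

text \<open>The operator is skew-adjoint: its coefficients are constant and symmetric, and each \<open>\<partial>\<^sub>k\<close> contributes a
  sign.\<close>

lemma ham_op_parts:
  assumes f: "smooth f" "constant_beyond R f" and g: "smooth g" "constant_beyond R g"
  shows "(\<integral>x. ham_op f x \<bullet> g x \<partial>lborel) = - (\<integral>x. f x \<bullet> ham_op g x \<partial>lborel)"
proof -
  have Jg: "smooth (\<lambda>x. ham_matrix k (g x))" "constant_beyond R (\<lambda>x. ham_matrix k (g x))" for k
    using smooth_linear[OF bounded_linear_ham_matrix g(1)] g(2) unfolding constant_beyond_def by (simp, metis)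
  have i1: "integrable lborel (\<lambda>x. pd k f x \<bullet> ham_matrix k (g x))" for k
    by (rule compact_support_integrable[OF smooth_bilinear[OF bounded_bilinear_inner smooth_pd[OF f(1)] Jg(1)], of "R + 1"])
      (use pd_vanishes[OF f(2), of k] in \<open>simp add: vanishes_beyond_def\<close>)
  have i2: "integrable lborel (\<lambda>x. f x \<bullet> pd k (\<lambda>x. ham_matrix k (g x)) x)" for k
    by (rule compact_support_integrable[OF smooth_bilinear[OF bounded_bilinear_inner f(1) smooth_pd[OF Jg(1)]], of "R + 1"])
      (use pd_vanishes[OF Jg(2), of k] in \<open>simp add: vanishes_beyond_def\<close>)
  have "(\<integral>x. ham_op f x \<bullet> g x \<partial>lborel) = (\<integral>x. (\<Sum>k\<in>UNIV. pd k f x \<bullet> ham_matrix k (g x)) \<partial>lborel)"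
    by (simp add: ham_op_def inner_sum_left ham_matrix_symmetric)
  also have "\<dots> = (\<Sum>k\<in>UNIV. \<integral>x. pd k f x \<bullet> ham_matrix k (g x) \<partial>lborel)"
    by (rule Bochner_Integration.integral_sum) (rule i1)
  also have "\<dots> = (\<Sum>k\<in>UNIV. - (\<integral>x. f x \<bullet> pd k (\<lambda>x. ham_matrix k (g x)) x \<partial>lborel))"
    by (intro sum.cong refl integral_by_parts[OF f Jg])
  also have "\<dots> = - (\<integral>x. (\<Sum>k\<in>UNIV. f x \<bullet> pd k (\<lambda>x. ham_matrix k (g x)) x) \<partial>lborel)"
    unfolding sum_negf by (subst Bochner_Integration.integral_sum) (auto intro: i2)
  also have "\<dots> = - (\<integral>x. f x \<bullet> ham_op g x \<partial>lborel)"
    by (simp add: ham_op_def inner_sum_right pd_linear[OF bounded_linear_ham_matrix g(1)])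
  finally show ?thesis .
qed

definition asymp_const :: "('a::euclidean_space \<Rightarrow> 'b::real_normed_vector) \<Rightarrow> bool" where
  "asymp_const f \<longleftrightarrow> smooth f \<and> (\<exists>R. constant_beyond R f)"

lemma asymp_const_ham_op_parts:
  assumes "asymp_const f" "asymp_const g"
  shows "(\<integral>x. ham_op f x \<bullet> g x \<partial>lborel) = - (\<integral>x. f x \<bullet> ham_op g x \<partial>lborel)"
proof -
  obtain R1 R2 where "constant_beyond R1 f" "constant_beyond R2 g"
    using assms unfolding asymp_const_def by blast
  then have "constant_beyond (max R1 R2) f" "constant_beyond (max R1 R2) g"
    using constant_beyond_mono max.cobounded1 max.cobounded2 by blast+
  then show ?thesis using assms by (intro ham_op_parts) (auto simp: asymp_const_def)
qed

lemma asymp_const_ham_op_field: "asymp_const f \<Longrightarrow> ham_op f \<in> fields"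
  using compact_family_slice_field[OF compact_family_ham_op[OF asymp_family_constant_family]] by (auto simp: asymp_const_def)

lemma asymp_const_slice: "asymp_family w \<Longrightarrow> asymp_const (w s)"
  using asymp_family_slice by (auto simp: asymp_const_def)

lemma fields_asymp_const: "u \<in> fields \<Longrightarrow> asymp_const u"
  using vanishes_constant by (auto simp: asymp_const_def fields_iff)

lemma integrable_inner_field:
  assumes "continuous_on UNIV f" "v \<in> fields"
  shows "integrable lborel (\<lambda>x. f x \<bullet> v x)"
proof -
  obtain R where R: "vanishes_beyond R v" and v: "smooth v" using assms(2) by (auto simp: fields_iff)
  show ?thesis
    using R by (intro compact_support_integral(1)[where R = R] continuous_on_inner assms(1) smooth_cont[OF v])
      (simp add: vanishes_beyond_def)
qed

lemma asymp_const_cont: "asymp_const f \<Longrightarrow> continuous_on UNIV f"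
  by (auto simp: asymp_const_def intro: smooth_cont)

text \<open>The left-hand side is the integrand of the bracket. Moving \<open>\<J>\<close> in its second term onto the
  \<open>(D, \<phi>)\<close> part of \<open>g\<close> produces the \<open>(B, \<psi>)\<close> part of \<open>\<J> g\<close>, which complements the first term.\<close>

lemma graded_parts:
  assumes f: "asymp_const f" and g: "asymp_const g"
  shows "(\<integral>x. f x \<bullet> proj_D_phi (ham_op g x) - ham_op f x \<bullet> proj_D_phi (g x) \<partial>lborel) = (\<integral>x. f x \<bullet> ham_op g x \<partial>lborel)"
proof -
  define h where "h = (\<lambda>x. proj_D_phi (g x))"
  have sg: "smooth g" and sh: "smooth h"
    using g smooth_linear[OF bounded_linear_proj] by (auto simp: asymp_const_def h_def)
  have h: "asymp_const h"
    using g sh unfolding asymp_const_def constant_beyond_def h_def by metis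
  have ham_op_h: "ham_op h x = ham_op g x - proj_D_phi (ham_op g x)" for x
  proof -
    have "ham_op h x = (\<Sum>k\<in>UNIV. ham_matrix k (pd k g x) - proj_D_phi (ham_matrix k (pd k g x)))"
      unfolding ham_op_def h_def pd_linear[OF bounded_linear_proj sg]
      by (intro sum.cong refl) (metis ham_matrix_proj add_diff_cancel_left')
    also have "\<dots> = ham_op g x - proj_D_phi (ham_op g x)"
      by (simp add: ham_op_def sum_subtractf linear_sum[OF bounded_linear.linear[OF bounded_linear_proj]])
    finally show ?thesis .
  qed
  note cf = asymp_const_cont[OF f]
  have i: "integrable lborel (\<lambda>x. f x \<bullet> ham_op g x)" "integrable lborel (\<lambda>x. f x \<bullet> ham_op h x)"
    by (rule integrable_inner_field[OF cf asymp_const_ham_op_field[OF g]]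
        integrable_inner_field[OF cf asymp_const_ham_op_field[OF h]])+
  have i3: "integrable lborel (\<lambda>x. ham_op f x \<bullet> h x)"
    using integrable_inner_field[OF asymp_const_cont[OF h] asymp_const_ham_op_field[OF f]] by (simp add: inner_commute)
  have "(\<integral>x. f x \<bullet> proj_D_phi (ham_op g x) - ham_op f x \<bullet> proj_D_phi (g x) \<partial>lborel)
      = (\<integral>x. (f x \<bullet> ham_op g x - f x \<bullet> ham_op h x) - ham_op f x \<bullet> h x \<partial>lborel)"
    by (simp only: ham_op_h inner_diff_right) (simp add: h_def)
  also have "\<dots> = (\<integral>x. f x \<bullet> ham_op g x \<partial>lborel) - (\<integral>x. f x \<bullet> ham_op h x \<partial>lborel) - (\<integral>x. ham_op f x \<bullet> h x \<partial>lborel)"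
    using i i3 by simp
  also have "\<dots> = (\<integral>x. f x \<bullet> ham_op g x \<partial>lborel)"
    using asymp_const_ham_op_parts[OF f h] by simp
  finally show ?thesis .
qed

section \<open>The algebra of smooth functionals\<close>

lemma smooth_functional_deriv:
  "F \<in> smooth_functionals \<Longrightarrow> u \<in> fields \<Longrightarrow> has_func_deriv F u (func_deriv F u)"
  unfolding smooth_functionals_def using func_deriv_eqI by fastforce

lemma smooth_functional_family:
  "F \<in> smooth_functionals \<Longrightarrow> compact_family u \<Longrightarrow> asymp_family (\<lambda>s. func_deriv F (u s))"
  unfolding smooth_functionals_def field_family_iff asymp_const_family_iff by blast

text \<open>As functional derivatives are unique, it suffices to exhibit one that depends smoothly on the field.\<close>

lemma smooth_functionalI:
  assumes "\<And>u. u \<in> fields \<Longrightarrow> has_func_deriv F u (g u)"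
    and "\<And>u. compact_family u \<Longrightarrow> asymp_family (\<lambda>s. g (u s))"
  shows "F \<in> smooth_functionals"
proof -
  have "func_deriv F (u s) = g (u s)" if "compact_family u" for u s
    by (rule func_deriv_eqI[OF assms(1)[OF compact_family_slice_field[OF that]]])
  then show ?thesis
    using assms unfolding smooth_functionals_def field_family_iff asymp_const_family_iff by fastforce
qed

lemma func_deriv_asymp_const:
  assumes "F \<in> smooth_functionals" "u \<in> fields"
  shows "asymp_const (func_deriv F u)"
  using asymp_const_slice[OF smooth_functional_family[OF assms(1) compact_family_field[OF assms(2)]]] .

lemma fields_add_scaleR:
  assumes "u \<in> fields" "v \<in> fields"
  shows "(\<lambda>x. u x + c *\<^sub>R v x) \<in> fields"
proof -
  have "compact_family (\<lambda>(s :: nat \<Rightarrow> real) x. u x + c *\<^sub>R v x)"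
    by (rule compact_family_add[OF compact_family_field[OF assms(1)] compact_family_linear[OF bounded_linear_scaleR_right compact_family_field[OF assms(2)]]])
  then show ?thesis by (rule compact_family_slice_field)
qed

lemma compact_family_line: "compact_family u \<Longrightarrow> compact_family v \<Longrightarrow> compact_family (\<lambda>s x. u s x + s i *\<^sub>R v s x)"
  by (rule compact_family_add[OF _ compact_family_bilinear[OF bounded_bilinear_scaleR asymp_family_coord]])

text \<open>The definition speaks of step \<open>0\<close> only, but the base point may be any point of the line.\<close>

lemma functional_along_line:
  assumes F: "F \<in> smooth_functionals" and u: "u \<in> fields" and v: "v \<in> fields"
  shows "((\<lambda>t. F (\<lambda>x. u x + t *\<^sub>R v x)) has_vector_derivative
    (\<integral>x. func_deriv F (\<lambda>x. u x + t *\<^sub>R v x) x \<bullet> v x \<partial>lborel)) (at t within S)"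
proof (rule real_shift_derivative)
  fix t :: real
  have "has_func_deriv F (\<lambda>x. u x + t *\<^sub>R v x) (func_deriv F (\<lambda>x. u x + t *\<^sub>R v x))"
    by (rule smooth_functional_deriv[OF F fields_add_scaleR[OF u v]])
  then have "((\<lambda>h. F (\<lambda>x. u x + t *\<^sub>R v x + h *\<^sub>R v x)) has_real_derivative
      (\<integral>x. func_deriv F (\<lambda>x. u x + t *\<^sub>R v x) x \<bullet> v x \<partial>lborel)) (at 0)"
    using v unfolding has_func_deriv_def by blast
  then show "((\<lambda>h. F (\<lambda>x. u x + (t + h) *\<^sub>R v x)) has_vector_derivative
      (\<integral>x. func_deriv F (\<lambda>x. u x + t *\<^sub>R v x) x \<bullet> v x \<partial>lborel)) (at 0)"
    by (simp add: has_real_derivative_iff_has_vector_derivative scaleR_add_left add.assoc)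
qed

lemma zero_field: "(\<lambda>x. 0) \<in> fields"
  by (auto simp: fields_iff vanishes_beyond_def smooth_const)

lemma compact_family_inner: "asymp_family v \<Longrightarrow> compact_family w \<Longrightarrow> compact_family (\<lambda>s x. v s x \<bullet> w s x)"
  by (rule compact_family_bilinear[OF bounded_bilinear_inner])

text \<open>The value is recovered from the derivative along the segment from the zero field, with a fresh parameter
  \<open>N\<close> as the position \<open>r\<close> on the segment. All operations in that formula preserve smoothness in the parameters.\<close>

lemma value_family:
  assumes F: "F \<in> smooth_functionals" and u: "compact_family u"
  shows "asymp_family (\<lambda>s (x::space). F (u s))"
proof -
  obtain N where N: "\<And>s t. u (s(N := t)) = u s"
    using finite_dependence_bound[of u] u unfolding compact_family_def by (metis order_refl)
  define W where "W = (\<lambda>s x. func_deriv F (\<lambda>x. 0 + s N *\<^sub>R u s x) x \<bullet> u s x)"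
  have csW: "compact_family W"
    unfolding W_def
    by (rule compact_family_inner[OF smooth_functional_family[OF F compact_family_line[OF compact_family_field[OF zero_field] u]] u])
  have "F (u s) = F (\<lambda>x. 0) + integral {0..1} (\<lambda>r. \<integral>x. W (s(N := r)) x \<partial>lborel)" for s
  proof -
    have "((\<lambda>r. \<integral>x. func_deriv F (\<lambda>x. 0 + r *\<^sub>R u s x) x \<bullet> u s x \<partial>lborel) has_integral
        F (\<lambda>x. 0 + 1 *\<^sub>R u s x) - F (\<lambda>x. 0 + 0 *\<^sub>R u s x)) {0..1}"
      by (rule fundamental_theorem_of_calculus[OF zero_le_one])
        (rule functional_along_line[OF F zero_field compact_family_slice_field[OF u]])
    then have "integral {0..1} (\<lambda>r. \<integral>x. func_deriv F (\<lambda>x. 0 + r *\<^sub>R u s x) x \<bullet> u s x \<partial>lborel)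
        = F (u s) - F (\<lambda>x. 0)"
      by (simp add: integral_unique)
    then show ?thesis by (simp add: W_def N)
  qed
  then have e: "(\<lambda>s (x::space). F (u s))
      = (\<lambda>s (x::space). F (\<lambda>x. 0) + integral {0..1} (\<lambda>r. \<integral>x. W (s(N := r)) x \<partial>lborel))"
    by (intro ext)
  show ?thesis
    unfolding asymp_family_def
  proof (intro conjI)
    show "finite_dependence (\<lambda>s (x::space). F (u s))"
      using u finite_dependence_map[of u "\<lambda>f x. F f"] by (simp add: compact_family_def)
    show "jointly_smooth (\<lambda>s (x::space). F (u s))"
      unfolding e by (rule jointly_smooth_add[OF jointly_smooth_const averaged_family_smooth[OF integral_family_smooth[OF csW]]])
    show "locally_beyond constant_beyond (\<lambda>s (x::space). F (u s))"
      by (rule locally_beyond_openI) (auto simp: constant_beyond_def)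
  qed
qed

lemma has_func_deriv_linear_combination:
  assumes "has_func_deriv F u f" "has_func_deriv G u g"
  shows "has_func_deriv (\<lambda>u. c * F u + G u) u (\<lambda>x. c *\<^sub>R f x + g x)"
  unfolding has_func_deriv_def
proof (intro conjI ballI)
  have cf: "continuous_on UNIV f" and cg: "continuous_on UNIV g"
    using assms by (auto simp: has_func_deriv_def)
  then show "continuous_on UNIV (\<lambda>x. c *\<^sub>R f x + g x)" by (intro continuous_intros)
  fix v assume v: "v \<in> fields"
  have "(\<integral>x. (c *\<^sub>R f x + g x) \<bullet> v x \<partial>lborel) = c * (\<integral>x. f x \<bullet> v x \<partial>lborel) + (\<integral>x. g x \<bullet> v x \<partial>lborel)"
    using integrable_inner_field[OF cf v] integrable_inner_field[OF cg v] by (simp add: inner_add_left)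
  then show "((\<lambda>e. c * F (\<lambda>x. u x + e *\<^sub>R v x) + G (\<lambda>x. u x + e *\<^sub>R v x)) has_real_derivative
      (\<integral>x. (c *\<^sub>R f x + g x) \<bullet> v x \<partial>lborel)) (at 0)"
    using assms v by (auto simp: has_func_deriv_def intro!: DERIV_add DERIV_cmult)
qed

lemma has_func_deriv_product:
  assumes "has_func_deriv F u f" "has_func_deriv G u g"
  shows "has_func_deriv (\<lambda>u. F u * G u) u (\<lambda>x. F u *\<^sub>R g x + G u *\<^sub>R f x)"
  unfolding has_func_deriv_def
proof (intro conjI ballI)
  have cf: "continuous_on UNIV f" and cg: "continuous_on UNIV g"
    using assms by (auto simp: has_func_deriv_def)
  then show "continuous_on UNIV (\<lambda>x. F u *\<^sub>R g x + G u *\<^sub>R f x)" by (intro continuous_intros)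
  fix v assume v: "v \<in> fields"
  have i: "(\<integral>x. (F u *\<^sub>R g x + G u *\<^sub>R f x) \<bullet> v x \<partial>lborel)
      = (\<integral>x. f x \<bullet> v x \<partial>lborel) * G u + (\<integral>x. g x \<bullet> v x \<partial>lborel) * F u"
    using integrable_inner_field[OF cf v] integrable_inner_field[OF cg v] by (simp add: inner_add_left)
  have "((\<lambda>e. F (\<lambda>x. u x + e *\<^sub>R v x)) has_real_derivative (\<integral>x. f x \<bullet> v x \<partial>lborel)) (at 0)"
    "((\<lambda>e. G (\<lambda>x. u x + e *\<^sub>R v x)) has_real_derivative (\<integral>x. g x \<bullet> v x \<partial>lborel)) (at 0)"
    using assms v by (auto simp: has_func_deriv_def)
  from DERIV_mult[OF this]
  show "((\<lambda>e. F (\<lambda>x. u x + e *\<^sub>R v x) * G (\<lambda>x. u x + e *\<^sub>R v x)) has_real_derivative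
      (\<integral>x. (F u *\<^sub>R g x + G u *\<^sub>R f x) \<bullet> v x \<partial>lborel)) (at 0)"
    by (simp add: i)
qed

lemma smooth_functional_linear_combination:
  assumes F: "F \<in> smooth_functionals" and G: "G \<in> smooth_functionals"
  shows "(\<lambda>u. c * F u + G u) \<in> smooth_functionals"
proof (rule smooth_functionalI)
  fix u assume "u \<in> fields"
  then show "has_func_deriv (\<lambda>u. c * F u + G u) u (\<lambda>x. c *\<^sub>R func_deriv F u x + func_deriv G u x)"
    by (intro has_func_deriv_linear_combination smooth_functional_deriv F G)
next
  fix u :: "state family" assume u: "compact_family u"
  show "asymp_family (\<lambda>s x. c *\<^sub>R func_deriv F (u s) x + func_deriv G (u s) x)"
    by (rule asymp_family_add[OF asymp_family_linear[OF bounded_linear_scaleR_right smooth_functional_family[OF F u]]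
          smooth_functional_family[OF G u]])
qed

lemma smooth_functional_product:
  assumes F: "F \<in> smooth_functionals" and G: "G \<in> smooth_functionals"
  shows "(\<lambda>u. F u * G u) \<in> smooth_functionals"
proof (rule smooth_functionalI)
  fix u assume "u \<in> fields"
  then show "has_func_deriv (\<lambda>u. F u * G u) u (\<lambda>x. F u *\<^sub>R func_deriv G u x + G u *\<^sub>R func_deriv F u x)"
    by (intro has_func_deriv_product smooth_functional_deriv F G)
next
  fix u :: "state family" assume u: "compact_family u"
  show "asymp_family (\<lambda>s x. F (u s) *\<^sub>R func_deriv G (u s) x + G (u s) *\<^sub>R func_deriv F (u s) x)"
    by (rule asymp_family_add[OF asymp_family_bilinear[OF bounded_bilinear_scaleR value_family[OF F u] smooth_functional_family[OF G u]]
          asymp_family_bilinear[OF bounded_bilinear_scaleR value_family[OF G u] smooth_functional_family[OF F u]]])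
qed

section \<open>The second variation\<close>

text \<open>The derivative of \<open>func_deriv F\<close> at \<open>u\<close> in the direction \<open>v\<close>, that is, the Hessian of \<open>F\<close> applied to one
  argument.\<close>

definition second_variation :: "functional \<Rightarrow> field \<Rightarrow> field \<Rightarrow> field" where
  "second_variation F u v x = vector_derivative (\<lambda>h. func_deriv F (\<lambda>y. u y + h *\<^sub>R v y) x) (at 0)"

text \<open>The direction is scaled by a fresh parameter \<open>N\<close>; the second variation is the derivative of this
  extended family with respect to \<open>s N\<close>, frozen at \<open>s N = 0\<close>.\<close>

lemma second_variation_family:
  assumes F: "F \<in> smooth_functionals" and u: "compact_family u" and v: "compact_family v"
  shows "asymp_family (\<lambda>s. second_variation F (u s) (v s))"
proof -
  have "finite_dependence (\<lambda>s. (u s, v s))"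
    using u v finite_dependence_comb[of u v Pair] by (simp add: compact_family_def)
  then obtain N where uv: "\<And>M s t. N \<le> M \<Longrightarrow> (u (s(M := t)), v (s(M := t))) = (u s, v s)"
    by (rule finite_dependence_bound) (rule that)
  have N: "u (s(N := t)) = u s" "v (s(N := t)) = v s" for s t
    using uv[of N s t] by simp_all
  define W where "W = (\<lambda>s. func_deriv F (\<lambda>y. u s y + s N *\<^sub>R v s y))"
  have "asymp_family W"
    unfolding W_def by (rule smooth_functional_family[OF F compact_family_line[OF u v]])
  then have "asymp_family (\<lambda>s. param_deriv N W (s(N := 0)))"
    by (intro asymp_family_reset asymp_family_param_deriv)
  moreover have "(\<lambda>s. param_deriv N W (s(N := 0))) = (\<lambda>s. second_variation F (u s) (v s))"
    by (intro ext) (simp add: N param_deriv_def second_variation_def W_def)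
  ultimately show ?thesis by simp
qed

lemma second_variation_asymp_const:
  assumes "F \<in> smooth_functionals" "u \<in> fields" "v \<in> fields"
  shows "asymp_const (second_variation F u v)"
  using asymp_const_slice[OF second_variation_family[OF assms(1) compact_family_field[OF assms(2)] compact_family_field[OF assms(3)]]] .

text \<open>Both sides are mixed second derivatives of \<open>F (u + h v + k w)\<close> at \<open>h = k = 0\<close>.\<close>

lemma second_variation_symmetric:
  assumes F: "F \<in> smooth_functionals" and u: "u \<in> fields" and v: "v \<in> fields" and w: "w \<in> fields"
  shows "(\<integral>x. second_variation F u v x \<bullet> w x \<partial>lborel) = (\<integral>x. second_variation F u w x \<bullet> v x \<partial>lborel)"
proof -
  \<comment> \<open>Parameters \<open>0\<close> and \<open>1\<close> are the coefficients of \<open>v\<close> and \<open>w\<close>.\<close>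
  define q :: "state family" where "q = (\<lambda>s y. (u y + s 0 *\<^sub>R v y) + s 1 *\<^sub>R w y)"
  have q: "compact_family q"
    unfolding q_def by (rule compact_family_line[OF compact_family_line[OF compact_family_field[OF u] compact_family_field[OF v]] compact_family_field[OF w]])
  define Q where "Q = (\<lambda>s. func_deriv F (q s))"
  have Q: "asymp_family Q" unfolding Q_def by (rule smooth_functional_family[OF F q])
  have V: "compact_family (\<lambda>s x. Q s x \<bullet> v x)" and W: "compact_family (\<lambda>s x. Q s x \<bullet> w x)"
    by (rule compact_family_inner[OF Q compact_family_field[OF v]], rule compact_family_inner[OF Q compact_family_field[OF w]])
  have dQ: "param_deriv i (\<lambda>s x. Q s x \<bullet> z x) s x = param_deriv i Q s x \<bullet> z x" if "z \<in> fields" for i z s x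
    using param_deriv_bilinear[OF bounded_bilinear_inner asymp_family_jointly_smooth[OF Q] compact_family_jointly_smooth[OF compact_family_field[OF that]], of i s x]
    by (simp add: param_deriv_def[of i "\<lambda>s. z"])
  define \<sigma> :: "real \<Rightarrow> real \<Rightarrow> nat \<Rightarrow> real" where "\<sigma> h k = (\<lambda>_. 0)(0 := h, 1 := k)" for h k
  have \<sigma>: "(\<sigma> h k)(0 := h') = \<sigma> h' k" "(\<sigma> h k)(1 := k') = \<sigma> h k'" for h k h' k'
    by (auto simp: \<sigma>_def)
  have q0: "q (\<sigma> h k) = (\<lambda>y. (u y + k *\<^sub>R w y) + h *\<^sub>R v y)" for h k
    by (auto simp: q_def \<sigma>_def)
  have q1: "q (\<sigma> h k) = (\<lambda>y. (u y + h *\<^sub>R v y) + k *\<^sub>R w y)" for h k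
    by (auto simp: q_def \<sigma>_def)
  have "((\<lambda>h. \<integral>x. Q (\<sigma> h 0) x \<bullet> w x \<partial>lborel) has_vector_derivative
      (\<integral>x. param_deriv 1 (\<lambda>s x. Q s x \<bullet> v x) (\<sigma> 0 0) x \<partial>lborel)) (at 0)"
  proof (rule mixed_derivatives_commute[where f = "\<lambda>h k. F (q (\<sigma> h k))"
        and ?f1.0 = "\<lambda>h k. \<integral>x. Q (\<sigma> h k) x \<bullet> v x \<partial>lborel"
        and ?f2.0 = "\<lambda>h k. \<integral>x. Q (\<sigma> h k) x \<bullet> w x \<partial>lborel"
        and ?f12.0 = "\<lambda>h k. \<integral>x. param_deriv 1 (\<lambda>s x. Q s x \<bullet> v x) (\<sigma> h k) x \<partial>lborel"])
    fix h k
    show "((\<lambda>h. F (q (\<sigma> h k))) has_vector_derivative (\<integral>x. Q (\<sigma> h k) x \<bullet> v x \<partial>lborel)) (at h)"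
      unfolding Q_def q0 by (rule functional_along_line[OF F fields_add_scaleR[OF u w] v])
    show "((\<lambda>k. F (q (\<sigma> h k))) has_vector_derivative (\<integral>x. Q (\<sigma> h k) x \<bullet> w x \<partial>lborel)) (at k)"
      unfolding Q_def q1 by (rule functional_along_line[OF F fields_add_scaleR[OF u v] w])
    show "((\<lambda>k. \<integral>x. Q (\<sigma> h k) x \<bullet> v x \<partial>lborel) has_vector_derivative
        (\<integral>x. param_deriv 1 (\<lambda>s x. Q s x \<bullet> v x) (\<sigma> h k) x \<partial>lborel)) (at k)"
      using integral_family_has_derivative_at[OF V, of "\<sigma> h k" 1 k UNIV] by (simp only: \<sigma>)
  next
    have "continuous_on UNIV (\<lambda>p. \<sigma> (fst p) (snd p))"
      unfolding \<sigma>_def by (intro cont_update continuous_intros)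
    then show "continuous_on UNIV (\<lambda>(h, k). \<integral>x. param_deriv 1 (\<lambda>s x. Q s x \<bullet> v x) (\<sigma> h k) x \<partial>lborel)"
      using continuous_on_compose2[OF integral_family_continuous[OF compact_family_param_deriv[OF V]], of UNIV "\<lambda>p. \<sigma> (fst p) (snd p)" 1]
      by (simp add: split_def)
  qed
  moreover have "((\<lambda>h. \<integral>x. Q (\<sigma> h 0) x \<bullet> w x \<partial>lborel) has_vector_derivative
      (\<integral>x. param_deriv 0 (\<lambda>s x. Q s x \<bullet> w x) (\<sigma> 0 0) x \<partial>lborel)) (at 0)"
    using integral_family_has_derivative_at[OF W, of "\<sigma> 0 0" 0 0 UNIV] by (simp only: \<sigma>)
  ultimately have "(\<integral>x. param_deriv 1 (\<lambda>s x. Q s x \<bullet> v x) (\<sigma> 0 0) x \<partial>lborel)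
      = (\<integral>x. param_deriv 0 (\<lambda>s x. Q s x \<bullet> w x) (\<sigma> 0 0) x \<partial>lborel)"
    by (rule vector_derivative_unique_at)
  moreover have "param_deriv 0 Q (\<sigma> 0 0) x = second_variation F u v x" for x
  proof -
    have "(\<sigma> 0 0)(0 := \<sigma> 0 0 0 + h) = \<sigma> h 0" for h by (auto simp: \<sigma>_def)
    then show ?thesis by (simp add: param_deriv_def second_variation_def Q_def q1)
  qed
  moreover have "param_deriv 1 Q (\<sigma> 0 0) x = second_variation F u w x" for x
  proof -
    have "(\<sigma> 0 0)(1 := \<sigma> 0 0 1 + h) = \<sigma> 0 h" for h by (auto simp: \<sigma>_def)
    then show ?thesis by (simp add: param_deriv_def second_variation_def Q_def q1)
  qed
  ultimately show ?thesis by (simp add: dQ[OF v] dQ[OF w])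
qed

section \<open>The Poisson bracket\<close>

text \<open>The vector field on the space of fields that \<open>G\<close> generates.\<close>

definition hamiltonian_field :: "functional \<Rightarrow> field \<Rightarrow> field" where
  "hamiltonian_field G u = ham_op (func_deriv G u)"

lemma hamiltonian_field_in_fields: "G \<in> smooth_functionals \<Longrightarrow> u \<in> fields \<Longrightarrow> hamiltonian_field G u \<in> fields"
  unfolding hamiltonian_field_def by (rule asymp_const_ham_op_field[OF func_deriv_asymp_const])

lemma hamiltonian_field_family: "G \<in> smooth_functionals \<Longrightarrow> compact_family u \<Longrightarrow> compact_family (\<lambda>s. hamiltonian_field G (u s))"
  unfolding hamiltonian_field_def by (rule compact_family_ham_op[OF smooth_functional_family])

lemma fd_component_eqs:
  "fd_B F u k = (\<lambda>x. comp_B (func_deriv F u x) $ k)" "fd_D F u k = (\<lambda>x. comp_D (func_deriv F u x) $ k)"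
  "fd_psi F u = (\<lambda>x. comp_psi (func_deriv F u x))" "fd_phi F u = (\<lambda>x. comp_phi (func_deriv F u x))"
  by (auto simp: fd_B_def fd_D_def fd_psi_def fd_phi_def)

lemma bracket_eq:
  assumes F: "F \<in> smooth_functionals" and G: "G \<in> smooth_functionals" and u: "u \<in> fields"
  shows "bracket F G u = (\<integral>x. func_deriv F u x \<bullet> hamiltonian_field G u x \<partial>lborel)"
proof -
  have f: "asymp_const (func_deriv F u)" and g: "asymp_const (func_deriv G u)"
    by (rule func_deriv_asymp_const[OF F u], rule func_deriv_asymp_const[OF G u])
  have sf: "smooth (func_deriv F u)" and sg: "smooth (func_deriv G u)"
    using f g by (auto simp: asymp_const_def)
  have "bracket F G u = (\<integral>x. func_deriv F u x \<bullet> proj_D_phi (ham_op (func_deriv G u) x)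
      - ham_op (func_deriv F u) x \<bullet> proj_D_phi (func_deriv G u x) \<partial>lborel)"
    unfolding bracket_def fd_component_eqs ham_op_components(2,4)[OF sf, symmetric] ham_op_components(2,4)[OF sg, symmetric]
    by (rule Bochner_Integration.integral_cong)
      (simp_all add: inner_state proj_D_phi_def sum_subtractf)
  then show ?thesis unfolding hamiltonian_field_def graded_parts[OF f g] .
qed

lemma bracket_components:
  assumes F: "F \<in> smooth_functionals" and G: "G \<in> smooth_functionals" and u: "u \<in> fields"
  shows "bracket F G u = (\<integral>x.
              (\<Sum>k\<in>UNIV. fd_B F u k x *
                  (- (\<Sum>i\<in>UNIV. \<Sum>j\<in>UNIV. levi_civita k i j * pd i (fd_D G u j) x)
                   - pd k (fd_phi G u) x))
            + fd_phi F u x * (- (\<Sum>k\<in>UNIV. pd k (fd_B G u k) x))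
            + (\<Sum>k\<in>UNIV. fd_D F u k x *
                  ((\<Sum>i\<in>UNIV. \<Sum>j\<in>UNIV. levi_civita k i j * pd i (fd_B G u j) x)
                   - pd k (fd_psi G u) x))
            + fd_psi F u x * (- (\<Sum>k\<in>UNIV. pd k (fd_D G u k) x)) \<partial>lborel)"
proof -
  have sg: "smooth (func_deriv G u)"
    using func_deriv_asymp_const[OF G u] by (simp add: asymp_const_def)
  show ?thesis
    unfolding bracket_eq[OF F G u] hamiltonian_field_def fd_component_eqs ham_op_components[OF sg, symmetric]
    by (rule Bochner_Integration.integral_cong) (simp_all add: inner_state)
qed

text \<open>The bracket is differentiated along \<open>u + h v\<close>. The term in which the derivative of \<open>G\<close> varies is
  integrated by parts, and the symmetry of the second variations then isolates the factor \<open>v\<close>.\<close>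

lemma bracket_func_deriv:
  assumes F: "F \<in> smooth_functionals" and G: "G \<in> smooth_functionals" and u: "u \<in> fields"
  shows "has_func_deriv (bracket F G) u
    (\<lambda>x. second_variation F u (hamiltonian_field G u) x - second_variation G u (hamiltonian_field F u) x)"
  unfolding has_func_deriv_def
proof (intro conjI ballI)
  note hF = hamiltonian_field_in_fields[OF F u] and hG = hamiltonian_field_in_fields[OF G u]
  note cF = asymp_const_cont[OF second_variation_asymp_const[OF F u hG]]
    and cG = asymp_const_cont[OF second_variation_asymp_const[OF G u hF]]
  show "continuous_on UNIV (\<lambda>x. second_variation F u (hamiltonian_field G u) x - second_variation G u (hamiltonian_field F u) x)"
    by (intro continuous_on_diff cF cG)
  fix v assume v: "v \<in> fields"
  define w :: "state family" where "w = (\<lambda>s x. u x + s 0 *\<^sub>R v x)"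
  have w: "compact_family w" unfolding w_def by (rule compact_family_line[OF compact_family_field[OF u] compact_family_field[OF v]])
  define f where "f = (\<lambda>s. func_deriv F (w s))"
  define g where "g = (\<lambda>s. func_deriv G (w s))"
  have f: "asymp_family f" and g: "asymp_family g"
    unfolding f_def g_def by (rule smooth_functional_family[OF F w], rule smooth_functional_family[OF G w])
  define z :: "nat \<Rightarrow> real" where "z = (\<lambda>_. 0)"
  have fz: "f z = func_deriv F u" and gz: "g z = func_deriv G u"
    by (simp_all add: f_def g_def w_def z_def)
  have df: "param_deriv 0 f z = second_variation F u v" and dg: "param_deriv 0 g z = second_variation G u v"
    by (auto simp: param_deriv_def second_variation_def f_def g_def w_def z_def)
  have I: "compact_family (\<lambda>s x. f s x \<bullet> ham_op (g s) x)"
    by (rule compact_family_inner[OF f compact_family_ham_op[OF g]])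
  have dI: "param_deriv 0 (\<lambda>s x. f s x \<bullet> ham_op (g s) x) z x
      = func_deriv F u x \<bullet> ham_op (second_variation G u v) x + second_variation F u v x \<bullet> hamiltonian_field G u x" for x
    unfolding param_deriv_bilinear[OF bounded_bilinear_inner asymp_family_jointly_smooth[OF f] compact_family_jointly_smooth[OF compact_family_ham_op[OF g]]]
      param_deriv_ham_op[OF asymp_family_jointly_smooth[OF g]]
    by (simp add: fz gz df dg hamiltonian_field_def)
  have d2F: "asymp_const (second_variation F u v)" and d2G: "asymp_const (second_variation G u v)"
    by (rule second_variation_asymp_const[OF F u v], rule second_variation_asymp_const[OF G u v])
  have "(\<integral>x. param_deriv 0 (\<lambda>s x. f s x \<bullet> ham_op (g s) x) z x \<partial>lborel)
      = (\<integral>x. func_deriv F u x \<bullet> ham_op (second_variation G u v) x \<partial>lborel)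
        + (\<integral>x. second_variation F u v x \<bullet> hamiltonian_field G u x \<partial>lborel)"
    unfolding dI
    by (rule Bochner_Integration.integral_add[OF
          integrable_inner_field[OF asymp_const_cont[OF func_deriv_asymp_const[OF F u]] asymp_const_ham_op_field[OF d2G]]
          integrable_inner_field[OF asymp_const_cont[OF d2F] hG]])
  also have "(\<integral>x. func_deriv F u x \<bullet> ham_op (second_variation G u v) x \<partial>lborel)
      = - (\<integral>x. second_variation G u v x \<bullet> hamiltonian_field F u x \<partial>lborel)"
    using asymp_const_ham_op_parts[OF func_deriv_asymp_const[OF F u] d2G] by (simp add: hamiltonian_field_def inner_commute)
  also have "- (\<integral>x. second_variation G u v x \<bullet> hamiltonian_field F u x \<partial>lborel) + (\<integral>x. second_variation F u v x \<bullet> hamiltonian_field G u x \<partial>lborel)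
      = (\<integral>x. second_variation F u (hamiltonian_field G u) x \<bullet> v x \<partial>lborel) - (\<integral>x. second_variation G u (hamiltonian_field F u) x \<bullet> v x \<partial>lborel)"
    using second_variation_symmetric[OF F u v hG] second_variation_symmetric[OF G u v hF] by simp
  also have "\<dots> = (\<integral>x. (second_variation F u (hamiltonian_field G u) x - second_variation G u (hamiltonian_field F u) x) \<bullet> v x \<partial>lborel)"
    using integrable_inner_field[OF cF v] integrable_inner_field[OF cG v] by (simp add: inner_diff_left)
  finally have e: "(\<integral>x. param_deriv 0 (\<lambda>s x. f s x \<bullet> ham_op (g s) x) z x \<partial>lborel) = \<dots>" .
  have b: "bracket F G (\<lambda>x. u x + h *\<^sub>R v x) = (\<integral>x. f (z(0 := z 0 + h)) x \<bullet> ham_op (g (z(0 := z 0 + h))) x \<partial>lborel)" for h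
    using bracket_eq[OF F G fields_add_scaleR[OF u v]] by (simp add: f_def g_def w_def z_def hamiltonian_field_def)
  show "((\<lambda>h. bracket F G (\<lambda>x. u x + h *\<^sub>R v x)) has_real_derivative
      (\<integral>x. (second_variation F u (hamiltonian_field G u) x - second_variation G u (hamiltonian_field F u) x) \<bullet> v x \<partial>lborel)) (at 0)"
    unfolding b e[symmetric] has_real_derivative_iff_has_vector_derivative
    by (rule integral_family_has_derivative[OF I])
qed

lemma smooth_functional_bracket:
  assumes F: "F \<in> smooth_functionals" and G: "G \<in> smooth_functionals"
  shows "bracket F G \<in> smooth_functionals"
proof (rule smooth_functionalI[OF bracket_func_deriv[OF F G]])
  fix u :: "state family" assume u: "compact_family u"
  have "asymp_family (\<lambda>s x. second_variation F (u s) (hamiltonian_field G (u s)) x + - second_variation G (u s) (hamiltonian_field F (u s)) x)"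
    by (rule asymp_family_add[OF second_variation_family[OF F u hamiltonian_field_family[OF G u]]
          asymp_family_linear[OF bounded_linear_minus[OF bounded_linear_ident] second_variation_family[OF G u hamiltonian_field_family[OF F u]]]])
  then show "asymp_family (\<lambda>s x. second_variation F (u s) (hamiltonian_field G (u s)) x - second_variation G (u s) (hamiltonian_field F (u s)) x)"
    by simp
qed

lemma bracket_bracket:
  assumes F: "F \<in> smooth_functionals" and G: "G \<in> smooth_functionals" and H: "H \<in> smooth_functionals"
    and u: "u \<in> fields"
  shows "bracket (bracket F G) H u
    = (\<integral>x. second_variation F u (hamiltonian_field G u) x \<bullet> hamiltonian_field H u x \<partial>lborel)
      - (\<integral>x. second_variation G u (hamiltonian_field F u) x \<bullet> hamiltonian_field H u x \<partial>lborel)"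
proof -
  note h = hamiltonian_field_in_fields[OF _ u]
  note c = asymp_const_cont[OF second_variation_asymp_const[OF _ u h]]
  show ?thesis
    unfolding bracket_eq[OF smooth_functional_bracket[OF F G] H u] func_deriv_eqI[OF bracket_func_deriv[OF F G u]]
    using integrable_inner_field[OF c[OF F G] h[OF H]] integrable_inner_field[OF c[OF G F] h[OF H]]
    by (simp add: inner_diff_left)
qed

text \<open>The three double brackets are differences of Hessians evaluated at pairs of Hamiltonian fields; each Hessian occurs
  twice, with opposite signs and exchanged arguments.\<close>

lemma bracket_jacobi:
  assumes F: "F \<in> smooth_functionals" and G: "G \<in> smooth_functionals" and H: "H \<in> smooth_functionals"
    and u: "u \<in> fields"
  shows "bracket (bracket F G) H u + bracket (bracket G H) F u + bracket (bracket H F) G u = 0"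
  using second_variation_symmetric[OF F u hamiltonian_field_in_fields[OF G u] hamiltonian_field_in_fields[OF H u]]
    second_variation_symmetric[OF G u hamiltonian_field_in_fields[OF F u] hamiltonian_field_in_fields[OF H u]]
    second_variation_symmetric[OF H u hamiltonian_field_in_fields[OF F u] hamiltonian_field_in_fields[OF G u]]
  by (simp add: bracket_bracket[OF F G H u] bracket_bracket[OF G H F u] bracket_bracket[OF H F G u])

lemma bracket_antisymmetric:
  assumes F: "F \<in> smooth_functionals" and G: "G \<in> smooth_functionals" and u: "u \<in> fields"
  shows "bracket F G u = - bracket G F u"
  using asymp_const_ham_op_parts[OF func_deriv_asymp_const[OF G u] func_deriv_asymp_const[OF F u]]
  by (simp add: bracket_eq[OF F G u] bracket_eq[OF G F u] hamiltonian_field_def inner_commute)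

lemma bracket_linear:
  assumes F: "F \<in> smooth_functionals" and G: "G \<in> smooth_functionals" and H: "H \<in> smooth_functionals"
    and u: "u \<in> fields"
  shows "bracket (\<lambda>u. c * F u + G u) H u = c * bracket F H u + bracket G H u"
proof -
  have d: "func_deriv (\<lambda>u. c * F u + G u) u = (\<lambda>x. c *\<^sub>R func_deriv F u x + func_deriv G u x)"
    by (intro func_deriv_eqI has_func_deriv_linear_combination smooth_functional_deriv F G u)
  note i = integrable_inner_field[OF asymp_const_cont[OF func_deriv_asymp_const[OF _ u]] hamiltonian_field_in_fields[OF H u]]
  show ?thesis
    unfolding bracket_eq[OF smooth_functional_linear_combination[OF F G] H u] bracket_eq[OF F H u] bracket_eq[OF G H u] d
    using i[OF F] i[OF G] by (simp add: inner_add_left)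
qed

lemma bracket_leibniz:
  assumes F: "F \<in> smooth_functionals" and G: "G \<in> smooth_functionals" and H: "H \<in> smooth_functionals"
    and u: "u \<in> fields"
  shows "bracket (\<lambda>u. F u * G u) H u = F u * bracket G H u + bracket F H u * G u"
proof -
  have d: "func_deriv (\<lambda>u. F u * G u) u = (\<lambda>x. F u *\<^sub>R func_deriv G u x + G u *\<^sub>R func_deriv F u x)"
    by (intro func_deriv_eqI has_func_deriv_product smooth_functional_deriv F G u)
  note i = integrable_inner_field[OF asymp_const_cont[OF func_deriv_asymp_const[OF _ u]] hamiltonian_field_in_fields[OF H u]]
  show ?thesis
    unfolding bracket_eq[OF smooth_functional_product[OF F G] H u] bracket_eq[OF F H u] bracket_eq[OF G H u] d
    using i[OF F] i[OF G] by (simp add: inner_add_left)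
qed

lemma poisson_bracket: "poisson_bracket_on fields smooth_functionals bracket"
  unfolding poisson_bracket_on_def
proof (intro conjI ballI allI)
  fix F G H c u
  assume F: "F \<in> smooth_functionals" and G: "G \<in> smooth_functionals" and H: "H \<in> smooth_functionals"
    and u: "u \<in> fields"
  show "bracket H (\<lambda>u. c * F u + G u) u = c * bracket H F u + bracket H G u"
    using bracket_antisymmetric[OF H smooth_functional_linear_combination[OF F G] u]
      bracket_antisymmetric[OF H F u] bracket_antisymmetric[OF H G u] bracket_linear[OF F G H u]
    by simp
qed (rule smooth_functional_linear_combination smooth_functional_product smooth_functional_bracket
    bracket_linear bracket_antisymmetric bracket_leibniz bracket_jacobi; assumption)+

section \<open>Local functionals\<close>

definition dir_deriv :: "('a::real_vector \<Rightarrow> 'b::real_normed_vector) \<Rightarrow> 'a \<Rightarrow> 'a \<Rightarrow> 'b" where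
  "dir_deriv a d z = vector_derivative (\<lambda>h. a (z + h *\<^sub>R d)) (at 0)"

text \<open>Smoothness is defined by partial derivatives along the basis; this extends it to arbitrary directions.\<close>

lemma has_derivative_dir_deriv:
  fixes a :: "'a::euclidean_space \<Rightarrow> 'b::real_normed_vector"
  assumes "smooth a"
  shows "(a has_derivative (\<lambda>d. dir_deriv a d z)) (at z)"
    and "dir_deriv a d z = (\<Sum>b\<in>Basis. (d \<bullet> b) *\<^sub>R dir_deriv a b z)"
    and "smooth (dir_deriv a d)"
proof -
  have e: "deriv_along (space_shift b) a = dir_deriv a b" for b
    by (auto simp: deriv_along_def dir_deriv_def space_shift_def)
  have D: "((\<lambda>h. a (p + h *\<^sub>R b)) has_vector_derivative dir_deriv a b p) (at 0)" "smooth (dir_deriv a b)"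
    if "b \<in> Basis" for b p
    using smooth_along_D[of "space_shift ` Basis" a "space_shift b"] assms that
    by (auto simp: smooth_iff e) (auto simp: space_shift_def)
  have F: "(a has_derivative (\<lambda>d. \<Sum>b\<in>Basis. (d \<bullet> b) *\<^sub>R dir_deriv a b z)) (at z)" for z
    by (rule has_derivative_continuous_partials) (use D in \<open>auto intro: smooth_cont\<close>)
  have eq: "dir_deriv a d z = (\<Sum>b\<in>Basis. (d \<bullet> b) *\<^sub>R dir_deriv a b z)" for d z
  proof -
    have "((\<lambda>h. z + h *\<^sub>R d) has_vector_derivative d) (at 0)"
      by (auto intro!: derivative_eq_intros)
    from vector_derivative_diff_chain_within[OF this has_derivative_at_withinI, of a]
    have "((\<lambda>h. a (z + h *\<^sub>R d)) has_vector_derivative (\<Sum>b\<in>Basis. (d \<bullet> b) *\<^sub>R dir_deriv a b z)) (at 0)"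
      using F[of z] by (simp add: o_def)
    then show ?thesis unfolding dir_deriv_def[of a d] by (rule vector_derivative_at)
  qed
  then show "dir_deriv a d z = (\<Sum>b\<in>Basis. (d \<bullet> b) *\<^sub>R dir_deriv a b z)" .
  show "(a has_derivative (\<lambda>d. dir_deriv a d z)) (at z)"
    using F[of z] by (simp only: eq[symmetric])
  have "smooth_along (space_shift ` Basis) (\<lambda>z. \<Sum>b\<in>Basis. (d \<bullet> b) *\<^sub>R dir_deriv a b z)"
    using D(2) unfolding smooth_iff by (intro smooth_along_sum smooth_along_linear[OF bounded_linear_scaleR_right]) auto
  moreover have "dir_deriv a d = (\<lambda>z. \<Sum>b\<in>Basis. (d \<bullet> b) *\<^sub>R dir_deriv a b z)"
    by (rule ext) (rule eq)
  ultimately show "smooth (dir_deriv a d)"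
    by (simp add: smooth_iff)
qed

lemma linear_dir_deriv: "smooth (a :: 'a::euclidean_space \<Rightarrow> 'b::real_normed_vector) \<Longrightarrow> linear (\<lambda>d. dir_deriv a d z)"
  by (rule has_derivative_linear[OF has_derivative_dir_deriv(1)])

lemma linear_functional_gradient:
  fixes L :: "'a::euclidean_space \<Rightarrow> real"
  assumes "linear L"
  shows "L v = (\<Sum>c\<in>Basis. L c *\<^sub>R c) \<bullet> v"
proof -
  have "L (\<Sum>c\<in>Basis. (v \<bullet> c) *\<^sub>R c) = (\<Sum>c\<in>Basis. (v \<bullet> c) * L c)"
    by (simp add: linear_sum[OF assms] linear_scale[OF assms])
  then show ?thesis
    by (simp only: euclidean_representation inner_sum_left inner_scaleR_left) (simp add: inner_commute mult.commute)
qed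

text \<open>Gradients of the density with respect to the value of the field and to its \<open>k\<close>-th spatial derivative.\<close>

definition field_gradient :: "density \<Rightarrow> space \<times> state \<times> (state^3) \<Rightarrow> state" where
  "field_gradient a z = (\<Sum>c\<in>Basis. dir_deriv a (0, c, 0) z *\<^sub>R c)"

definition jet_gradient :: "3 \<Rightarrow> density \<Rightarrow> space \<times> state \<times> (state^3) \<Rightarrow> state" where
  "jet_gradient k a z = (\<Sum>c\<in>Basis. dir_deriv a (0, 0, axis k c) z *\<^sub>R c)"

lemma linear_axis: "linear (axis k :: 'a::real_vector \<Rightarrow> 'a^3)"
  by (rule linearI) (auto simp: vec_eq_iff axis_def)

lemma dir_deriv_split:
  assumes a: "smooth a"
  shows "dir_deriv a (0, v, q) z = field_gradient a z \<bullet> v + (\<Sum>k\<in>UNIV. jet_gradient k a z \<bullet> q $ k)"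
proof -
  note L = linear_dir_deriv[OF a, of z]
  have 1: "dir_deriv a (0, v, 0) z = field_gradient a z \<bullet> v"
    unfolding field_gradient_def
  proof (rule linear_functional_gradient)
    have "linear (\<lambda>v. (0, v, 0) :: space \<times> state \<times> (state^3))" by (rule linearI) auto
    from linear_compose[OF this L] show "linear (\<lambda>v. dir_deriv a (0, v, 0) z)" by (simp add: o_def)
  qed
  have 2: "dir_deriv a (0, 0, axis k w) z = jet_gradient k a z \<bullet> w" for k w
    unfolding jet_gradient_def
  proof (rule linear_functional_gradient)
    have "linear (\<lambda>p. (0, 0, axis k p) :: space \<times> state \<times> (state^3))"
      by (rule linearI) (auto simp: linear_add[OF linear_axis] linear_scale[OF linear_axis])
    from linear_compose[OF this L] show "linear (\<lambda>p. dir_deriv a (0, 0, axis k p) z)" by (simp add: o_def)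
  qed
  have "((0, v, q) :: space \<times> state \<times> (state^3)) = (0, v, 0) + (\<Sum>k\<in>UNIV. (0, 0, axis k (q $ k)))"
    by (simp add: prod_eq_iff fst_sum snd_sum vec_eq_iff axis_def if_distrib cong: if_cong)
  then have "dir_deriv a (0, v, q) z = dir_deriv a (0, v, 0) z + (\<Sum>k\<in>UNIV. dir_deriv a (0, 0, axis k (q $ k)) z)"
    by (simp only: linear_add[OF L] linear_sum[OF L])
  then show ?thesis by (simp only: 1 2)
qed

lemma smooth_sum: "(\<And>i. i \<in> I \<Longrightarrow> smooth (f i)) \<Longrightarrow> smooth (\<lambda>x. \<Sum>i\<in>I. f i x)"
  by (simp add: smooth_iff smooth_along_sum)

lemma smooth_field_gradient: "smooth a \<Longrightarrow> smooth (field_gradient a)"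
  unfolding field_gradient_def[abs_def]
  by (intro smooth_sum smooth_bilinear[OF bounded_bilinear_scaleR] has_derivative_dir_deriv(3) smooth_const)

lemma smooth_jet_gradient: "smooth a \<Longrightarrow> smooth (jet_gradient k a)"
  unfolding jet_gradient_def[abs_def]
  by (intro smooth_sum smooth_bilinear[OF bounded_bilinear_scaleR] has_derivative_dir_deriv(3) smooth_const)

definition homogeneous_beyond :: "real \<Rightarrow> (space \<times> state \<times> (state^3) \<Rightarrow> 'b) \<Rightarrow> bool" where
  "homogeneous_beyond R b \<longleftrightarrow> (\<forall>x y w p. R \<le> norm x \<longrightarrow> R \<le> norm y \<longrightarrow> b (x, w, p) = b (y, w, p))"

lemma dir_deriv_homogeneous:
  assumes "homogeneous_beyond R a" "R \<le> norm x" "R \<le> norm y"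
  shows "dir_deriv a (0, c, q) (x, w, p) = dir_deriv a (0, c, q) (y, w, p)"
proof -
  have "a (x, w', p') = a (y, w', p')" for w' p'
    using assms unfolding homogeneous_beyond_def by blast
  then have "a ((x, w, p) + h *\<^sub>R (0, c, q)) = a ((y, w, p) + h *\<^sub>R (0, c, q))" for h
    by simp
  then show ?thesis by (simp only: dir_deriv_def)
qed

lemma homogeneous_gradients:
  assumes "homogeneous_beyond R a"
  shows "homogeneous_beyond R (field_gradient a)" "homogeneous_beyond R (jet_gradient k a)"
  unfolding homogeneous_beyond_def field_gradient_def jet_gradient_def
  by (intro allI impI sum.cong refl arg_cong2[of _ _ _ _ scaleR] dir_deriv_homogeneous[OF assms]; assumption)+

definition jet :: "field \<Rightarrow> space \<Rightarrow> space \<times> state \<times> (state^3)" where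
  "jet u x = (x, u x, (\<chi> k. pd k u x))"

lemma jointly_smooth_Pair: "jointly_smooth v \<Longrightarrow> jointly_smooth w \<Longrightarrow> jointly_smooth (\<lambda>s x. (v s x, w s x))"
  using jointly_smooth_add[OF jointly_smooth_linear[OF bounded_linear_Pair[OF bounded_linear_ident bounded_linear_zero], of v]
      jointly_smooth_linear[OF bounded_linear_Pair[OF bounded_linear_zero bounded_linear_ident], of w]]
  by simp

lemma jointly_smooth_vec:
  fixes w :: "3 \<Rightarrow> 'b::euclidean_space family"
  assumes "\<And>k. jointly_smooth (w k)"
  shows "jointly_smooth (\<lambda>s x. \<chi> k. w k s x)"
proof -
  have "bounded_linear (axis k :: 'b \<Rightarrow> 'b^3)" for k
    unfolding linear_conv_bounded_linear[symmetric] by (rule linear_axis)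
  then have "jointly_smooth (\<lambda>s x. \<Sum>k\<in>UNIV. axis k (w k s x))"
    by (rule jointly_smooth_sum[OF jointly_smooth_linear[OF _ assms]])
  moreover have "(\<Sum>k\<in>UNIV. axis k (w k s x)) = (\<chi> k. w k s x)" for s x
    by (simp add: vec_eq_iff axis_def if_distrib cong: if_cong)
  ultimately show ?thesis by simp
qed

lemma jointly_smooth_jet: "jointly_smooth u \<Longrightarrow> jointly_smooth (\<lambda>s. jet (u s))"
  unfolding jet_def[abs_def] by (intro jointly_smooth_Pair jointly_smooth_position jointly_smooth_vec jointly_smooth_pd)

lemma jet_beyond:
  assumes "vanishes_beyond R u" "R + 1 \<le> norm x"
  shows "jet u x = (x, 0, 0)"
  using assms pd_vanishes[OF vanishes_constant[OF assms(1)]]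
  by (auto simp: jet_def vanishes_beyond_def vec_eq_iff)

lemma density_family:
  assumes b: "smooth b" and u: "compact_family u"
  shows "finite_dependence (\<lambda>s x. b (jet (u s) x))" "jointly_smooth (\<lambda>s x. b (jet (u s) x))"
  using finite_dependence_map[of u "\<lambda>f x. b (jet f x)"] jointly_smooth_compose[OF b jointly_smooth_jet[OF compact_family_jointly_smooth[OF u]]] u
  by (simp_all add: compact_family_def)

text \<open>Near infinity the fields vanish together with their gradients, and \<open>b\<close> no longer depends on the position there.\<close>

lemma asymp_family_density_family:
  assumes b: "smooth b" and R: "homogeneous_beyond R b" and u: "compact_family u"
  shows "asymp_family (\<lambda>s x. b (jet (u s) x))"
  unfolding asymp_family_def
proof (intro conjI density_family[OF b u] locally_beyond_openI)
  fix s0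
  obtain R' U where U: "open U" "s0 \<in> U" "\<And>s. s \<in> U \<Longrightarrow> vanishes_beyond R' (u s)"
    using u locally_beyond_open[of vanishes_beyond u s0] unfolding compact_family_def by metis
  have "constant_beyond (max R (R' + 1)) (\<lambda>x. b (jet (u s) x))" if "s \<in> U" for s
    unfolding constant_beyond_def
  proof (intro allI impI)
    fix x y :: space assume xy: "max R (R' + 1) \<le> norm x" "max R (R' + 1) \<le> norm y"
    then have "b (x, 0, 0) = b (y, 0, 0)"
      using R unfolding homogeneous_beyond_def max.bounded_iff by blast
    then show "b (jet (u s) x) = b (jet (u s) y)"
      using jet_beyond[OF U(3)[OF that]] xy by simp
  qed
  then show "\<exists>R U. open U \<and> s0 \<in> U \<and> (\<forall>s\<in>U. constant_beyond R (\<lambda>x. b (jet (u s) x)))"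
    using U(1,2) by blast
qed

lemma compact_family_density_family:
  assumes b: "smooth b" and R: "\<And>x. R \<le> norm x \<Longrightarrow> b (x, 0, 0) = 0" and u: "compact_family u"
  shows "compact_family (\<lambda>s x. b (jet (u s) x))"
  unfolding compact_family_def
proof (intro conjI density_family[OF b u] locally_beyond_openI)
  fix s0
  obtain R' U where U: "open U" "s0 \<in> U" "\<And>s. s \<in> U \<Longrightarrow> vanishes_beyond R' (u s)"
    using u locally_beyond_open[of vanishes_beyond u s0] unfolding compact_family_def by metis
  have "vanishes_beyond (max R (R' + 1)) (\<lambda>x. b (jet (u s) x))" if "s \<in> U" for s
    using jet_beyond[OF U(3)[OF that]] R by (simp add: vanishes_beyond_def)
  then show "\<exists>R U. open U \<and> s0 \<in> U \<and> (\<forall>s\<in>U. vanishes_beyond R (\<lambda>x. b (jet (u s) x)))"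
    using U(1,2) by blast
qed

definition euler_lagrange :: "density \<Rightarrow> field \<Rightarrow> field" where
  "euler_lagrange a u x = field_gradient a (jet u x) - (\<Sum>k\<in>UNIV. pd k (\<lambda>x. jet_gradient k a (jet u x)) x)"

lemma admissible_densityD:
  assumes "admissible_density a"
  obtains R where "smooth a" "homogeneous_beyond R a" "\<And>x. R \<le> norm x \<Longrightarrow> a (x, 0, 0) = 0"
  using assms unfolding admissible_density_def homogeneous_beyond_def by blast

lemma euler_lagrange_family:
  assumes a: "admissible_density a" and u: "compact_family u"
  shows "asymp_family (\<lambda>s. euler_lagrange a (u s))"
proof -
  obtain R where s: "smooth a" and R: "homogeneous_beyond R a"
    using admissible_densityD[OF a] by metis
  have "asymp_family (\<lambda>s x. field_gradient a (jet (u s) x) + - (\<Sum>k\<in>UNIV. pd k (\<lambda>x. jet_gradient k a (jet (u s) x)) x))"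
    by (intro asymp_family_add asymp_family_linear[OF bounded_linear_minus[OF bounded_linear_ident]] compact_imp_asymp_family[OF compact_family_sum] compact_family_pd
        asymp_family_density_family[OF smooth_field_gradient[OF s] homogeneous_gradients(1)[OF R] u]
        asymp_family_density_family[OF smooth_jet_gradient[OF s] homogeneous_gradients(2)[OF R] u] finite)
  then show ?thesis by (simp add: euler_lagrange_def[abs_def])
qed

lemma jet_line:
  assumes "smooth u" "smooth v"
  shows "jet (\<lambda>x. u x + h *\<^sub>R v x) x = jet u x + h *\<^sub>R (0, v x, \<chi> k. pd k v x)"
proof -
  have "pd k (\<lambda>x. u x + h *\<^sub>R v x) x = pd k u x + h *\<^sub>R pd k v x" for k
    using pd_add[OF assms(1) smooth_linear[OF bounded_linear_scaleR_right assms(2)]]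
      pd_linear[OF bounded_linear_scaleR_right assms(2)] by simp
  then show ?thesis by (simp add: jet_def vec_eq_iff)
qed

text \<open>Differentiation under the integral, followed by an integration by parts in the terms that contain
  \<open>\<partial>\<^sub>k v\<close>.\<close>

lemma local_functional_has_func_deriv:
  assumes a: "admissible_density a" and u: "u \<in> fields"
  shows "has_func_deriv (local_functional a) u (euler_lagrange a u)"
  unfolding has_func_deriv_def
proof (intro conjI ballI)
  obtain R where s: "smooth a" and R: "homogeneous_beyond R a" "\<And>x. R \<le> norm x \<Longrightarrow> a (x, 0, 0) = 0"
    using admissible_densityD[OF a] by metis
  show "continuous_on UNIV (euler_lagrange a u)"
    by (rule asymp_const_cont[OF asymp_const_slice[OF euler_lagrange_family[OF a compact_family_field[OF u]]]])
  fix v assume v: "v \<in> fields"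
  have su: "smooth u" and sv: "smooth v" using u v by (auto simp: fields_iff)
  define z :: "nat \<Rightarrow> real" where "z = (\<lambda>_. 0)"
  define W where "W = (\<lambda>s x. a (jet (\<lambda>x. u x + s (0::nat) *\<^sub>R v x) x))"
  have W: "compact_family W"
    unfolding W_def by (rule compact_family_density_family[OF s R(2) compact_family_line[OF compact_family_field[OF u] compact_family_field[OF v]]])
  define g where "g = (\<lambda>x. field_gradient a (jet u x))"
  define p where "p = (\<lambda>k x. jet_gradient k a (jet u x))"
  have g: "asymp_const g" and p: "asymp_const (p k)" for k
    unfolding g_def p_def
    using asymp_const_slice[OF asymp_family_density_family[OF smooth_field_gradient[OF s] homogeneous_gradients(1)[OF R(1)] compact_family_field[OF u]]]
      asymp_const_slice[OF asymp_family_density_family[OF smooth_jet_gradient[OF s] homogeneous_gradients(2)[OF R(1)] compact_family_field[OF u]]]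
    by auto
  have dW: "param_deriv 0 W z x = g x \<bullet> v x + (\<Sum>k\<in>UNIV. p k x \<bullet> pd k v x)" for x
  proof -
    have "param_deriv 0 W z x = dir_deriv a (0, v x, \<chi> k. pd k v x) (jet u x)"
      by (simp only: param_deriv_def dir_deriv_def W_def jet_line[OF su sv]) (simp add: z_def)
    then show ?thesis by (simp add: dir_deriv_split[OF s] g_def p_def)
  qed
  have pdv: "pd k v \<in> fields" for k
    using compact_family_slice_field[OF compact_family_pd[OF compact_imp_asymp_family[OF compact_family_field[OF v]]]] .
  have pdp: "pd k (p k) \<in> fields" for k
    using p[of k] compact_family_slice_field[OF compact_family_pd[OF asymp_family_constant_family]] unfolding asymp_const_def by blast
  have parts: "(\<integral>x. p k x \<bullet> pd k v x \<partial>lborel) = - (\<integral>x. pd k (p k) x \<bullet> v x \<partial>lborel)" for k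
  proof -
    obtain R1 R2 where "constant_beyond R1 (p k)" "constant_beyond R2 v"
      using p[of k] fields_asymp_const[OF v] unfolding asymp_const_def by blast
    then have "constant_beyond (max R1 R2) (p k)" "constant_beyond (max R1 R2) v"
      using constant_beyond_mono max.cobounded1 max.cobounded2 by blast+
    then show ?thesis using integral_by_parts[of "p k" _ v k] p[of k] sv by (simp add: asymp_const_def)
  qed
  have ig: "integrable lborel (\<lambda>x. g x \<bullet> v x)" by (rule integrable_inner_field[OF asymp_const_cont[OF g] v])
  have ip: "integrable lborel (\<lambda>x. p k x \<bullet> pd k v x)" for k
    by (rule integrable_inner_field[OF asymp_const_cont[OF p] pdv])
  have iq: "integrable lborel (\<lambda>x. pd k (p k) x \<bullet> v x)" for k
    by (rule integrable_inner_field[OF asymp_const_cont[OF fields_asymp_const[OF pdp]] v])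
  have "(\<integral>x. param_deriv 0 W z x \<partial>lborel)
      = (\<integral>x. g x \<bullet> v x \<partial>lborel) + (\<Sum>k\<in>UNIV. \<integral>x. p k x \<bullet> pd k v x \<partial>lborel)"
    unfolding dW using ig ip by simp
  also have "\<dots> = (\<integral>x. g x \<bullet> v x \<partial>lborel) - (\<integral>x. (\<Sum>k\<in>UNIV. pd k (p k) x \<bullet> v x) \<partial>lborel)"
    using iq by (simp add: parts sum_negf)
  also have "\<dots> = (\<integral>x. g x \<bullet> v x - (\<Sum>k\<in>UNIV. pd k (p k) x \<bullet> v x) \<partial>lborel)"
    using ig iq by simp
  also have "\<dots> = (\<integral>x. euler_lagrange a u x \<bullet> v x \<partial>lborel)"
    by (simp add: euler_lagrange_def g_def p_def inner_diff_left inner_sum_left)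
  finally have e: "(\<integral>x. param_deriv 0 W z x \<partial>lborel) = (\<integral>x. euler_lagrange a u x \<bullet> v x \<partial>lborel)" .
  have b: "local_functional a (\<lambda>x. u x + h *\<^sub>R v x) = (\<integral>x. W (z(0 := z 0 + h)) x \<partial>lborel)" for h
    by (simp add: local_functional_def W_def jet_def z_def)
  show "((\<lambda>h. local_functional a (\<lambda>x. u x + h *\<^sub>R v x)) has_real_derivative
      (\<integral>x. euler_lagrange a u x \<bullet> v x \<partial>lborel)) (at 0)"
    unfolding b e[symmetric] has_real_derivative_iff_has_vector_derivative
    by (rule integral_family_has_derivative[OF W])
qed

lemma local_functional_smooth: "admissible_density a \<Longrightarrow> local_functional a \<in> smooth_functionals"
  by (rule smooth_functionalI[OF local_functional_has_func_deriv euler_lagrange_family])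

text \<open>Only the gradient with respect to the field value is left in the Euler-Lagrange expression.\<close>

lemma gradient_free_func_deriv:
  assumes a: "admissible_density a" and gf: "gradient_free a" and u: "u \<in> fields"
  shows "GDERIV (\<lambda>w. a (x, w, 0)) (u x) :> func_deriv (local_functional a) u x"
proof -
  obtain R where s: "smooth a" using admissible_densityD[OF a] by metis
  have gf': "a (x, w, p) = a (x, w, p')" for x w p p'
    using gf unfolding gradient_free_def by blast
  have "jet_gradient k a (x, w, p) = 0" for k x w p
  proof -
    have "a ((x, w, p) + h *\<^sub>R (0, 0, q)) = a (x, w, p)" for h q
      using gf'[of x w "p + h *\<^sub>R q" p] by simp
    then have "dir_deriv a (0, 0, q) (x, w, p) = 0" for q
      unfolding dir_deriv_def by simp
    then show ?thesis by (simp add: jet_gradient_def)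
  qed
  then have "func_deriv (local_functional a) u x = field_gradient a (jet u x)"
    unfolding func_deriv_eqI[OF local_functional_has_func_deriv[OF a u]] euler_lagrange_def
    by (simp add: jet_def pd_def)
  also have "\<dots> = field_gradient a (x, u x, 0)"
  proof -
    have "a ((x, u x, p) + h *\<^sub>R (0, c, 0)) = a ((x, u x, 0) + h *\<^sub>R (0, c, 0))" for p h c
      using gf'[of x "u x + h *\<^sub>R c" p 0] by simp
    then have "dir_deriv a (0, c, 0) (x, u x, p) = dir_deriv a (0, c, 0) (x, u x, 0)" for c p
      unfolding dir_deriv_def by (intro arg_cong[of _ _ "\<lambda>f. vector_derivative f (at 0)"] ext)
    then show ?thesis unfolding field_gradient_def jet_def by (intro sum.cong refl arg_cong2[of _ _ _ _ scaleR])
  qed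
  finally have e: "func_deriv (local_functional a) u x = field_gradient a (x, u x, 0)" .
  have "((\<lambda>w. (x, w, 0) :: space \<times> state \<times> (state^3)) has_derivative (\<lambda>h. (0, h, 0))) (at (u x))"
    by (auto intro!: derivative_eq_intros)
  from has_derivative_compose[OF this has_derivative_dir_deriv(1)[OF s]]
  have "((\<lambda>w. a (x, w, 0)) has_derivative (\<lambda>h. dir_deriv a (0, h, 0) (x, u x, 0))) (at (u x))" .
  then show ?thesis
    by (simp add: gderiv_def e dir_deriv_split[OF s] inner_commute)
qed

section \<open>The evolution equations\<close>

text \<open>Linear functionals are the test functionals for the evolution law.\<close>

lemma linear_functional_has_func_deriv:
  assumes d: "d \<in> fields" and u: "u \<in> fields"
  shows "has_func_deriv (\<lambda>u. \<integral>x. d x \<bullet> u x \<partial>lborel) u d"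
  unfolding has_func_deriv_def
proof (intro conjI ballI)
  show c: "continuous_on UNIV d" by (rule asymp_const_cont[OF fields_asymp_const[OF d]])
  fix v assume v: "v \<in> fields"
  have "(\<integral>x. d x \<bullet> (u x + h *\<^sub>R v x) \<partial>lborel) = (\<integral>x. d x \<bullet> u x \<partial>lborel) + h * (\<integral>x. d x \<bullet> v x \<partial>lborel)" for h
    using integrable_inner_field[OF c u] integrable_inner_field[OF c v] by (simp add: inner_add_right)
  then show "((\<lambda>h. \<integral>x. d x \<bullet> (u x + h *\<^sub>R v x) \<partial>lborel) has_real_derivative (\<integral>x. d x \<bullet> v x \<partial>lborel)) (at 0)"
    by (auto intro!: derivative_eq_intros)
qed

lemma linear_functional_smooth: "d \<in> fields \<Longrightarrow> (\<lambda>u. \<integral>x. d x \<bullet> u x \<partial>lborel) \<in> smooth_functionals"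
  by (rule smooth_functionalI[OF linear_functional_has_func_deriv compact_imp_asymp_family[OF compact_family_field]])

lemma dt_components:
  assumes "((\<lambda>\<tau>. q \<tau> x) has_vector_derivative v) (at t)"
  shows "dt_B q t k x = comp_B v $ k" "dt_D q t k x = comp_D v $ k"
    "dt_psi q t x = comp_psi v" "dt_phi q t x = comp_phi v"
proof -
  have "deriv (\<lambda>\<tau>. L (q \<tau> x)) t = L v" if "bounded_linear L" for L :: "state \<Rightarrow> real"
    using bounded_linear.has_vector_derivative[OF that assms]
    by (intro DERIV_imp_deriv) (simp add: has_real_derivative_iff_has_vector_derivative)
  from this[OF bounded_linear_comp_B] this[OF bounded_linear_comp_D]
    this[OF bounded_linear_comp_psi] this[OF bounded_linear_comp_phi]
  show "dt_B q t k x = comp_B v $ k" "dt_D q t k x = comp_D v $ k"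
    "dt_psi q t x = comp_psi v" "dt_phi q t x = comp_phi v"
    by (simp_all add: dt_B_def dt_D_def dt_psi_def dt_phi_def)
qed

text \<open>The evolution law for the linear functional with kernel \<open>d = v - X\<^sub>E\<close> says that \<open>\<integral> d \<bullet> d = 0\<close>.\<close>

lemma evolution_law:
  assumes E: "E \<in> smooth_functionals" and qt: "q t \<in> fields" and v: "v \<in> fields"
    and dq: "\<And>x. ((\<lambda>\<tau>. q \<tau> x) has_vector_derivative v x) (at t)"
    and law: "\<And>F. F \<in> smooth_functionals \<Longrightarrow> dt_functional F q t = bracket F E (q t)"
  shows "v x = hamiltonian_field E (q t) x"
proof -
  note h = hamiltonian_field_in_fields[OF E qt]
  define d where "d = (\<lambda>x. v x + (-1) *\<^sub>R hamiltonian_field E (q t) x)"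
  have d: "d \<in> fields" unfolding d_def by (rule fields_add_scaleR[OF v h])
  note cd = asymp_const_cont[OF fields_asymp_const[OF d]]
  define F where "F = (\<lambda>u. \<integral>x. d x \<bullet> u x \<partial>lborel)"
  have F: "F \<in> smooth_functionals" unfolding F_def by (rule linear_functional_smooth[OF d])
  have dF: "func_deriv F (q t) = d"
    unfolding F_def by (rule func_deriv_eqI[OF linear_functional_has_func_deriv[OF d qt]])
  have "dt_functional F q t = (\<integral>x. d x \<bullet> v x \<partial>lborel)"
    unfolding dt_functional_def fd_component_eqs dF dt_components[OF dq]
    by (rule Bochner_Integration.integral_cong) (simp_all add: inner_state)
  then have "(\<integral>x. d x \<bullet> v x \<partial>lborel) = (\<integral>x. d x \<bullet> hamiltonian_field E (q t) x \<partial>lborel)"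
    using law[OF F] by (simp add: bracket_eq[OF F E qt] dF)
  then have "(\<integral>x. d x \<bullet> d x \<partial>lborel) = 0"
    using integrable_inner_field[OF cd v] integrable_inner_field[OF cd h]
    by (simp add: d_def inner_diff_right)
  moreover obtain R where "vanishes_beyond R d" using d by (auto simp: fields_iff)
  ultimately have "d x \<bullet> d x = 0"
    by (intro nonneg_integral_zero[where R = R and f = "\<lambda>x. d x \<bullet> d x"] continuous_on_inner cd)
      (auto simp: vanishes_beyond_def)
  then show ?thesis by (simp add: d_def)
qed

lemma evolution_equations:
  assumes E: "E \<in> smooth_functionals" and ev: "field_evolution I q" and t: "t \<in> I"
    and law: "\<And>F. F \<in> smooth_functionals \<Longrightarrow> dt_functional F q t = bracket F E (q t)"
  shows "dt_B q t k x
          + (\<Sum>i\<in>UNIV. \<Sum>j\<in>UNIV. levi_civita k i j * pd i (fd_D E (q t) j) x)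
          + pd k (fd_phi E (q t)) x = 0"
    and "dt_phi q t x + (\<Sum>k\<in>UNIV. pd k (fd_B E (q t) k) x) = 0"
    and "dt_D q t k x
          - (\<Sum>i\<in>UNIV. \<Sum>j\<in>UNIV. levi_civita k i j * pd i (fd_B E (q t) j) x)
          + pd k (fd_psi E (q t)) x = 0"
    and "dt_psi q t x + (\<Sum>k\<in>UNIV. pd k (fd_D E (q t) k) x) = 0"
proof -
  obtain v where qt: "q t \<in> fields" and v: "v \<in> fields"
    and dq: "\<And>x. ((\<lambda>\<tau>. q \<tau> x) has_vector_derivative v x) (at t)"
    using ev t unfolding field_evolution_def by blast
  have "smooth (func_deriv E (q t))"
    using func_deriv_asymp_const[OF E qt] by (simp add: asymp_const_def)
  note c = ham_op_components[OF this, folded hamiltonian_field_def]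
  have vx: "v x = hamiltonian_field E (q t) x" by (rule evolution_law[OF E qt v dq law])
  note e = dt_components[OF dq]
  show "dt_B q t k x
          + (\<Sum>i\<in>UNIV. \<Sum>j\<in>UNIV. levi_civita k i j * pd i (fd_D E (q t) j) x)
          + pd k (fd_phi E (q t)) x = 0"
    "dt_phi q t x + (\<Sum>k\<in>UNIV. pd k (fd_B E (q t) k) x) = 0"
    "dt_D q t k x
          - (\<Sum>i\<in>UNIV. \<Sum>j\<in>UNIV. levi_civita k i j * pd i (fd_B E (q t) j) x)
          + pd k (fd_psi E (q t)) x = 0"
    "dt_psi q t x + (\<Sum>k\<in>UNIV. pd k (fd_D E (q t) k) x) = 0"
    by (simp_all add: e vx c fd_component_eqs)
qed

theorem mainTheorem4:
  shows
    "(\<forall>a. admissible_density a \<longrightarrow>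
        local_functional a \<in> smooth_functionals \<and>
        (gradient_free a \<longrightarrow>
          (\<forall>u\<in>fields. \<forall>x.
            GDERIV (\<lambda>w. a (x, w, 0)) (u x) :> func_deriv (local_functional a) u x)))
     \<and> poisson_bracket_on fields smooth_functionals bracket
     \<and> (\<forall>F\<in>smooth_functionals. \<forall>G\<in>smooth_functionals. \<forall>u\<in>fields.
          bracket F G u = (\<integral>x.
              (\<Sum>k\<in>UNIV. fd_B F u k x *
                  (- (\<Sum>i\<in>UNIV. \<Sum>j\<in>UNIV. levi_civita k i j * pd i (fd_D G u j) x)
                   - pd k (fd_phi G u) x))
            + fd_phi F u x * (- (\<Sum>k\<in>UNIV. pd k (fd_B G u k) x))
            + (\<Sum>k\<in>UNIV. fd_D F u k x *
                  ((\<Sum>i\<in>UNIV. \<Sum>j\<in>UNIV. levi_civita k i j * pd i (fd_B G u j) x)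
                   - pd k (fd_psi G u) x))
            + fd_psi F u x * (- (\<Sum>k\<in>UNIV. pd k (fd_D G u k) x)) \<partial>lborel))
     \<and> (\<forall>E\<in>smooth_functionals. \<forall>I q. field_evolution I q \<longrightarrow>
          (\<forall>t\<in>I. \<forall>F\<in>smooth_functionals. dt_functional F q t = bracket F E (q t)) \<longrightarrow>
          (\<forall>t\<in>I. \<forall>x.
              (\<forall>k. dt_B q t k x
                  + (\<Sum>i\<in>UNIV. \<Sum>j\<in>UNIV. levi_civita k i j * pd i (fd_D E (q t) j) x)
                  + pd k (fd_phi E (q t)) x = 0)
            \<and> dt_phi q t x + (\<Sum>k\<in>UNIV. pd k (fd_B E (q t) k) x) = 0
            \<and> (\<forall>k. dt_D q t k x
                  - (\<Sum>i\<in>UNIV. \<Sum>j\<in>UNIV. levi_civita k i j * pd i (fd_B E (q t) j) x)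
                  + pd k (fd_psi E (q t)) x = 0)
            \<and> dt_psi q t x + (\<Sum>k\<in>UNIV. pd k (fd_D E (q t) k) x) = 0))"
proof (intro conjI)
  show "\<forall>a. admissible_density a \<longrightarrow> local_functional a \<in> smooth_functionals \<and>
      (gradient_free a \<longrightarrow> (\<forall>u\<in>fields. \<forall>x.
        GDERIV (\<lambda>w. a (x, w, 0)) (u x) :> func_deriv (local_functional a) u x))"
    using local_functional_smooth gradient_free_func_deriv by blast
  show "poisson_bracket_on fields smooth_functionals bracket"
    by (rule poisson_bracket)
qed (blast intro: bracket_components,
    (intro ballI allI impI conjI; rule evolution_equations, assumption+, blast))

end
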